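(* Let $\mathcal M'$ be an effective dual $t$-motive which is free of rank $r$ over $\overline K[t]$ with basis $m_1,\dots,m_r$ and free of rank $d$ over $\overline K[\sigma]$ with basis $w_1,\dots,w_d$, let $\Phi'\in\mathrm{Mat}_r(\overline K[t])$ be the matrix with $\sigma m_i=\sum_j\Phi'_{ij}m_j$, and let $E'$ be the Anderson $t$-module associated to $\mathcal M'$ (with maps $\delta_0,\delta_1$ as in the context). Let $\mathbf f=(f_1,\dots,f_r)\in\mathrm{Mat}_{1\times r}(\overline K[t])$, put $$\Phi=\begin{pmatrix}\Phi'&0\\ \mathbf f&1\end{pmatrix}\in \mathrm{Mat}_{r+1}(\overline K[t]),$$ and let $\Psi=\begin{pmatrix}\Psi'&0\\ \Psi_{r+1}&1\end{pmatrix}\in\mathrm{GL}_{r+1}(\mathbb L)$ (with $\Psi_{r+1}\in\mathrm{Mat}_{1\times r}(\mathbb L)$) satisfy $\Psi^{(-1)}=\Phi\Psi$ and $\Upsilon:=\Psi^{-1}=\begin{pmatrix}\Upsilon'&0\\ \Upsilon_{r+1}&1\end{pmatrix}\in\mathrm{Mat}_{r+1}(\mathbb T)$, with $\Upsilon_{r+1}\in\mathrm{Mat}_{1\times r}(\mathbb T)$. Put $\mathbf v_{\mathcal M}:=\delta_1(\mathbf f^\top)=\delta_1(f_1m_1+\dots+f_rm_r)\in E'(\overline K)$. Let $F\in\mathbb F_q[t]$ be such that $F\Psi\in\mathrm{Mat}_{r+1}(\mathbb T)$, and suppose that $F\Psi_{r+1}^{(k)}$ converges to $0$ (in the Gauss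 norm) as $k\to\infty$. Then: (a) (a1) the point $\delta_0(\mathbf f^\top-\Upsilon_{r+1}^\top)$ is a Stark unit for $E'$; (a2) we have the Stark logarithmic identity $\mathrm{Log}^{St}_{E'}(\mathbf v_{\mathcal M})=\delta_0(\mathbf f^\top-\Upsilon_{r+1}^\top)$. (b) Suppose moreover that there is a finite collection of triples $(\ell_i,n_i,\mathbf u_i=(u_{i,1},\dots,u_{i,d})^\top)\in\mathbb Z^{\ge0}\times\mathbb Z^{\ge0}\times\mathbb C_\infty^d$, each $\mathbf u_i$ lying in the domain of convergence of $\mathrm{Log}_{E'}$, such that $$f_1m_1+\dots+f_rm_r=\sum_i t^{n_i}\sigma^{\ell_i}\Big(\sum_{j=1}^d u_{i,j}w_j\Big).$$ Then we have the split-logarithmic identity $\mathrm{Log}^!_{E'}(\mathbf v_{\mathcal M})=\delta_0(\mathbf f^\top-\Upsilon_{r+1}^\top)$. Finally, if in addition $\delta_0(\mathbf f^\top)=0$, then the right-hand sides in (a) and (b) equal $\delta_0(-\Upsilon_{r+1}^\top)$.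
   Context: Notation: $\mathbb F_q$ is a finite field with $q$ elements, $A=\mathbb F_q[\theta]$, $K=\mathbb F_q(\theta)$, $K_\infty=\mathbb F_q((1/\theta))$ with absolute value $|\cdot|_\infty$ normalized by $|\theta|_\infty=q$, $\mathbb C_\infty$ is the completion of an algebraic closure of $K_\infty$, and $\overline K$ is the algebraic closure of $K$ in $\mathbb C_\infty$. $t$ and $z$ are further independent variables. $\mathbb T$ is the Tate algebra of power series $\sum_{i\ge0}b_it^i$ with $b_i\in\mathbb C_\infty$, $|b_i|_\infty\to0$, with Gauss norm $\|\sum b_it^i\|=\max_i|b_i|_\infty$ (extended to matrices by the maximum over entries), and $\mathbb L$ is its fraction field; $\mathbb T_z(\mathbb C_\infty)$ is the analogous Tate algebra in $z$. For $i\in\mathbb Z$ and $g=\sum_jc_jt^j$ put $g^{(i)}=\sum_jc_j^{q^i}t^j$ (extended entrywise to matrices and to $\mathbb L$; for $\mathbf x\in\mathbb C_\infty^d$, $\mathbf x^{(i)}$ raises entries to the $q^i$-th power). Rings: $\overline K[t,\sigma]$ is the ring generated by $\overline K$, $t$, $\sigma$ with $t$ central and $\sigma c=c^{1/q}\sigma$ for $c\in\overline K$; $\overline K[\sigma]$ its subring. An effective dual $t$-motive is a left $\overline K[t,\sigma]$-module $\mathcal M'$, free and finitely generated over $\overline K[t]$, with $(t-\theta)^\ell(\mathcal M'/\sigma\mathcal M')=0$ for $\ell\gg0$. We identify $(g_1,\dots,g_r)^\top\in\overline K[t]^r$ with $\sum g_im_i\in\mathcal M'$. Maps $\delta_0,\delta_1$: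 every $m\in\mathcal M'$ is uniquely a finite sum $m=\sum_{i\ge0}\sum_{j=1}^dc_{i,j}\sigma^iw_j$ with $c_{i,j}\in\overline K$; set $\delta_0(m)=(c_{0,1},\dots,c_{0,d})^\top$ and $\delta_1(m)=\sum_{i\ge0}(c_{i,1}^{q^i},\dots,c_{i,d}^{q^i})^\top$, and $\delta_{1,z}(m)=\sum_i(c_{i,1}^{q^i},\dots,c_{i,d}^{q^i})^\top z^i$. $\delta_1$ induces an isomorphism $\mathcal M'/(\sigma-1)\mathcal M'\cong\overline K^d$. The map $\delta_0$ is $\overline K$-linear and factors through $\mathcal M'/(t-\theta)^N\mathcal M'$ for $N$ large; it is extended in the natural way to $\mathcal M'\otimes_{\overline K[t]}\mathbb T\cong\mathbb T^r$ (concretely, for column vectors of functions analytic near $t=\theta$, by extending $\mathbb C_\infty$-linearly and replacing each entry by its Taylor expansion at $t=\theta$ truncated to order $N$). Anderson $t$-modules: an $\mathbb F_q$-algebra homomorphism $E:A\to\mathrm{Mat}_d(\overline K)[\tau]$ (where $\tau c=c^q\tau$), $E_a=d[a]+\sum_{k\ge1}E_{a,k}\tau^k$ with $d[a]-aI_d$ nilpotent; $E_a$ acts on $\mathbb C_\infty^d$ by $\mathbf x\mapsto d[a]\mathbf x+\sum_kE_{a,k}\mathbf x^{(k)}$. The Anderson $t$-module $E'$ associated to $\mathcal M'$ is the one with $E'_a(\delta_1(m))=\delta_1(a(t)m)$ for $a\in A$, $m\in\mathcal M'$, where $a(t)$ is $a$ with $\theta$ replaced by $t$. $\mathrm{Exp}_{E'}=\sum_iQ_i\tau^i$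 ($Q_0=I_d$) is the unique such series with $\mathrm{Exp}_{E'}d[a]=E'_a\mathrm{Exp}_{E'}$ for all $a\in A$ (it converges on all of $\mathbb C_\infty^d$); $\mathrm{Log}_{E'}=\sum_iP_i\tau^i$ is its formal inverse, and its domain of convergence is the set of $\mathbf u\in\mathbb C_\infty^d$ for which $\sum_iP_i\mathbf u^{(i)}$ converges. The $z$-deformation: $\widetilde E'_a=\sum_kE'_{a,k}z^k\tau^k$, $\mathrm{Exp}_{\widetilde E'}=\sum_iQ_iz^i\tau^i$, $\mathrm{Log}_{\widetilde E'}=\sum_iP_iz^i\tau^i$, acting on $\mathbb T_z(\mathbb C_\infty)^d$ ($\tau$ fixes $z$). Stark units: for $\mathbf z\in\mathbb C_\infty^d$ put $\mathbf Z=\mathrm{Exp}_{E'}(\mathbf z)$. $\mathbf z$ is a Stark unit for $E'$ if $\mathbf z=\mathbf x|_{z=1}$ for some $\mathbf x\in\mathbb T_z(\mathbb C_\infty)^d$ with $\mathrm{Exp}_{\widetilde E'}(\mathbf x)\in\overline K[z]^d$; one then writes $\mathrm{Log}^{St}_{E'}(\mathbf Z)=\mathbf z$ (Stark logarithmic identity). A split-logarithmic identity $\mathrm{Log}^!_{E'}(\mathbf Z)=\mathbf z$ (for $\mathbf z,\mathbf Z\in\mathbb C_\infty^d$) means there is a finite collection $(a_i,\mathbf u_i)\in A\times\mathbb C_\infty^d$, each $\mathbf u_i$ in the domain of convergence of $\mathrm{Log}_{E'}$, with $\mathbf z=\sum_id[a_i]\mathrm{Log}_{E'}(\mathbf u_i)$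 and $\mathbf Z=\sum_iE'_{a_i}\mathbf u_i$. *)

theory Defs
  imports "HOL-Analysis.Analysis" "HOL-Computational_Algebra.Computational_Algebra"
begin

text \<open>
  The finite field \<open>\<F>\<^sub>q\<close> is a subset \<open>Fq\<close> of \<open>\<C>\<^sub>\<infinity>\<close>, with \<open>q = card Fq\<close>. An element \<open>a(\<theta>)\<close> of
  \<open>A = \<F>\<^sub>q[\<theta>]\<close> is represented by the polynomial \<open>a(t)\<close> with coefficients in \<open>Fq\<close>; as
  \<open>\<theta>\<close> is transcendental over \<open>\<F>\<^sub>q\<close>, nothing is lost.
\<close>

section \<open>The fields\<close>

definition is_subfield :: "'a::field set \<Rightarrow> bool" where
  "is_subfield S \<longleftrightarrow> 0 \<in> S \<and> 1 \<in> S \<and> (\<forall>x\<in>S. \<forall>y\<in>S. x - y \<in> S \<and> x * y \<in> S) \<and> (\<forall>x\<in>S. inverse x \<in> S)"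

definition polys_over :: "'a::zero set \<Rightarrow> 'a poly set" where
  "polys_over S = {p. \<forall>n. coeff p n \<in> S}"

definition algebraic_closure_in :: "'a::field set \<Rightarrow> 'a set" where
  "algebraic_closure_in S = {x. \<exists>p\<in>polys_over S. p \<noteq> 0 \<and> poly p x = 0}"

definition Kfield :: "'c::field set \<Rightarrow> 'c \<Rightarrow> 'c set" where
  "Kfield Fq \<theta> = {poly a \<theta> / poly b \<theta> | a b. a \<in> polys_over Fq \<and> b \<in> polys_over Fq \<and> poly b \<theta> \<noteq> 0}"

definition Kbar :: "'c::field set \<Rightarrow> 'c \<Rightarrow> 'c set" where
  "Kbar Fq \<theta> = algebraic_closure_in (Kfield Fq \<theta>)"

definition K_infty :: "'c::{field,metric_space} set \<Rightarrow> 'c \<Rightarrow> 'c set" where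
  "K_infty Fq \<theta> = {x. \<exists>(N::int) c. (\<forall>n. c n \<in> Fq) \<and> (\<lambda>n. c n * \<theta> powi (N - int n)) sums x}"

definition absval :: "'c::{field,metric_space} \<Rightarrow> real" where
  "absval x = dist x 0"

text \<open>
  The type \<open>'c\<close> is the completion of an algebraic closure of \<open>\<F>\<^sub>q((1/\<theta>))\<close>: a complete
  non-archimedean valued field containing that Laurent series field, in which the elements
  algebraic over it form an algebraically closed dense subset.
\<close>

locale c_infinity =
  fixes Fq :: "'c::{field,metric_space} set" and \<theta> :: 'c
  assumes Fq: "is_subfield Fq" "finite Fq"
    and dist_eq: "dist x y = absval (x - y :: 'c)"
    and absval_mult: "absval (x * y :: 'c) = absval x * absval y"
    and absval_add: "absval (x + y :: 'c) \<le> max (absval x) (absval y)"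
    and absval_theta: "absval \<theta> = real (card Fq)"
    and complete: "complete (UNIV :: 'c set)"
    and alg_closed: "p \<in> polys_over (algebraic_closure_in (K_infty Fq \<theta>)) \<Longrightarrow> degree p > 0 \<Longrightarrow>
           \<exists>x \<in> algebraic_closure_in (K_infty Fq \<theta>). poly p x = 0"
    and dense: "closure (algebraic_closure_in (K_infty Fq \<theta>)) = UNIV"


section \<open>Frobenius twists\<close>

text \<open>\<open>frob q i\<close> is \<open>x \<mapsto> x\<^bsup>q^i\<^esup>\<close> for \<open>i \<in> \<int>\<close>; roots are unique in characteristic \<open>p\<close>.\<close>

definition frob :: "nat \<Rightarrow> int \<Rightarrow> 'c::field \<Rightarrow> 'c" where
  "frob q i x = (if 0 \<le> i then x ^ (q ^ nat i) else (THE y. y ^ (q ^ nat (- i)) = x))"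

definition frob_vec :: "nat \<Rightarrow> int \<Rightarrow> 'c::field ^ 'n \<Rightarrow> 'c ^ 'n" where
  "frob_vec q i x = (\<chi> j. frob q i (x $ j))"

definition frob_fls :: "nat \<Rightarrow> int \<Rightarrow> 'c::field fls \<Rightarrow> 'c fls" where
  "frob_fls q i g = Abs_fls (\<lambda>n. frob q i (fls_nth g n))"


section \<open>Tate algebra\<close>

definition tate :: "'c::{field,metric_space} fps set" where
  "tate = {g. (\<lambda>n. absval (fps_nth g n)) \<longlonglongrightarrow> 0}"

text \<open>The fraction field of the Tate algebra, inside \<open>\<C>\<^sub>\<infinity>((t))\<close>; the twist is coefficientwise there.\<close>

definition tate_frac :: "'c::{field,metric_space} fls set" where
  "tate_frac = {fps_to_fls a / fps_to_fls b | a b. a \<in> tate \<and> b \<in> tate \<and> b \<noteq> 0}"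

definition gauss_norm :: "'c::{field,metric_space} fls \<Rightarrow> real" where
  "gauss_norm g = (SUP n. absval (fls_nth g n))"

definition gauss_norm_vec :: "'c::{field,metric_space} fls ^ 'n::finite \<Rightarrow> real" where
  "gauss_norm_vec v = (MAX j. gauss_norm (v $ j))"

definition fls_of_poly :: "'c::field poly \<Rightarrow> 'c fls" where
  "fls_of_poly p = fps_to_fls (fps_of_poly p)"

text \<open>
  The block matrix with rows \<open>(X, 0)\<close> and \<open>(x, 1)\<close>. The index type \<open>'r option\<close> has \<open>r + 1\<close> elements,
  \<open>None\<close> being the last index.
\<close>

definition block :: "'a::zero_neq_one ^ 'r ^ 'r \<Rightarrow> 'a ^ 'r \<Rightarrow> 'a ^ 'r option ^ 'r option" where
  "block X x = (\<chi> i j. case i of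
       Some i' \<Rightarrow> (case j of Some j' \<Rightarrow> X $ i' $ j' | None \<Rightarrow> 0)
     | None \<Rightarrow> (case j of Some j' \<Rightarrow> x $ j' | None \<Rightarrow> 1))"


section \<open>Dual t-motives\<close>

text \<open>
  A left \<open>\<K>[t,\<sigma>]\<close>-module for \<open>\<K>\<close> the algebraic closure of \<open>K\<close>, given by the actions of \<open>\<K>\<close>, \<open>t\<close>
  and \<open>\<sigma>\<close>. The value of \<open>smul\<close> at scalars outside \<open>\<K>\<close> is irrelevant.
\<close>

record ('c, 'm) tsigma_ops =
  smul :: "'c \<Rightarrow> 'm \<Rightarrow> 'm"
  tmul :: "'m \<Rightarrow> 'm"
  sigma :: "'m \<Rightarrow> 'm"

locale tsigma_module =
  fixes Fq :: "'c::{field,metric_space} set" and \<theta> :: 'c and M :: "('c, 'm::ab_group_add) tsigma_ops"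
  assumes smul_add_right: "c \<in> Kbar Fq \<theta> \<Longrightarrow> smul M c (x + y) = smul M c x + smul M c y"
    and smul_add_left: "c \<in> Kbar Fq \<theta> \<Longrightarrow> c' \<in> Kbar Fq \<theta> \<Longrightarrow> smul M (c + c') x = smul M c x + smul M c' x"
    and smul_mult: "c \<in> Kbar Fq \<theta> \<Longrightarrow> c' \<in> Kbar Fq \<theta> \<Longrightarrow> smul M (c * c') x = smul M c (smul M c' x)"
    and smul_one: "smul M 1 x = x"
    and tmul_add: "tmul M (x + y) = tmul M x + tmul M y"
    and tmul_smul: "c \<in> Kbar Fq \<theta> \<Longrightarrow> tmul M (smul M c x) = smul M c (tmul M x)"
    and sigma_add: "sigma M (x + y) = sigma M x + sigma M y"
    and sigma_smul: "c \<in> Kbar Fq \<theta> \<Longrightarrow> sigma M (smul M c x) = smul M (frob (card Fq) (- 1) c) (sigma M x)"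
    and sigma_tmul: "sigma M (tmul M x) = tmul M (sigma M x)"

definition poly_act :: "('c::zero, 'm::ab_group_add) tsigma_ops \<Rightarrow> 'c poly \<Rightarrow> 'm \<Rightarrow> 'm" where
  "poly_act M p x = (\<Sum>i\<le>degree p. smul M (coeff p i) ((tmul M ^^ i) x))"

definition t_expansion ::
  "'c::{field,metric_space} set \<Rightarrow> 'c \<Rightarrow> ('c, 'm::ab_group_add) tsigma_ops \<Rightarrow> 'i set \<Rightarrow> ('i \<Rightarrow> 'm) \<Rightarrow> ('i \<Rightarrow> 'c poly) \<Rightarrow> 'm \<Rightarrow> bool" where
  "t_expansion Fq \<theta> M I b g x \<longleftrightarrow>
     (\<forall>i\<in>I. g i \<in> polys_over (Kbar Fq \<theta>)) \<and> (\<forall>i. i \<notin> I \<longrightarrow> g i = 0) \<and> x = (\<Sum>i\<in>I. poly_act M (g i) (b i))"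

definition is_t_basis ::
  "'c::{field,metric_space} set \<Rightarrow> 'c \<Rightarrow> ('c, 'm::ab_group_add) tsigma_ops \<Rightarrow> 'i set \<Rightarrow> ('i \<Rightarrow> 'm) \<Rightarrow> bool" where
  "is_t_basis Fq \<theta> M I b \<longleftrightarrow> finite I \<and> (\<forall>x. \<exists>!g. t_expansion Fq \<theta> M I b g x)"

definition effective_dual_t_motive ::
  "'c::{field,metric_space} set \<Rightarrow> 'c \<Rightarrow> ('c, 'm::ab_group_add) tsigma_ops \<Rightarrow> bool" where
  "effective_dual_t_motive Fq \<theta> M \<longleftrightarrow> tsigma_module Fq \<theta> M \<and>
     (\<exists>(n::nat) b. is_t_basis Fq \<theta> M {..<n} b) \<and>
     (\<exists>L. \<forall>l\<ge>L. \<forall>x. poly_act M ([:- \<theta>, 1:] ^ l) x \<in> range (sigma M))"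

definition t_coords ::
  "'c::{field,metric_space} set \<Rightarrow> 'c \<Rightarrow> ('c, 'm::ab_group_add) tsigma_ops \<Rightarrow> ('r::finite \<Rightarrow> 'm) \<Rightarrow> 'm \<Rightarrow> 'c poly ^ 'r" where
  "t_coords Fq \<theta> M m x = (\<chi> i. (THE g. t_expansion Fq \<theta> M UNIV m g x) i)"

text \<open>\<open>c i $ j\<close> is the coefficient of \<open>\<sigma>\<^sup>i w\<^sub>j\<close>.\<close>

definition sigma_expansion ::
  "'c::{field,metric_space} set \<Rightarrow> 'c \<Rightarrow> ('c, 'm::ab_group_add) tsigma_ops \<Rightarrow> ('d::finite \<Rightarrow> 'm) \<Rightarrow> (nat \<Rightarrow> 'c ^ 'd) \<Rightarrow> 'm \<Rightarrow> bool" where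
  "sigma_expansion Fq \<theta> M w c x \<longleftrightarrow>
     (\<forall>i j. c i $ j \<in> Kbar Fq \<theta>) \<and> finite {i. c i \<noteq> 0} \<and>
     x = (\<Sum>i | c i \<noteq> 0. \<Sum>j\<in>UNIV. smul M (c i $ j) ((sigma M ^^ i) (w j)))"

definition is_sigma_basis ::
  "'c::{field,metric_space} set \<Rightarrow> 'c \<Rightarrow> ('c, 'm::ab_group_add) tsigma_ops \<Rightarrow> ('d::finite \<Rightarrow> 'm) \<Rightarrow> bool" where
  "is_sigma_basis Fq \<theta> M w \<longleftrightarrow> (\<forall>x. \<exists>!c. sigma_expansion Fq \<theta> M w c x)"

definition sigma_coeffs ::
  "'c::{field,metric_space} set \<Rightarrow> 'c \<Rightarrow> ('c, 'm::ab_group_add) tsigma_ops \<Rightarrow> ('d::finite \<Rightarrow> 'm) \<Rightarrow> 'm \<Rightarrow> nat \<Rightarrow> 'c ^ 'd" where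
  "sigma_coeffs Fq \<theta> M w x = (THE c. sigma_expansion Fq \<theta> M w c x)"

definition delta0 ::
  "'c::{field,metric_space} set \<Rightarrow> 'c \<Rightarrow> ('c, 'm::ab_group_add) tsigma_ops \<Rightarrow> ('d::finite \<Rightarrow> 'm) \<Rightarrow> 'm \<Rightarrow> 'c ^ 'd" where
  "delta0 Fq \<theta> M w x = sigma_coeffs Fq \<theta> M w x 0"

definition delta1 ::
  "'c::{field,metric_space} set \<Rightarrow> 'c \<Rightarrow> ('c, 'm::ab_group_add) tsigma_ops \<Rightarrow> ('d::finite \<Rightarrow> 'm) \<Rightarrow> 'm \<Rightarrow> 'c ^ 'd" where
  "delta1 Fq \<theta> M w x =
     (\<Sum>i | sigma_coeffs Fq \<theta> M w x i \<noteq> 0. frob_vec (card Fq) (int i) (sigma_coeffs Fq \<theta> M w x i))"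

text \<open>
  Extension of \<open>\<delta>\<^sub>0\<close> to columns of power series converging at \<open>\<theta>\<close>: each entry is replaced by its
  Taylor polynomial at \<open>\<theta>\<close> of order \<open>N\<close>, where \<open>\<delta>\<^sub>0\<close> vanishes on \<open>(t - \<theta>)\<^sup>N M\<close>. Since \<open>\<delta>\<^sub>0\<close> kills
  the Taylor terms of degree \<open>\<ge> N\<close>, the choice of \<open>N\<close> does not matter, and the least one is taken.
  The Taylor coefficients are hyperderivatives; a convergent series on the unit disk need not converge
  at \<open>\<theta>\<close>, where \<open>|\<theta>| = q > 1\<close>.
\<close>

definition taylor_coeff :: "'c::{field,metric_space} \<Rightarrow> 'c fps \<Rightarrow> nat \<Rightarrow> 'c" where
  "taylor_coeff \<theta> g k = (\<Sum>n. of_nat (n choose k) * fps_nth g n * \<theta> ^ (n - k))"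

definition delta0_order ::
  "'c::{field,metric_space} set \<Rightarrow> 'c \<Rightarrow> ('c, 'm::ab_group_add) tsigma_ops \<Rightarrow> ('d::finite \<Rightarrow> 'm) \<Rightarrow> nat" where
  "delta0_order Fq \<theta> M w = (LEAST N. \<forall>x. delta0 Fq \<theta> M w (poly_act M ([:- \<theta>, 1:] ^ N) x) = 0)"

definition delta0_ext ::
  "'c::{field,metric_space} set \<Rightarrow> 'c \<Rightarrow> ('c, 'm::ab_group_add) tsigma_ops \<Rightarrow> ('r::finite \<Rightarrow> 'm) \<Rightarrow> ('d::finite \<Rightarrow> 'm) \<Rightarrow> 'c fps ^ 'r \<Rightarrow> 'c ^ 'd" where
  "delta0_ext Fq \<theta> M m w g =
     (\<Sum>i\<in>UNIV. \<Sum>k<delta0_order Fq \<theta> M w.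
        taylor_coeff \<theta> (g $ i) k *s delta0 Fq \<theta> M w (poly_act M ([:- \<theta>, 1:] ^ k) (m i)))"

text \<open>
  The action of \<open>\<sigma>\<close> on the coordinate space \<open>\<C>\<^sub>\<infinity>[t]\<^sup>r\<close> of \<open>\<C>\<^sub>\<infinity>[t] \<otimes> M\<close>:
  \<open>\<sigma>(\<Sum> g\<^sub>i m\<^sub>i) = \<Sum> g\<^sub>i\<^bsup>(-1)\<^esup> \<Phi>'\<^sub>i\<^sub>j m\<^sub>j\<close>.
\<close>

definition sigma_coord :: "nat \<Rightarrow> 'c::field poly ^ 'r ^ 'r \<Rightarrow> 'c poly ^ 'r \<Rightarrow> 'c poly ^ 'r::finite" where
  "sigma_coord q \<Phi>' g = (\<chi> i. map_poly (frob q (- 1)) (g $ i)) v* \<Phi>'"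


section \<open>Anderson t-modules\<close>

text \<open>\<open>S k\<close> is the coefficient of \<open>\<tau>\<^sup>k\<close> in a power series (or polynomial) in \<open>\<tau>\<close>.\<close>

type_synonym ('c, 'd) tau_series = "nat \<Rightarrow> 'c ^ 'd ^ 'd"

type_synonym ('c, 'd) t_module = "'c poly \<Rightarrow> ('c, 'd) tau_series"

definition tau_const :: "'c::field ^ 'd ^ 'd \<Rightarrow> ('c, 'd::finite) tau_series" where
  "tau_const B = (\<lambda>k. if k = 0 then B else 0)"

definition tau_mult :: "nat \<Rightarrow> ('c::field, 'd::finite) tau_series \<Rightarrow> ('c, 'd) tau_series \<Rightarrow> ('c, 'd) tau_series" where
  "tau_mult q S T = (\<lambda>n. \<Sum>i\<le>n. S i ** map_matrix (frob q (int i)) (T (n - i)))"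

locale anderson_t_module =
  fixes Fq :: "'c::{field,metric_space} set" and \<theta> :: 'c and E :: "('c, 'd::finite) t_module"
  assumes coeff_Kbar: "a \<in> polys_over Fq \<Longrightarrow> E a k $ i $ j \<in> Kbar Fq \<theta>"
    and finite_support: "a \<in> polys_over Fq \<Longrightarrow> finite {k. E a k \<noteq> 0}"
    and hom_const: "c \<in> Fq \<Longrightarrow> E [:c:] = tau_const (mat c)"
    and hom_add: "a \<in> polys_over Fq \<Longrightarrow> b \<in> polys_over Fq \<Longrightarrow> E (a + b) = (\<lambda>k. E a k + E b k)"
    and hom_mult: "a \<in> polys_over Fq \<Longrightarrow> b \<in> polys_over Fq \<Longrightarrow> E (a * b) = tau_mult (card Fq) (E a) (E b)"
    and nilpotent: "a \<in> polys_over Fq \<Longrightarrow> \<exists>n. (((**) (E a 0 - mat (poly a \<theta>))) ^^ n) (mat 1) = 0"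

definition t_module_act :: "nat \<Rightarrow> ('c::field, 'd::finite) tau_series \<Rightarrow> 'c ^ 'd \<Rightarrow> 'c ^ 'd" where
  "t_module_act q S x = (\<Sum>k | S k \<noteq> 0. S k *v frob_vec q (int k) x)"

definition associated_t_module ::
  "'c::{field,metric_space} set \<Rightarrow> 'c \<Rightarrow> ('c, 'm::ab_group_add) tsigma_ops \<Rightarrow> ('d::finite \<Rightarrow> 'm) \<Rightarrow> ('c, 'd) t_module \<Rightarrow> bool" where
  "associated_t_module Fq \<theta> M w E \<longleftrightarrow> anderson_t_module Fq \<theta> E \<and>
     (\<forall>a\<in>polys_over Fq. \<forall>x.
        t_module_act (card Fq) (E a) (delta1 Fq \<theta> M w x) = delta1 Fq \<theta> M w (poly_act M a x))"

definition exp_series :: "'c::{field,metric_space} set \<Rightarrow> ('c, 'd::finite) t_module \<Rightarrow> ('c, 'd) tau_series" where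
  "exp_series Fq E = (THE Q. Q 0 = mat 1 \<and>
     (\<forall>a\<in>polys_over Fq. tau_mult (card Fq) Q (tau_const (E a 0)) = tau_mult (card Fq) (E a) Q))"

definition log_series :: "'c::{field,metric_space} set \<Rightarrow> ('c, 'd::finite) t_module \<Rightarrow> ('c, 'd) tau_series" where
  "log_series Fq E = (THE P.
     tau_mult (card Fq) P (exp_series Fq E) = tau_const (mat 1) \<and>
     tau_mult (card Fq) (exp_series Fq E) P = tau_const (mat 1))"

definition log_domain :: "'c::{field,metric_space} set \<Rightarrow> ('c, 'd::finite) t_module \<Rightarrow> ('c ^ 'd) set" where
  "log_domain Fq E = {u. summable (\<lambda>i. log_series Fq E i *v frob_vec (card Fq) (int i) u)}"

definition t_log :: "'c::{field,metric_space} set \<Rightarrow> ('c, 'd::finite) t_module \<Rightarrow> 'c ^ 'd \<Rightarrow> 'c ^ 'd" where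
  "t_log Fq E u = (\<Sum>i. log_series Fq E i *v frob_vec (card Fq) (int i) u)"

text \<open>
  The \<open>z\<close>-deformed series \<open>\<Sum> S\<^sub>i z\<^sup>i \<tau>\<^sup>i\<close> acting on columns of power series in \<open>z\<close>; each power of \<open>z\<close>
  receives only finitely many contributions.
\<close>

definition deformed_act :: "nat \<Rightarrow> ('c::field, 'd::finite) tau_series \<Rightarrow> 'c fps ^ 'd \<Rightarrow> 'c fps ^ 'd" where
  "deformed_act q S x = (\<chi> j. Abs_fps (\<lambda>n.
     (\<Sum>i\<le>n. S i *v frob_vec q (int i) (\<chi> l. fps_nth (x $ l) (n - i))) $ j))"

definition stark_unit ::
  "'c::{field,metric_space} set \<Rightarrow> 'c \<Rightarrow> ('c, 'd::finite) t_module \<Rightarrow> 'c ^ 'd \<Rightarrow> bool" where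
  "stark_unit Fq \<theta> E \<zeta> \<longleftrightarrow> (\<exists>x. (\<forall>j. x $ j \<in> tate) \<and>
     (\<exists>p. (\<forall>j. p $ j \<in> polys_over (Kbar Fq \<theta>)) \<and>
        deformed_act (card Fq) (exp_series Fq E) x = (\<chi> j. fps_of_poly (p $ j))) \<and>
     (\<forall>j. fps_nth (x $ j) sums (\<zeta> $ j)))"

definition stark_log_identity ::
  "'c::{field,metric_space} set \<Rightarrow> 'c \<Rightarrow> ('c, 'd::finite) t_module \<Rightarrow> 'c ^ 'd \<Rightarrow> 'c ^ 'd \<Rightarrow> bool" where
  "stark_log_identity Fq \<theta> E Z \<zeta> \<longleftrightarrow> stark_unit Fq \<theta> E \<zeta> \<and>
     (\<lambda>i. exp_series Fq E i *v frob_vec (card Fq) (int i) \<zeta>) sums Z"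

definition split_log_identity ::
  "'c::{field,metric_space} set \<Rightarrow> ('c, 'd::finite) t_module \<Rightarrow> 'c ^ 'd \<Rightarrow> 'c ^ 'd \<Rightarrow> bool" where
  "split_log_identity Fq E Z \<zeta> \<longleftrightarrow> (\<exists>aus :: ('c poly \<times> ('c ^ 'd)) list.
     (\<forall>(a, u) \<in> set aus. a \<in> polys_over Fq \<and> u \<in> log_domain Fq E) \<and>
     \<zeta> = (\<Sum>(a, u)\<leftarrow>aus. E a 0 *v t_log Fq E u) \<and>
     Z = (\<Sum>(a, u)\<leftarrow>aus. t_module_act (card Fq) (E a) u))"

end

theory Submission
  imports Defs
begin

text \<open>
  The equation \<open>\<Psi>\<^bsup>(-1)\<^esup> = \<Phi>\<Psi>\<close> says that \<open>(1 - \<sigma>) \<upsilon> = f\<close>, where \<open>\<sigma> g = g\<^bsup>(-1)\<^esup> \<Phi>'\<close> is invertible on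
  columns of power series, and \<open>F \<psi>\<^bsup>(k)\<^esup> \<rightarrow> 0\<close> says that \<open>\<sigma>\<^bsup>-k\<^esup> \<upsilon> \<rightarrow> 0\<close>. Hence \<open>f - \<upsilon> = \<Sum>\<^sub>k \<sigma>\<^bsup>-k\<^esup> f\<close>, first in the
  Gauss norm and then, by interpolation between the radii \<open>1\<close> and \<open>|\<theta>|\<close>, in a norm for which \<open>\<delta>\<^sub>0\<close> is
  continuous. The matrices \<open>P\<^sub>k\<close> with columns \<open>\<delta>\<^sub>0(\<sigma>\<^bsup>-k\<^esup> w\<^sub>j)\<close> intertwine \<open>E\<^sub>a\<close> with \<open>d[a]\<close>, so they are the
  coefficients of the logarithm, and \<open>\<Sum>\<^sub>k \<delta>\<^sub>0(\<sigma>\<^bsup>-k\<^esup> f) z\<^sup>k\<close> is the deformed logarithm of \<open>\<delta>\<^sub>1\<^sub>,\<^sub>z(f)\<close>. Evaluating at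
  \<open>z = 1\<close>, which is harmless because the exponential is entire, gives the Stark logarithmic identity;
  for the split one the series is rearranged along \<open>f = \<Sum> t\<^sup>n \<sigma>\<^sup>l(u w)\<close>.
\<close>

text \<open>The obstacle is that the hypotheses concern the unit disk, while
  \<open>\<delta>\<^sub>0\<close> looks at t = \<theta>, where |\<theta>| = q > 1. Frobenius bridges
  the gap. Inverting \<sigma> ends with a q-th power of the coefficients, which carries radius R to
  R^q: it moves the possible pole of the inverse of \<open>\<Phi>'\<close> from \<theta> out to
  radius q^q, and it makes the size at radius q depend on q - 1 factors that are measured in the
  Gauss norm. The points \<open>u\<close> of the split case have entries in the completed field,
  whose scalars do not act on the module. Hence \<sigma>, its inverse \<open>S\<close> and the
  extension \<open>\<Lambda>\<close> of \<open>\<delta>\<^sub>0\<close> are handled on coordinate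
  columns. Exponential and logarithm are given by unique existence. Uniqueness and entireness both
  rest on the operator of t^(q^s) for large s: its constant coefficient is a scalar matrix, so the
  functional equation becomes a recursion solved by one division, and the divisor is so large that
  the coefficients decay.\<close>

no_notation fps_nth (infixl \<open>$\<close> 75)


subsection \<open>Algebraic elements over a subfield\<close>

lemma
  assumes "is_subfield S"
  shows subfield_0: "0 \<in> S" and subfield_1: "1 \<in> S"
    and subfield_diff: "x \<in> S \<Longrightarrow> y \<in> S \<Longrightarrow> x - y \<in> S"
    and subfield_mult: "x \<in> S \<Longrightarrow> y \<in> S \<Longrightarrow> x * y \<in> S"
    and subfield_inverse: "x \<in> S \<Longrightarrow> inverse x \<in> S"
  using assms by (auto simp: is_subfield_def)

lemma subfield_minus: "is_subfield S \<Longrightarrow> x \<in> S \<Longrightarrow> - x \<in> S"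
  using subfield_diff[of S 0 x] subfield_0[of S] by simp

lemma subfield_add: "is_subfield S \<Longrightarrow> x \<in> S \<Longrightarrow> y \<in> S \<Longrightarrow> x + y \<in> S"
  using subfield_diff[of S x "- y"] subfield_minus[of S y] by simp

lemma subfield_divide: "is_subfield S \<Longrightarrow> x \<in> S \<Longrightarrow> y \<in> S \<Longrightarrow> x / y \<in> S"
  using subfield_mult[of S x "inverse y"] subfield_inverse[of S y] by (simp add: divide_inverse)

lemma subfield_sum: "is_subfield S \<Longrightarrow> (\<And>i. i \<in> I \<Longrightarrow> f i \<in> S) \<Longrightarrow> sum f I \<in> S"
  by (induction I rule: infinite_finite_induct) (auto intro: subfield_0 subfield_add)

text \<open>Gaussian elimination: an equation with a nonzero coefficient at \<open>k\<close> is
  solved for the unknown \<open>k\<close>, which leaves one equation and one unknown fewer.\<close>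

lemma homogeneous_system_solution:
  assumes "is_subfield S" "finite I" "finite J" "card I < card J"
    and "\<And>i j. a j i \<in> S"
  shows "\<exists>c. (\<forall>j. c j \<in> S) \<and> (\<exists>j\<in>J. c j \<noteq> 0) \<and> (\<forall>i\<in>I. (\<Sum>j\<in>J. c j * a j i) = 0)"
  using assms(2-)
proof (induction I arbitrary: J a rule: finite_induct)
  case empty
  then have "J \<noteq> {}" by auto
  then show ?case by (intro exI[of _ "\<lambda>_. 1"]) (auto intro: subfield_1 assms)
next
  case (insert i0 I)
  show ?case
  proof (cases "\<forall>j\<in>J. a j i0 = 0")
    case True
    have "card I < card J" using insert by simp
    then obtain c where "\<forall>j. c j \<in> S" "\<exists>j\<in>J. c j \<noteq> 0" "\<forall>i\<in>I. (\<Sum>j\<in>J. c j * a j i) = 0"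
      using insert.IH[of J a] insert.prems by blast
    with True show ?thesis by (intro exI[of _ c]) auto
  next
    case False
    then obtain k where k: "k \<in> J" "a k i0 \<noteq> 0" by auto
    \<comment> \<open>The system after the unknown \<open>k\<close> has been eliminated by means of
      equation \<open>i0\<close>, whose own row becomes zero.\<close>
    define a' where "a' j i = a j i - a j i0 / a k i0 * a k i" for j i
    have "card I < card (J - {k})" using insert k by simp
    moreover have "a' j i \<in> S" for j i
      unfolding a'_def by (intro subfield_diff subfield_mult subfield_divide assms(1) insert.prems)
    ultimately obtain c where "\<forall>j. c j \<in> S" "\<exists>j\<in>J-{k}. c j \<noteq> 0"
        "\<forall>i\<in>I. (\<Sum>j\<in>J-{k}. c j * a' j i) = 0"
      using insert.IH[of "J - {k}" a'] insert.prems by blast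
    then have c: "\<And>j. c j \<in> S" "\<exists>j\<in>J-{k}. c j \<noteq> 0"
        "\<And>i. i \<in> I \<Longrightarrow> (\<Sum>j\<in>J-{k}. c j * a' j i) = 0"
      by blast+
    define c' where "c' j = (if j = k then - (\<Sum>j\<in>J-{k}. c j * (a j i0 / a k i0)) else c j)" for j
    have *: "(\<Sum>j\<in>J. c' j * a j i) = (\<Sum>j\<in>J-{k}. c j * a' j i)" for i
    proof -
      have "(\<Sum>j\<in>J. c' j * a j i) = c' k * a k i + (\<Sum>j\<in>J-{k}. c' j * a j i)"
        using k insert.prems by (simp add: sum.remove)
      also have "(\<Sum>j\<in>J-{k}. c' j * a j i) = (\<Sum>j\<in>J-{k}. c j * a j i)"
        by (intro sum.cong) (auto simp: c'_def)
      also have "c' k * a k i = - (\<Sum>j\<in>J-{k}. c j * (a j i0 / a k i0 * a k i))"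
        by (simp add: c'_def sum_distrib_right mult.assoc)
      finally show ?thesis by (simp add: a'_def right_diff_distrib sum_subtractf)
    qed
    have "a' j i0 = 0" for j using k by (simp add: a'_def)
    then have "\<forall>i\<in>insert i0 I. (\<Sum>j\<in>J. c' j * a j i) = 0" using c * by auto
    moreover have "\<forall>j. c' j \<in> S" unfolding c'_def
      by (intro allI) (simp add: c insert.prems assms(1) subfield_minus subfield_sum subfield_mult subfield_divide)
    moreover have "\<exists>j\<in>J. c' j \<noteq> 0" using c(2) by (auto simp: c'_def)
    ultimately show ?thesis by blast
  qed
qed

definition lin_span :: "'a::field set \<Rightarrow> 'i set \<Rightarrow> ('i \<Rightarrow> 'a) \<Rightarrow> 'a set" where
  "lin_span S I b = {\<Sum>i\<in>I. c i * b i | c. \<forall>i. c i \<in> S}"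

lemma lin_span_add: "is_subfield S \<Longrightarrow> x \<in> lin_span S I b \<Longrightarrow> y \<in> lin_span S I b \<Longrightarrow> x + y \<in> lin_span S I b"
proof -
  assume S: "is_subfield S" and "x \<in> lin_span S I b" "y \<in> lin_span S I b"
  then obtain c d where "\<forall>i. c i \<in> S" "x = (\<Sum>i\<in>I. c i * b i)" "\<forall>i. d i \<in> S" "y = (\<Sum>i\<in>I. d i * b i)"
    by (auto simp: lin_span_def)
  with S show ?thesis unfolding lin_span_def
    by (auto intro!: exI[of _ "\<lambda>i. c i + d i"] subfield_add simp: sum.distrib distrib_right)
qed

lemma lin_span_scale:
  assumes "is_subfield S" "x \<in> lin_span S I b" "s \<in> S"
  shows "s * x \<in> lin_span S I b"
proof -
  from assms obtain c where "\<forall>i. c i \<in> S" "x = (\<Sum>i\<in>I. c i * b i)" by (auto simp: lin_span_def)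
  then show ?thesis using assms unfolding lin_span_def
    by (auto intro!: exI[of _ "\<lambda>i. s * c i"] subfield_mult simp: sum_distrib_left mult.assoc)
qed

lemma lin_span_base:
  assumes "is_subfield S" "finite I" "i \<in> I"
  shows "b i \<in> lin_span S I b"
  using assms unfolding lin_span_def
  by (auto intro!: exI[of _ "\<lambda>j. if j = i then 1 else 0"] simp: subfield_0 subfield_1 if_distrib[of "\<lambda>x. x * _"] cong: if_cong)

lemma lin_span_0: "is_subfield S \<Longrightarrow> 0 \<in> lin_span S I b"
  unfolding lin_span_def by (auto intro!: exI[of _ "\<lambda>j. 0"] simp: subfield_0)

lemma lin_span_sum: "is_subfield S \<Longrightarrow> (\<And>i. i \<in> J \<Longrightarrow> f i \<in> lin_span S I b) \<Longrightarrow> sum f J \<in> lin_span S I b"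
  by (induction J rule: infinite_finite_induct) (auto intro: lin_span_0 lin_span_add)

lemma lin_span_mult_closed:
  assumes "is_subfield S" "\<And>i. i \<in> I \<Longrightarrow> s * b i \<in> lin_span S I b" "x \<in> lin_span S I b"
  shows "s * x \<in> lin_span S I b"
proof -
  from assms obtain c where c: "\<forall>i. c i \<in> S" "x = (\<Sum>i\<in>I. c i * b i)" by (auto simp: lin_span_def)
  have "s * x = (\<Sum>i\<in>I. c i * (s * b i))" unfolding c(2) by (simp add: sum_distrib_left algebra_simps)
  also have "\<dots> \<in> lin_span S I b" by (rule lin_span_sum[OF assms(1)]) (rule lin_span_scale[OF assms(1)], use assms c in auto)
  finally show ?thesis .
qed

lemma polys_over_sum_monom: "is_subfield S \<Longrightarrow> (\<And>j. c j \<in> S) \<Longrightarrow> (\<Sum>j\<le>n. monom (c j) j) \<in> polys_over S"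
  unfolding polys_over_def by (auto simp: coeff_sum intro: subfield_sum subfield_0)

text \<open>All powers of \<open>s\<close> lie in a span of |I| generators, so those with exponents
  0, ..., |I| satisfy a nontrivial linear relation, and this relation is a polynomial vanishing at
  \<open>s\<close>.\<close>

lemma algebraic_if_stable:
  assumes S: "is_subfield S" and "finite I" and s: "\<And>i. i \<in> I \<Longrightarrow> s * b i \<in> lin_span S I b"
    and 1: "1 \<in> lin_span S I b"
  shows "s \<in> algebraic_closure_in S"
proof -
  have "s ^ n \<in> lin_span S I b" for n
    using 1 by (induction n) (auto intro: lin_span_mult_closed[OF S s])
  then have "\<forall>n. \<exists>c. (\<forall>i. c i \<in> S) \<and> s ^ n = (\<Sum>i\<in>I. c i * b i)" by (auto simp: lin_span_def)
  then obtain a where a: "\<And>n i. a n i \<in> S" "\<And>n. s ^ n = (\<Sum>i\<in>I. a n i * b i)" by metis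
  define n where "n = card I"
  have "card I < card {..n}" by (simp add: n_def)
  then obtain c where "\<forall>j. c j \<in> S" "\<exists>j\<in>{..n}. c j \<noteq> 0" "\<forall>i\<in>I. (\<Sum>j\<le>n. c j * a j i) = 0"
    using homogeneous_system_solution[OF S \<open>finite I\<close> finite_atMost, of n a] a(1) by blast
  then have c: "\<And>j. c j \<in> S" "\<exists>j\<in>{..n}. c j \<noteq> 0" "\<And>i. i \<in> I \<Longrightarrow> (\<Sum>j\<le>n. c j * a j i) = 0"
    by blast+
  define p where "p = (\<Sum>j\<le>n. monom (c j) j)"
  have "p \<in> polys_over S" unfolding p_def using S c by (intro polys_over_sum_monom)
  moreover have "p \<noteq> 0"
  proof -
    from c obtain j where j: "j \<le> n" "c j \<noteq> 0" by auto
    then have "coeff p j = c j" by (simp add: p_def coeff_sum)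
    with j show ?thesis by auto
  qed
  moreover have "poly p s = (\<Sum>j\<le>n. c j * (\<Sum>i\<in>I. a j i * b i))"
    by (simp add: p_def poly_sum poly_monom a(2)[symmetric])
  then have "poly p s = (\<Sum>i\<in>I. (\<Sum>j\<le>n. c j * a j i) * b i)"
    by (simp add: sum_distrib_left sum_distrib_right mult.assoc) (rule sum.swap)
  ultimately show ?thesis using c by (auto simp: algebraic_closure_in_def)
qed

lemma algebraic_power_reduction:
  assumes S: "is_subfield S" and "x \<in> algebraic_closure_in S"
  obtains n c where "n > 0" "\<And>i. c i \<in> S" "x ^ n = (\<Sum>i<n. c i * x ^ i)"
proof -
  from assms obtain p where p: "p \<in> polys_over S" "p \<noteq> 0" "poly p x = 0"
    by (auto simp: algebraic_closure_in_def)
  define n where "n = degree p"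
  define l where "l = coeff p n"
  have l: "l \<noteq> 0" using p by (simp add: l_def n_def)
  have n: "n > 0"
  proof (rule ccontr)
    assume "\<not> n > 0"
    then have "degree p = 0" by (simp add: n_def)
    then obtain c where "p = [:c:]" by (metis degree_eq_zeroE)
    with p show False by simp
  qed
  have "0 = (\<Sum>i\<le>n. coeff p i * x ^ i)" using p(3) by (simp add: poly_altdef n_def)
  also have "\<dots> = (\<Sum>i<n. coeff p i * x ^ i) + l * x ^ n"
    by (simp add: l_def lessThan_Suc_atMost[symmetric])
  finally have "l * x ^ n = - (\<Sum>i<n. coeff p i * x ^ i)" by (metis add_eq_0_iff)
  then have "x ^ n = - (\<Sum>i<n. coeff p i * x ^ i) / l" using l by (simp add: field_simps)
  also have "\<dots> = (\<Sum>i<n. (- coeff p i / l) * x ^ i)"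
    by (simp add: sum_negf[symmetric] sum_divide_distrib)
  finally have "x ^ n = (\<Sum>i<n. (- coeff p i / l) * x ^ i)" .
  moreover have "- coeff p i / l \<in> S" for i using p S
    by (auto simp: polys_over_def l_def intro!: subfield_divide subfield_minus)
  ultimately show ?thesis using n that[of n "\<lambda>i. - coeff p i / l"] by blast
qed

text \<open>The span of the monomials x^i y^j, with exponents below the degrees of relations for x
  and y, is stable under both elements, hence also under their difference and product.\<close>

lemma algebraic_common_span:
  assumes S: "is_subfield S" and x: "x \<in> algebraic_closure_in S" and y: "y \<in> algebraic_closure_in S"
  obtains I :: "(nat \<times> nat) set" and b where "finite I" "1 \<in> lin_span S I b"
    "\<And>i. i \<in> I \<Longrightarrow> x * b i \<in> lin_span S I b" "\<And>i. i \<in> I \<Longrightarrow> y * b i \<in> lin_span S I b"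
proof -
  obtain n c where n: "n > 0" "\<And>i. c i \<in> S" "x ^ n = (\<Sum>i<n. c i * x ^ i)"
    using algebraic_power_reduction[OF S x] by blast
  obtain k d where k: "k > 0" "\<And>i. d i \<in> S" "y ^ k = (\<Sum>i<k. d i * y ^ i)"
    using algebraic_power_reduction[OF S y] by blast
  define I where "I = {..<n} \<times> {..<k}"
  define b where "b = (\<lambda>(i,j). x ^ i * y ^ j)"
  have I: "finite I" by (simp add: I_def)
  have b: "x ^ i * y ^ j \<in> lin_span S I b" if "i < n" "j < k" for i j
    using lin_span_base[OF S I, of "(i,j)" b] that by (simp add: I_def b_def)
  show ?thesis
  proof (rule that[OF I])
    show "1 \<in> lin_span S I b" using b[of 0 0] n k by simp
    fix i assume "i \<in> I"
    then obtain u v where i: "i = (u, v)" "u < n" "v < k" by (auto simp: I_def)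
    \<comment> \<open>Only the top exponent leaves the box of monomials; there x^n is replaced by
      lower powers.\<close>
    show "x * b i \<in> lin_span S I b"
    proof (cases "Suc u = n")
      case True
      have "x * b i = x ^ n * y ^ v" using True by (simp add: i b_def flip: True)
      also have "\<dots> = (\<Sum>j<n. c j * (x ^ j * y ^ v))" by (simp add: n(3) sum_distrib_right mult.assoc)
      also have "\<dots> \<in> lin_span S I b" by (rule lin_span_sum[OF S]) (rule lin_span_scale[OF S], use b i n in auto)
      finally show ?thesis .
    next
      case False
      with i b[of "Suc u" v] show ?thesis by (simp add: b_def mult.assoc)
    qed
    show "y * b i \<in> lin_span S I b"
    proof (cases "Suc v = k")
      case True
      have "y * b i = x ^ u * y ^ k" using True by (simp add: i b_def flip: True)
      also have "\<dots> = (\<Sum>j<k. d j * (x ^ u * y ^ j))" by (simp add: k(3) sum_distrib_left algebra_simps)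
      also have "\<dots> \<in> lin_span S I b" by (rule lin_span_sum[OF S]) (rule lin_span_scale[OF S], use b i k in auto)
      finally show ?thesis .
    next
      case False
      with i b[of u "Suc v"] show ?thesis by (simp add: b_def algebra_simps)
    qed
  qed
qed

lemma
  assumes S: "is_subfield S" and x: "x \<in> algebraic_closure_in S" and y: "y \<in> algebraic_closure_in S"
  shows algebraic_diff: "x - y \<in> algebraic_closure_in S"
    and algebraic_mult: "x * y \<in> algebraic_closure_in S"
proof -
  obtain I :: "(nat \<times> nat) set" and b where I: "finite I" "1 \<in> lin_span S I b"
    "\<And>i. i \<in> I \<Longrightarrow> x * b i \<in> lin_span S I b" "\<And>i. i \<in> I \<Longrightarrow> y * b i \<in> lin_span S I b"
    using algebraic_common_span[OF assms] by blast
  have m: "- 1 \<in> S" using subfield_minus[OF S subfield_1[OF S]] .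
  show "x - y \<in> algebraic_closure_in S"
  proof (rule algebraic_if_stable[OF S I(1) _ I(2)])
    fix i assume "i \<in> I"
    then have "x * b i + (- 1) * (y * b i) \<in> lin_span S I b"
      using I by (intro lin_span_add[OF S] lin_span_scale[OF S _ m]) auto
    then show "(x - y) * b i \<in> lin_span S I b" by (simp add: left_diff_distrib)
  qed
  show "x * y \<in> algebraic_closure_in S"
  proof (rule algebraic_if_stable[OF S I(1) _ I(2)])
    fix i assume "i \<in> I"
    then have "x * (y * b i) \<in> lin_span S I b"
      using lin_span_mult_closed[OF S I(3)] I(4) by blast
    then show "x * y * b i \<in> lin_span S I b" by (simp add: mult.assoc)
  qed
qed

lemma subfield_subset_algebraic:
  assumes "is_subfield S" "x \<in> S" shows "x \<in> algebraic_closure_in S"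
proof -
  have "[:- x, 1:] \<in> polys_over S" using assms
    by (auto simp: polys_over_def coeff_pCons split: nat.split intro: subfield_minus subfield_1 subfield_0)
  then show ?thesis unfolding algebraic_closure_in_def by (intro CollectI bexI[of _ "[:- x, 1:]"]) auto
qed

subsection \<open>The valued field and its Frobenius\<close>

lemma Kfield_subfield:
  assumes S: "is_subfield S"
  shows "is_subfield (Kfield S \<theta>)"
proof -
  have 1: "[:1:] \<in> polys_over S" "0 \<in> polys_over S"
    using subfield_0[OF S] subfield_1[OF S] by (auto simp: polys_over_def coeff_pCons split: nat.split)
  have d: "p - r \<in> polys_over S" if "p \<in> polys_over S" "r \<in> polys_over S" for p r
    using that subfield_diff[OF S] by (auto simp: polys_over_def)
  have m: "p * r \<in> polys_over S" if "p \<in> polys_over S" "r \<in> polys_over S" for p r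
    using that by (auto simp: polys_over_def coeff_mult intro!: subfield_sum[OF S] subfield_mult[OF S])
  show ?thesis unfolding is_subfield_def
  proof (intro conjI ballI)
    show "0 \<in> Kfield S \<theta>" unfolding Kfield_def
      by (rule CollectI, rule exI[of _ 0], rule exI[of _ "[:1:]"]) (use 1 in auto)
    show "1 \<in> Kfield S \<theta>" unfolding Kfield_def
      by (rule CollectI, rule exI[of _ "[:1:]"], rule exI[of _ "[:1:]"]) (use 1 in auto)
  next
    fix x y assume "x \<in> Kfield S \<theta>" "y \<in> Kfield S \<theta>"
    then obtain a b a' b' where p: "a \<in> polys_over S" "b \<in> polys_over S" "a' \<in> polys_over S" "b' \<in> polys_over S"
      "poly b \<theta> \<noteq> 0" "poly b' \<theta> \<noteq> 0" and xy: "x = poly a \<theta> / poly b \<theta>" "y = poly a' \<theta> / poly b' \<theta>"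
      unfolding Kfield_def by auto
    have "x - y = poly (a * b' - a' * b) \<theta> / poly (b * b') \<theta>" using p by (simp add: xy diff_frac_eq)
    then show "x - y \<in> Kfield S \<theta>" unfolding Kfield_def mem_Collect_eq
      by (intro exI[of _ "a * b' - a' * b"] exI[of _ "b * b'"] conjI m d p) (use p in simp_all)
    have "x * y = poly (a * a') \<theta> / poly (b * b') \<theta>" by (simp add: xy)
    then show "x * y \<in> Kfield S \<theta>" unfolding Kfield_def mem_Collect_eq
      by (intro exI[of _ "a * a'"] exI[of _ "b * b'"] conjI m d p) (use p in simp_all)
  next
    fix x assume "x \<in> Kfield S \<theta>"
    then obtain a b where p: "a \<in> polys_over S" "b \<in> polys_over S"
      "poly b \<theta> \<noteq> 0" and x: "x = poly a \<theta> / poly b \<theta>"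
      unfolding Kfield_def by auto
    show "inverse x \<in> Kfield S \<theta>"
    proof (cases "poly a \<theta> = 0")
      \<comment> \<open>In the field class \<open>inverse 0 = 0\<close>, so closure under inverses
        has to cover zero as well.\<close>
      case True
      show ?thesis unfolding Kfield_def
        by (rule CollectI, rule exI[of _ 0], rule exI[of _ "[:1:]"]) (use 1 x True in auto)
    next
      case False
      show ?thesis unfolding Kfield_def
        by (rule CollectI, rule exI[of _ b], rule exI[of _ a]) (use x p False in auto)
    qed
  qed
qed

context c_infinity
begin

abbreviation "q \<equiv> card Fq"

lemma absval_eq_0 [simp]: "absval (x :: 'c) = 0 \<longleftrightarrow> x = 0"
  by (simp add: absval_def)

lemma absval_0 [simp]: "absval (0 :: 'c) = 0" by simp

lemma absval_nonneg [simp]: "0 \<le> absval (x :: 'c)"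
  by (simp add: absval_def)

lemma absval_1 [simp]: "absval (1 :: 'c) = 1"
proof -
  have "absval (1 :: 'c) * absval (1 :: 'c) = absval (1 :: 'c)" using absval_mult[of 1 1] by simp
  then show ?thesis by simp
qed

lemma absval_power: "absval ((x :: 'c) ^ n) = absval x ^ n"
  by (induction n) (auto simp: absval_mult)

lemma absval_minus [simp]: "absval (- x :: 'c) = absval x"
  using dist_eq[of 0 x] by (simp add: absval_def dist_commute)

lemma absval_diff_commute: "absval (x - y :: 'c) = absval (y - x)"
  using absval_minus[of "x - y"] by simp

lemma absval_inverse: "absval (inverse x :: 'c) = inverse (absval x)"
proof (cases "x = 0")
  case False
  then have "absval x * absval (inverse x) = 1" by (simp add: absval_mult[symmetric])
  then show ?thesis by (simp add: inverse_unique)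
qed simp

lemma absval_add_le: "absval (x :: 'c) \<le> B \<Longrightarrow> absval y \<le> B \<Longrightarrow> absval (x + y) \<le> B"
  using absval_add[of x y] by simp

lemma absval_diff_le: "absval (x :: 'c) \<le> B \<Longrightarrow> absval y \<le> B \<Longrightarrow> absval (x - y) \<le> B"
  using absval_add_le[of x B "- y"] by simp

lemma absval_sum_le: "0 \<le> B \<Longrightarrow> (\<And>i. i \<in> I \<Longrightarrow> absval (f i :: 'c) \<le> B) \<Longrightarrow> absval (sum f I) \<le> B"
  by (induction I rule: infinite_finite_induct) (auto intro: absval_add_le)

lemma absval_of_nat_le: "absval (of_nat n :: 'c) \<le> 1"
  by (induction n) (auto intro: absval_add_le)

section \<open>The finite field and the additivity of q-th powers\<close>

lemma Fq_subfield: "is_subfield Fq"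
  using Fq by auto

lemma q_ge_2: "q \<ge> 2"
proof -
  have "card {0, 1 :: 'c} \<le> q"
    using Fq by (intro card_mono) (auto simp: is_subfield_def)
  then show ?thesis by simp
qed

lemma q_pos: "q > 0" using q_ge_2 by auto

lemma q_power_pos: "q ^ n > 0"
  using q_pos by simp

lemma zero_power_q_power [simp]: "(0 :: 'c) ^ (q ^ n) = 0"
  using q_power_pos[of n] by (simp add: power_0_left)

text \<open>Multiplication by a nonzero \<open>a\<close> permutes the q - 1 nonzero elements;
  comparing their product before and after gives a^(q-1) = 1.\<close>

lemma Fq_power_q: "a \<in> Fq \<Longrightarrow> a ^ q = a"
proof (cases "a = 0")
  case True
  then show ?thesis using q_pos by simp
next
  case False
  assume a: "a \<in> Fq"
  define U where "U = Fq - {0}"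
  have U: "finite U" "card U = q - 1" using Fq by (auto simp: U_def card_Diff_singleton is_subfield_def)
  have inj: "inj_on ((*) a) U" using False by (auto simp: inj_on_def)
  have "(*) a ` U \<subseteq> U" using a False Fq by (auto simp: U_def is_subfield_def)
  then have "(*) a ` U = U" by (rule endo_inj_surj[OF U(1) _ inj])
  then have "\<Prod>U = (\<Prod>b\<in>U. a * b)" using prod.reindex[OF inj, of "\<lambda>x. x"] by simp
  also have "\<dots> = a ^ (q - 1) * \<Prod>U" by (simp add: prod.distrib U)
  finally have "a ^ (q - 1) = 1" using U by (simp add: U_def)
  then show ?thesis using q_pos power_minus_mult[of q a] by simp
qed

text \<open>\<open>(X + 1)\<^sup>q - X\<^sup>q - 1\<close> has degree less than \<open>q\<close> and vanishes on the \<open>q\<close> elements of \<open>\<F>\<^sub>q\<close>.\<close>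

lemma choose_q_eq_0:
  assumes k: "0 < k" "k < q"
  shows "(of_nat (q choose k) :: 'c) = 0"
proof -
  define p :: "'c poly" where "p = (\<Sum>k\<in>{0<..<q}. monom (of_nat (q choose k)) k)"
  have "degree p \<le> q - 1" unfolding p_def
    by (intro degree_sum_le) (auto intro: order.trans[OF degree_monom_le])
  then have deg: "degree p < q" using q_pos by simp
  have "poly p a = 0" if "a \<in> Fq" for a
  proof -
    have "a + 1 \<in> Fq" using that Fq_subfield by (intro subfield_add subfield_1) auto
    then have "a + 1 = (a + 1) ^ q" by (simp add: Fq_power_q)
    also have "\<dots> = (\<Sum>k\<le>q. of_nat (q choose k) * a ^ k)" by (subst binomial_ring) simp
    also have "{..q} = insert 0 (insert q {0<..<q})" by auto
    also have "(\<Sum>k\<in>\<dots>. of_nat (q choose k) * a ^ k) = 1 + (a ^ q + poly p a)"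
      using q_pos by (simp add: p_def poly_sum poly_monom)
    finally show "poly p a = 0" using that by (simp add: Fq_power_q)
  qed
  then have "p = 0"
    using deg poly_eqI_degree[of Fq p 0] q_pos by auto
  moreover have "coeff p k = of_nat (q choose k)" using k by (simp add: p_def coeff_sum)
  ultimately show ?thesis by simp
qed

text \<open>Kept for arbitrary commutative rings because it serves both the field and its
  polynomials, where it leads to (t - \<theta>)^(q^s) = t^(q^s) - \<theta>^(q^s).\<close>

lemma binomial_power_q:
  fixes x y :: "'b::comm_ring_1"
  assumes "\<And>k. 0 < k \<Longrightarrow> k < q \<Longrightarrow> (of_nat (q choose k) :: 'b) = 0"
  shows "(x + y) ^ q = x ^ q + y ^ q"
proof -
  have "(x + y) ^ q = (\<Sum>k\<le>q. of_nat (q choose k) * x ^ k * y ^ (q - k))" by (rule binomial_ring)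
  also have "{..q} = insert 0 (insert q {0<..<q})" by auto
  also have "(\<Sum>k\<in>\<dots>. of_nat (q choose k) * x ^ k * y ^ (q - k)) = x ^ q + y ^ q"
    using q_pos assms by simp
  finally show ?thesis .
qed

lemma binomial_power_q_power:
  fixes x y :: "'b::comm_ring_1"
  assumes "\<And>k. 0 < k \<Longrightarrow> k < q \<Longrightarrow> (of_nat (q choose k) :: 'b) = 0"
  shows "(x + y) ^ (q ^ n) = x ^ (q ^ n) + y ^ (q ^ n)"
proof (induction n arbitrary: x y)
  case (Suc n)
  have "(x + y) ^ (q ^ Suc n) = ((x + y) ^ q) ^ (q ^ n)" by (simp add: power_mult)
  then show ?case using Suc[of "x ^ q" "y ^ q"] by (simp add: binomial_power_q[OF assms] power_mult)
qed simp

lemma add_power_q: "(x + y :: 'c) ^ (q ^ n) = x ^ (q ^ n) + y ^ (q ^ n)"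
  by (rule binomial_power_q_power) (rule choose_q_eq_0)

lemma poly_add_power_q: "(p + r :: 'c poly) ^ (q ^ n) = p ^ (q ^ n) + r ^ (q ^ n)"
  by (rule binomial_power_q_power) (simp add: choose_q_eq_0 of_nat_poly)

lemma minus_power_q: "(- x :: 'c) ^ (q ^ n) = - (x ^ (q ^ n))"
  using add_power_q[of x "- x" n] by (simp add: eq_neg_iff_add_eq_0 add.commute)

lemma diff_power_q: "(x - y :: 'c) ^ (q ^ n) = x ^ (q ^ n) - y ^ (q ^ n)"
  using add_power_q[of x "- y" n] by (simp add: minus_power_q)

lemma sum_power_q: "(\<Sum>i\<in>I. f i :: 'c) ^ (q ^ n) = (\<Sum>i\<in>I. f i ^ (q ^ n))"
  by (induction I rule: infinite_finite_induct) (auto simp: add_power_q)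

lemma power_q_inj: "(x :: 'c) ^ (q ^ n) = y ^ (q ^ n) \<Longrightarrow> x = y"
  using diff_power_q[of x y n] by simp

lemma Fq_power_q_power: "a \<in> Fq \<Longrightarrow> a ^ (q ^ n) = a"
  by (induction n) (auto simp: power_mult Fq_power_q)

section \<open>Roots of order q in the completed field\<close>

lemma tendsto_absval_iff: "((f :: 'b \<Rightarrow> 'c) \<longlongrightarrow> l) G \<longleftrightarrow> ((\<lambda>x. absval (f x - l)) \<longlongrightarrow> 0) G"
  by (subst tendsto_dist_iff) (simp add: dist_eq)

text \<open>Algebraic closedness is available only for the dense set of algebraic elements. Roots
  are taken of approximations from there, and |u - v|^q = |u^q - v^q| makes these roots a Cauchy
  sequence.\<close>

lemma ex_root_q: "\<exists>y. y ^ q = (x :: 'c)"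
proof -
  define L where "L = algebraic_closure_in (K_infty Fq \<theta>)"
  \<comment> \<open>The sign comes from the polynomial X^q + a, whose roots satisfy y^q =
    -a.\<close>
  have "\<exists>a. (\<forall>n. a n \<in> L) \<and> a \<longlonglongrightarrow> - x"
    using dense unfolding L_def by (metis UNIV_I closure_sequential)
  then obtain a where a: "\<And>n. a n \<in> L" "a \<longlonglongrightarrow> - x" by blast
  \<comment> \<open>A constant is the Laurent series with the single term n = 0. This puts 0 and 1
    into \<open>L\<close>, as required of the coefficients of X^q + a.\<close>
  have K: "c \<in> K_infty Fq \<theta>" if "c \<in> Fq" for c
  proof -
    have "(\<lambda>n. (if n = 0 then c else 0) * \<theta> powi (0 - int n)) sums ((if 0 = (0::nat) then c else 0) * \<theta> powi (0 - int 0))"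
      using sums_finite[of "{0}" "\<lambda>n. (if n = 0 then c else 0) * \<theta> powi (0 - int n)"] by simp
    then show ?thesis using that subfield_0[OF Fq_subfield] unfolding K_infty_def
      by (intro CollectI exI[of _ 0] exI[of _ "\<lambda>n. if n = 0 then c else 0"]) auto
  qed
  have m1: "- 1 \<in> Fq" using subfield_minus[OF Fq_subfield subfield_1[OF Fq_subfield]] .
  have X: "[:0, 1:] \<in> polys_over (K_infty Fq \<theta>)" "[:- 1, 1:] \<in> polys_over (K_infty Fq \<theta>)"
    using K[OF m1] K[OF subfield_0[OF Fq_subfield]] K[OF subfield_1[OF Fq_subfield]]
    by (auto simp: polys_over_def coeff_pCons split: nat.split)
  have L: "0 \<in> L" "1 \<in> L" unfolding L_def algebraic_closure_in_def mem_Collect_eq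
    by (rule bexI[OF _ X(1)], simp) (rule bexI[OF _ X(2)], simp)
  have "\<exists>y. y ^ q = - a n" for n
  proof -
    define p where "p = [:a n:] + monom 1 q"
    have "degree p = q" unfolding p_def using q_pos
      by (subst degree_add_eq_right) (auto simp: degree_monom_eq)
    moreover have "p \<in> polys_over L" using a(1)[of n] L q_pos
      by (auto simp: p_def polys_over_def coeff_pCons split: nat.split)
    ultimately obtain y where "poly p y = 0" using alg_closed[of p] q_pos unfolding L_def by auto
    then show ?thesis by (auto simp: p_def poly_monom add_eq_0_iff)
  qed
  then obtain y where y: "\<And>n. y n ^ q = - a n" by metis
  have q1: "q ^ 1 = q" by simp
  have *: "absval (u - v) ^ q = absval (u ^ q - v ^ q)" for u v :: 'c
    using diff_power_q[of u v 1] by (simp add: absval_power[symmetric])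
  have "Cauchy y"
  proof (rule metric_CauchyI)
    fix e :: real assume e: "e > 0"
    have "Cauchy a" using a(2) by (rule LIMSEQ_imp_Cauchy)
    then obtain N where N: "\<And>i j. i \<ge> N \<Longrightarrow> j \<ge> N \<Longrightarrow> dist (a i) (a j) < e ^ q"
      using e unfolding Cauchy_def by (meson zero_less_power)
    show "\<exists>N. \<forall>i\<ge>N. \<forall>j\<ge>N. dist (y i) (y j) < e"
    proof (intro exI allI impI)
      fix i j assume "i \<ge> N" "j \<ge> N"
      then have "absval (y i - y j) ^ q < e ^ q"
        using N[of j i] by (simp add: * y dist_eq)
      then show "dist (y i) (y j) < e" unfolding dist_eq using e by (simp add: power_less_imp_less_base)
    qed
  qed
  then obtain l where l: "y \<longlonglongrightarrow> l" using complete unfolding complete_def by auto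
  have "(\<lambda>n. absval (y n - l) ^ q) \<longlonglongrightarrow> 0 ^ q" using l by (intro tendsto_power) (simp add: tendsto_absval_iff)
  then have "(\<lambda>n. absval (- a n - l ^ q)) \<longlonglongrightarrow> 0" using q_pos by (simp add: * y power_0_left)
  then have "(\<lambda>n. - a n) \<longlonglongrightarrow> l ^ q" by (simp add: tendsto_absval_iff)
  moreover have "(\<lambda>n. - a n) \<longlonglongrightarrow> x"
  proof -
    have "(\<lambda>n. absval (a n - - x)) \<longlonglongrightarrow> 0" using a(2) by (simp add: tendsto_absval_iff)
    moreover have "absval (a n - - x) = absval (- a n - x)" for n
      using absval_minus[of "- a n - x"] by (simp add: add.commute)
    ultimately show ?thesis by (simp add: tendsto_absval_iff)
  qed
  ultimately show ?thesis using LIMSEQ_unique by blast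
qed

abbreviation "rt \<equiv> frob q (- 1)"

lemma frob_int [simp]: "frob q (int k) x = (x :: 'c) ^ (q ^ k)"
  by (simp add: frob_def)

lemma rt_power [simp]: "rt (x :: 'c) ^ q = x"
proof -
  have "\<exists>!y. y ^ q = x" using ex_root_q[of x] power_q_inj[of _ 1] by auto
  then have "(THE y. y ^ q = x) ^ q = x" by (rule theI')
  then show ?thesis by (simp add: frob_def)
qed

lemma rt_unique: "(y :: 'c) ^ q = x \<Longrightarrow> rt x = y"
  using power_q_inj[of "rt x" 1 y] by simp

lemma rt_of_power [simp]: "rt ((x :: 'c) ^ q) = x"
  by (rule rt_unique) simp

lemma rt_0 [simp]: "rt (0 :: 'c) = 0" and rt_1 [simp]: "rt (1 :: 'c) = 1"
  by (rule rt_unique; use q_pos in simp)+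

lemma rt_add: "rt (x + y :: 'c) = rt x + rt y"
  using add_power_q[of "rt x" "rt y" 1] by (intro rt_unique) simp

lemma rt_mult: "rt (x * y :: 'c) = rt x * rt y"
  by (intro rt_unique) (simp add: power_mult_distrib)

lemma rt_Fq: "x \<in> Fq \<Longrightarrow> rt x = x"
  by (intro rt_unique Fq_power_q)

section \<open>Closure properties of the algebraic closure of K\<close>

abbreviation "KK \<equiv> Kbar Fq \<theta>"

lemma KK_add: "x \<in> KK \<Longrightarrow> y \<in> KK \<Longrightarrow> x + y \<in> KK"
  and KK_diff: "x \<in> KK \<Longrightarrow> y \<in> KK \<Longrightarrow> x - y \<in> KK"
  and KK_mult: "x \<in> KK \<Longrightarrow> y \<in> KK \<Longrightarrow> x * y \<in> KK"
  and KK_minus: "x \<in> KK \<Longrightarrow> - x \<in> KK"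
  and KK_0 [simp]: "0 \<in> KK" and KK_1 [simp]: "1 \<in> KK"
  and KK_Fq: "x \<in> Fq \<Longrightarrow> x \<in> KK"
  and KK_theta: "\<theta> \<in> KK"
proof -
  note K = Kfield_subfield[OF Fq_subfield, of \<theta>]
  show diff: "x - y \<in> KK" if "x \<in> KK" "y \<in> KK" for x y using that algebraic_diff[OF K] by (simp add: Kbar_def)
  show "x * y \<in> KK" if "x \<in> KK" "y \<in> KK" for x y using that algebraic_mult[OF K] by (simp add: Kbar_def)
  have sub: "x \<in> KK" if "x \<in> Kfield Fq \<theta>" for x using that subfield_subset_algebraic[OF K] by (simp add: Kbar_def)
  show 0: "0 \<in> KK" and "1 \<in> KK" using sub K by (auto simp: is_subfield_def)
  show m: "- x \<in> KK" if "x \<in> KK" for x using diff[OF 0 that] by simp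
  show "x + y \<in> KK" if "x \<in> KK" "y \<in> KK" for x y using diff[OF that(1) m[OF that(2)]] by simp
  note c = subfield_0[OF Fq_subfield] subfield_1[OF Fq_subfield]
  have one: "[:1:] \<in> polys_over Fq" using c by (auto simp: polys_over_def coeff_pCons split: nat.split)
  show "x \<in> KK" if "x \<in> Fq" for x
  proof (rule sub)
    have "[:x:] \<in> polys_over Fq" using c that by (auto simp: polys_over_def coeff_pCons split: nat.split)
    with one show "x \<in> Kfield Fq \<theta>" unfolding Kfield_def
      by (intro CollectI exI[of _ "[:x:]"] exI[of _ "[:1:]"]) auto
  qed
  show "\<theta> \<in> KK"
  proof (rule sub)
    have "[:0, 1:] \<in> polys_over Fq" using c by (auto simp: polys_over_def coeff_pCons split: nat.split)
    with one show "\<theta> \<in> Kfield Fq \<theta>" unfolding Kfield_def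
      by (intro CollectI exI[of _ "[:0, 1:]"] exI[of _ "[:1:]"]) auto
  qed
qed

lemma KK_power: "x \<in> KK \<Longrightarrow> x ^ n \<in> KK"
  by (induction n) (auto intro: KK_mult)

lemma KK_sum: "(\<And>i. i \<in> I \<Longrightarrow> f i \<in> KK) \<Longrightarrow> sum f I \<in> KK"
  by (induction I rule: infinite_finite_induct) (auto intro: KK_add)

text \<open>If p vanishes at x, then p(X^q) vanishes at the q-th root of x. So \<sigma>, which takes
  q-th roots of scalars, does not lead out of the scalars of the module.\<close>

lemma KK_rt: assumes "x \<in> KK" shows "rt x \<in> KK"
proof -
  from assms obtain p where p: "p \<in> polys_over (Kfield Fq \<theta>)" "p \<noteq> 0" "poly p x = 0"
    by (auto simp: Kbar_def algebraic_closure_in_def)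
  define r where "r = (\<Sum>j\<le>degree p. monom (coeff p j) (q * j))"
  have c: "coeff r (q * j) = coeff p j" for j
    using q_pos by (auto simp: r_def coeff_sum coeff_eq_0)
  then have "r \<noteq> 0" using p(2) by (metis coeff_0 leading_coeff_0_iff)
  moreover have "poly r (rt x) = 0"
    using p(3) by (simp add: r_def poly_sum poly_monom power_mult poly_altdef[of p])
  moreover have "r \<in> polys_over (Kfield Fq \<theta>)"
    using p(1) Kfield_subfield[OF Fq_subfield, of \<theta>]
    by (auto simp: r_def polys_over_def coeff_sum intro!: subfield_sum subfield_0)
  ultimately show ?thesis by (auto simp: Kbar_def algebraic_closure_in_def)
qed

text \<open>The powers of \<theta> have pairwise different absolute values. With infinitely many
  scalars an additive polynomial can be recovered from its values.\<close>

lemma KK_infinite: "infinite KK"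
proof
  assume "finite KK"
  moreover have "range (\<lambda>n. \<theta> ^ n) \<subseteq> KK" by (auto intro: KK_power KK_theta)
  ultimately have "finite (range (\<lambda>n. \<theta> ^ n))" using finite_subset by blast
  moreover have "inj (\<lambda>n. \<theta> ^ n)"
  proof
    fix m n assume "\<theta> ^ m = \<theta> ^ n"
    then have "real q ^ m = real q ^ n" using absval_power[of \<theta>] absval_theta by metis
    then show "m = n" using q_ge_2 by simp
  qed
  ultimately show False using finite_imageD by blast
qed

lemma theta_nz: "\<theta> \<noteq> 0"
  using absval_theta q_pos by auto

end

subsection \<open>Coefficientwise maps\<close>

definition fps_map :: "('a::zero \<Rightarrow> 'a) \<Rightarrow> 'a fps \<Rightarrow> 'a fps" where
  "fps_map \<phi> g = Abs_fps (\<lambda>n. \<phi> (fps_nth g n))"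

definition fls_map :: "('a::zero \<Rightarrow> 'a) \<Rightarrow> 'a fls \<Rightarrow> 'a fls" where
  "fls_map \<phi> g = Abs_fls (\<lambda>n. \<phi> (fls_nth g n))"

lemma fps_map_nth [simp]: "fps_nth (fps_map \<phi> g) n = \<phi> (fps_nth g n)"
  by (simp add: fps_map_def)

lemma fps_to_fls_sum: "fps_to_fls (sum f I) = (\<Sum>i\<in>I. fps_to_fls (f i :: 'a::field fps))"
  by (induction I rule: infinite_finite_induct) auto

text \<open>The instances are x^q, x^(q^k) and the q-th root. Injectivity keeps subdegrees of
  Laurent series, hence the index ranges in their products.\<close>

locale injective_endomorphism =
  fixes \<phi> :: "'a::field \<Rightarrow> 'a"
  assumes hom_add: "\<phi> (x + y) = \<phi> x + \<phi> y" and hom_mult: "\<phi> (x * y) = \<phi> x * \<phi> y"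
    and eq_0_iff [simp]: "\<phi> x = 0 \<longleftrightarrow> x = 0"
begin

lemma hom_0: "\<phi> 0 = 0" by simp

lemma hom_1 [simp]: "\<phi> 1 = 1"
proof -
  have "\<phi> 1 * \<phi> 1 = \<phi> 1" using hom_mult[of 1 1] by simp
  then show ?thesis by simp
qed

lemma hom_minus: "\<phi> (- x) = - \<phi> x"
  using hom_add[of "- x" x] hom_0 by (simp add: eq_neg_iff_add_eq_0)

lemma hom_sum: "\<phi> (sum f I) = (\<Sum>i\<in>I. \<phi> (f i))"
  by (induction I rule: infinite_finite_induct) (auto simp: hom_add)

lemma fps_map_add: "fps_map \<phi> (f + g) = fps_map \<phi> f + fps_map \<phi> g"
  by (rule fps_ext) (simp add: hom_add)

lemma fps_map_mult: "fps_map \<phi> (f * g) = fps_map \<phi> f * fps_map \<phi> g"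
  by (rule fps_ext) (simp add: fps_mult_nth hom_sum hom_mult)

lemma fps_map_0 [simp]: "fps_map \<phi> 0 = 0" by (rule fps_ext) simp

lemma fps_map_minus: "fps_map \<phi> (- f) = - fps_map \<phi> f"
  by (rule fps_ext) (simp add: hom_minus)

lemma fps_map_sum: "fps_map \<phi> (sum f I) = (\<Sum>i\<in>I. fps_map \<phi> (f i))"
  by (induction I rule: infinite_finite_induct) (auto simp: fps_map_add)

lemma fps_map_of_poly: "fps_map \<phi> (fps_of_poly p) = fps_of_poly (map_poly \<phi> p)"
  by (rule fps_ext) (simp add: coeff_map_poly)

lemma fls_map_nth [simp]: "fls_nth (fls_map \<phi> g) n = \<phi> (fls_nth g n)"
proof -
  obtain N where "\<forall>n<N. fls_nth g n = 0" by (rule fls_nth_vanishes_belowE)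
  then show ?thesis unfolding fls_map_def
    by (intro nth_Abs_fls_ex_lower_bound exI[of _ N]) simp
qed

lemma fls_map_subdegree [simp]: "fls_subdegree (fls_map \<phi> g) = fls_subdegree g"
proof (cases "g = 0")
  case True
  then have "fls_map \<phi> g = 0" by (intro fls_eqI) simp
  with True show ?thesis by simp
next
  case False
  then show ?thesis by (intro fls_subdegree_eqI) auto
qed

lemma fls_map_mult: "fls_map \<phi> (f * g) = fls_map \<phi> f * fls_map \<phi> g"
  by (rule fls_eqI) (simp add: fls_times_nth(2) hom_sum hom_mult)

lemma fls_map_add: "fls_map \<phi> (f + g) = fls_map \<phi> f + fls_map \<phi> g"
  by (rule fls_eqI) (simp add: hom_add)

lemma fls_map_0 [simp]: "fls_map \<phi> 0 = 0" by (rule fls_eqI) simp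

lemma fls_map_1 [simp]: "fls_map \<phi> 1 = 1" by (rule fls_eqI) simp

lemma fls_map_sum: "fls_map \<phi> (sum f I) = (\<Sum>i\<in>I. fls_map \<phi> (f i))"
  by (induction I rule: infinite_finite_induct) (auto simp: fls_map_add)

lemma fls_map_fps: "fls_map \<phi> (fps_to_fls f) = fps_to_fls (fps_map \<phi> f)"
  by (rule fls_eqI) simp

lemma map_poly_hom_add: "map_poly \<phi> (f + g) = map_poly \<phi> f + map_poly \<phi> g"
  by (rule poly_eqI) (simp add: coeff_map_poly hom_add)

lemma map_poly_hom_mult: "map_poly \<phi> (f * g) = map_poly \<phi> f * map_poly \<phi> g"
  by (rule poly_eqI) (simp add: coeff_map_poly coeff_mult hom_sum hom_mult)

end

context c_infinity
begin

sublocale power_q: injective_endomorphism "\<lambda>x::'c. x ^ q"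
  using add_power_q[of _ _ 1] q_pos by unfold_locales (auto simp: power_mult_distrib)

sublocale power_q_power: injective_endomorphism "\<lambda>x::'c. x ^ (q ^ k)" for k
  using q_pos by unfold_locales (auto simp: power_mult_distrib add_power_q)

sublocale rt: injective_endomorphism "rt :: 'c \<Rightarrow> 'c"
proof
  show "rt x = 0 \<longleftrightarrow> x = 0" for x :: 'c proof
    assume "rt x = 0"
    then have "x = 0 ^ q" using rt_power[of x] by metis
    then show "x = 0" using q_pos by simp
  qed simp
qed (simp_all add: rt_add rt_mult)

abbreviation "fps_fr \<equiv> fps_map (\<lambda>x::'c. x ^ q)"
abbreviation "fps_rt \<equiv> fps_map (rt :: 'c \<Rightarrow> 'c)"

lemma fps_fr_rt [simp]: "fps_fr (fps_rt g) = g" and fps_rt_fr [simp]: "fps_rt (fps_fr g) = g"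
  by (rule fps_ext, simp)+

lemma frob_fls_rt: "frob_fls q (- 1) g = fls_map rt (g :: 'c fls)"
  by (simp add: frob_fls_def fls_map_def)

lemma frob_fls_int: "frob_fls q (int k) g = fls_map (\<lambda>x. x ^ (q ^ k)) (g :: 'c fls)"
  by (simp add: frob_fls_def fls_map_def)

lemma fps_map_Fq:
  assumes "a \<in> polys_over Fq"
  shows "fps_fr (fps_of_poly a) = fps_of_poly a" "fps_rt (fps_of_poly a) = fps_of_poly a"
    "fps_map (\<lambda>x::'c. x ^ (q ^ k)) (fps_of_poly a) = fps_of_poly a"
  using assms by (auto intro!: fps_ext simp: polys_over_def Fq_power_q Fq_power_q_power rt_Fq)

subsection \<open>Weighted Gauss norms\<close>

text \<open>The weighted Gauss norm at radius \<open>R\<close> is at most \<open>B\<close>. A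
  predicate and not a supremum, so that no number has to stand for the norm of an unbounded
  series.\<close>

definition bd :: "real \<Rightarrow> real \<Rightarrow> 'c fps \<Rightarrow> bool" where
  "bd R B g \<longleftrightarrow> (\<forall>n. absval (fps_nth g n) * R ^ n \<le> B)"

lemma bd_nonneg: "R \<ge> 0 \<Longrightarrow> bd R B g \<Longrightarrow> B \<ge> 0"
  unfolding bd_def by (metis absval_nonneg mult_nonneg_nonneg order_trans zero_le_power)

lemma bd_mono: "bd R B g \<Longrightarrow> B \<le> B' \<Longrightarrow> bd R B' g"
  unfolding bd_def using order_trans by blast

lemma bd_antimono_radius: "bd R B g \<Longrightarrow> 0 \<le> R' \<Longrightarrow> R' \<le> R \<Longrightarrow> bd R' B g"
  unfolding bd_def by (meson absval_nonneg mult_left_mono order_trans power_mono)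

lemma bd_sum:
  assumes "R > 0" "B \<ge> 0" "\<And>i. i \<in> I \<Longrightarrow> bd R B (f i)"
  shows "bd R B (sum f I)"
  unfolding bd_def
proof
  fix n
  have "absval (\<Sum>i\<in>I. fps_nth (f i) n) \<le> B / R ^ n"
    using assms by (intro absval_sum_le) (auto simp: bd_def field_simps)
  then show "absval (fps_nth (sum f I) n) * R ^ n \<le> B"
    using assms(1) by (simp add: fps_sum_nth field_simps)
qed

lemma bd_add: "R \<ge> 0 \<Longrightarrow> bd R B f \<Longrightarrow> bd R B g \<Longrightarrow> bd R B (f + g)"
  unfolding bd_def
proof
  fix n assume "R \<ge> 0" "\<forall>n. absval (fps_nth f n) * R ^ n \<le> B" "\<forall>n. absval (fps_nth g n) * R ^ n \<le> B"
  then show "absval (fps_nth (f + g) n) * R ^ n \<le> B"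
    using absval_add[of "fps_nth f n" "fps_nth g n"]
    by (smt (verit) fps_add_nth mult_right_mono zero_le_power)
qed

lemma bd_minus: "bd R B (- f) \<longleftrightarrow> bd R B f"
  by (simp add: bd_def)

lemma bd_diff: "R \<ge> 0 \<Longrightarrow> bd R B f \<Longrightarrow> bd R B g \<Longrightarrow> bd R B (f - g)"
  using bd_add[of R B f "- g"] by (simp add: bd_minus)

lemma bd_mult:
  assumes R: "R > 0" and f: "bd R A f" and g: "bd R B g"
  shows "bd R (A * B) (f * g)"
  unfolding bd_def
proof
  fix n
  have AB: "A \<ge> 0" "B \<ge> 0" using bd_nonneg[of R] R f g by (auto intro: less_imp_le)
  have "absval (fps_nth (f * g) n) \<le> A * B / R ^ n"
    unfolding fps_mult_nth
  proof (rule absval_sum_le)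
    fix i assume i: "i \<in> {0..n}"
    have "absval (fps_nth f i * fps_nth g (n - i)) * R ^ n
        = (absval (fps_nth f i) * R ^ i) * (absval (fps_nth g (n - i)) * R ^ (n - i))"
      using i by (simp add: absval_mult mult_ac power_add[symmetric])
    also have "\<dots> \<le> A * B" using f g R AB by (intro mult_mono) (auto simp: bd_def)
    finally show "absval (fps_nth f i * fps_nth g (n - i)) \<le> A * B / R ^ n"
      using R by (simp add: field_simps)
  qed (use AB R in auto)
  then show "absval (fps_nth (f * g) n) * R ^ n \<le> A * B" using R by (simp add: field_simps)
qed

text \<open>The twist enlarges the radius from R to R^q; for R = q this is what carries series past
  \<theta>.\<close>

lemma bd_fps_fr: "R \<ge> 0 \<Longrightarrow> bd R B g \<Longrightarrow> bd (R ^ q) (B ^ q) (fps_fr g)"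
  unfolding bd_def
proof
  fix n assume R: "R \<ge> 0" "\<forall>n. absval (fps_nth g n) * R ^ n \<le> B"
  then have "(absval (fps_nth g n) * R ^ n) ^ q \<le> B ^ q" by (intro power_mono) auto
  then show "absval (fps_nth (fps_fr g) n) * (R ^ q) ^ n \<le> B ^ q"
    by (simp add: absval_power power_mult_distrib power_mult[symmetric] mult.commute)
qed

lemma bd_fps_of_poly: "\<exists>B. bd R B (fps_of_poly p)"
proof (intro exI, unfold bd_def, intro allI)
  fix n
  show "absval (fps_nth (fps_of_poly p) n) * R ^ n \<le> (\<Sum>i\<le>degree p. absval (coeff p i) * \<bar>R\<bar> ^ i)"
  proof (cases "n \<le> degree p")
    case True
    have "absval (coeff p n) * R ^ n \<le> absval (coeff p n) * \<bar>R\<bar> ^ n"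
      by (intro mult_left_mono) (auto simp: power_abs[symmetric])
    also have "\<dots> \<le> (\<Sum>i\<le>degree p. absval (coeff p i) * \<bar>R\<bar> ^ i)"
      using True by (intro member_le_sum) auto
    finally show ?thesis by simp
  next
    case False
    then have "coeff p n = 0" by (simp add: coeff_eq_0)
    then show ?thesis by (auto intro!: sum_nonneg)
  qed
qed

text \<open>Membership in the Tate algebra of the closed disk of radius |\<theta>| = q, where Taylor
  expansion at \<theta> makes sense.\<close>

definition conv :: "'c fps \<Rightarrow> bool" where
  "conv g \<longleftrightarrow> (\<lambda>n. absval (fps_nth g n) * real q ^ n) \<longlonglongrightarrow> 0"

lemma conv_fps_of_poly: "conv (fps_of_poly p)"
  unfolding conv_def
proof (rule tendsto_eventually)
  show "\<forall>\<^sub>F n in sequentially. absval (fps_nth (fps_of_poly p) n) * real q ^ n = 0"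
    using eventually_gt_at_top[of "degree p"] by eventually_elim (simp add: coeff_eq_0)
qed

lemma tendsto_0_sandwich:
  fixes f g :: "'b \<Rightarrow> real"
  assumes "\<And>n. 0 \<le> f n" "\<And>n. f n \<le> g n" "(g \<longlongrightarrow> 0) G"
  shows "(f \<longlongrightarrow> 0) G"
  using tendsto_sandwich[of "\<lambda>_. 0" f G g 0] assms by (simp add: tendsto_const)

text \<open>A bound at a strictly larger radius leaves the geometric factor (q / R)^n at radius
  q.\<close>

lemma conv_if_bd:
  assumes "bd R B g" "R > real q"
  shows "conv g"
  unfolding conv_def
proof (rule tendsto_0_sandwich)
  fix n
  have R: "R > 0" using assms(2) q_pos by linarith
  have "absval (fps_nth g n) * R ^ n \<le> B" using assms by (simp add: bd_def)
  then have "absval (fps_nth g n) * R ^ n * (real q / R) ^ n \<le> B * (real q / R) ^ n"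
    using R by (intro mult_right_mono) auto
  then show "absval (fps_nth g n) * real q ^ n \<le> B * (real q / R) ^ n"
    using R by (simp add: power_divide)
next
  have "real q / R < 1" "\<bar>real q / R\<bar> = real q / R" using assms q_pos by auto
  then have "(\<lambda>n. (real q / R) ^ n) \<longlonglongrightarrow> 0" by (intro LIMSEQ_power_zero) (simp del: abs_divide)
  then show "(\<lambda>n. B * (real q / R) ^ n) \<longlonglongrightarrow> 0" by (rule tendsto_mult_right_zero)
qed simp

lemma conv_add: "conv f \<Longrightarrow> conv g \<Longrightarrow> conv (f + g)"
proof -
  assume "conv f" "conv g"
  then have *: "(\<lambda>n. absval (fps_nth f n) * real q ^ n + absval (fps_nth g n) * real q ^ n) \<longlonglongrightarrow> 0"
    unfolding conv_def using tendsto_add_zero by blast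
  show "conv (f + g)" unfolding conv_def
  proof (rule tendsto_0_sandwich[OF _ _ *])
    fix n
    have "absval (fps_nth (f + g) n) \<le> absval (fps_nth f n) + absval (fps_nth g n)"
      using absval_add[of "fps_nth f n" "fps_nth g n"] absval_nonneg
      by (smt (verit) fps_add_nth)
    then show "absval (fps_nth (f + g) n) * real q ^ n \<le> absval (fps_nth f n) * real q ^ n + absval (fps_nth g n) * real q ^ n"
      by (metis distrib_right mult_right_mono of_nat_0_le_iff zero_le_power)
  qed simp
qed

lemma conv_minus: "conv (- f) \<longleftrightarrow> conv f"
  by (simp add: conv_def)

lemma conv_diff: "conv f \<Longrightarrow> conv g \<Longrightarrow> conv (f - g)"
  using conv_add[of f "- g"] by (simp add: conv_minus)

lemma conv_0 [simp]: "conv 0" by (simp add: conv_def)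

lemma conv_sum: "(\<And>i. i \<in> I \<Longrightarrow> conv (f i)) \<Longrightarrow> conv (sum f I)"
  by (induction I rule: infinite_finite_induct) (auto intro: conv_add)

lemma conv_const_mult: "conv g \<Longrightarrow> conv (fps_const c * g)"
  unfolding conv_def using tendsto_mult_right_zero[of "\<lambda>n. absval (fps_nth g n) * real q ^ n" sequentially "absval c"]
  by (simp add: absval_mult mult.assoc)

lemma conv_bd: assumes "conv g" shows "\<exists>B. bd (real q) B g"
proof -
  have "Bseq (\<lambda>n. absval (fps_nth g n) * real q ^ n)"
    using assms unfolding conv_def by (intro convergent_imp_Bseq convergentI)
  then obtain B where "\<forall>n. norm (absval (fps_nth g n) * real q ^ n) \<le> B" by (auto simp: Bseq_def)
  then show ?thesis unfolding bd_def by (intro exI[of _ B]) (auto simp: abs_mult)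
qed

lemma absval_Fq: assumes "a \<in> Fq" "a \<noteq> 0" shows "absval a = 1"
proof -
  have "absval a ^ q = absval a" using Fq_power_q[OF assms(1)] absval_power[of a q] by simp
  then have "absval a ^ (q - 1) * absval a = 1 * absval a" using power_minus_mult[OF q_pos, of "absval a"] by simp
  then have "absval a ^ (q - 1) = 1" using assms by simp
  then show ?thesis using q_ge_2 power_eq_1_iff[of "absval a" "q - 1"] by simp
qed

text \<open>The lowest coefficient of \<open>F\<close> has absolute value 1, so no coefficient of \<open>g\<close> can exceed the bound first.\<close>

lemma bd_cancel_Fq:
  assumes F: "F \<in> polys_over Fq" "F \<noteq> 0" and b: "bd 1 B (fps_of_poly F * g)"
  shows "bd 1 B g"
proof -
  define k where "k = (LEAST k. coeff F k \<noteq> 0)"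
  have "\<exists>k. coeff F k \<noteq> 0" using F(2) by (meson leading_coeff_0_iff)
  then have k: "coeff F k \<noteq> 0" unfolding k_def by (rule LeastI_ex)
  have k0: "coeff F i = 0" if "i < k" for i using not_less_Least[of i] that unfolding k_def by blast
  have B: "B \<ge> 0" using b by (rule bd_nonneg[rotated]) simp
  have "absval (fps_nth g n) \<le> B" for n
  proof (induction n rule: less_induct)
    case (less n)
    have "fps_nth (g * fps_of_poly F) (n + k) = (\<Sum>i\<le>n + k. fps_nth g i * coeff F (n + k - i))"
      by (simp add: fps_mult_nth atMost_atLeast0)
    also have "\<dots> = (\<Sum>i\<le>n. fps_nth g i * coeff F (n + k - i))"
      using k0 by (intro sum.mono_neutral_right) auto
    also have "\<dots> = (\<Sum>i<n. fps_nth g i * coeff F (n + k - i)) + fps_nth g n * coeff F k"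
      by (simp add: lessThan_Suc_atMost[symmetric])
    finally have *: "fps_nth g n * coeff F k = fps_nth (fps_of_poly F * g) (n + k) - (\<Sum>i<n. fps_nth g i * coeff F (n + k - i))"
      by (simp add: mult.commute)
    have "absval (fps_nth g n * coeff F k) \<le> B" unfolding *
    proof (intro absval_diff_le absval_sum_le B)
      show "absval (fps_nth (fps_of_poly F * g) (n + k)) \<le> B" using b by (simp add: bd_def)
      fix i assume "i \<in> {..<n}"
      then have "absval (fps_nth g i) \<le> B" using less by simp
      moreover have "absval (coeff F (n + k - i)) \<le> 1"
        using F(1) absval_Fq[of "coeff F (n + k - i)"] by (cases "coeff F (n + k - i) = 0") (auto simp: polys_over_def)
      ultimately have "absval (fps_nth g i) * absval (coeff F (n + k - i)) \<le> B * 1" using B by (intro mult_mono) auto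
      then show "absval (fps_nth g i * coeff F (n + k - i)) \<le> B" by (simp add: absval_mult)
    qed
    then show ?case using k F(1) absval_Fq[of "coeff F k"] by (simp add: absval_mult polys_over_def)
  qed
  then show ?thesis by (simp add: bd_def)
qed

subsection \<open>Convergent series\<close>

text \<open>The type \<open>'c\<close> carries only the classes of fields and metric spaces, so the
  limit laws for series are derived from the real-valued \<open>absval\<close>.\<close>

lemma sums_absval_iff: "(f :: nat \<Rightarrow> 'c) sums s \<longleftrightarrow> (\<lambda>n. absval ((\<Sum>i<n. f i) - s)) \<longlonglongrightarrow> 0"
  unfolding sums_def by (rule tendsto_absval_iff)

lemma tendsto_absval_add:
  assumes "((\<lambda>n. absval (f n :: 'c)) \<longlongrightarrow> 0) G" "((\<lambda>n. absval (g n :: 'c)) \<longlongrightarrow> 0) G"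
  shows "((\<lambda>n. absval (f n + g n)) \<longlongrightarrow> 0) G"
proof (rule tendsto_0_sandwich[OF _ _ tendsto_add_zero[OF assms]])
  show "absval (f n + g n) \<le> absval (f n) + absval (g n)" for n
    using absval_add[of "f n" "g n"] by (smt (verit) absval_nonneg)
qed simp

lemma tendsto_absval_mult:
  "((\<lambda>n. absval (f n :: 'c)) \<longlongrightarrow> 0) G \<Longrightarrow> ((\<lambda>n. absval (c * f n)) \<longlongrightarrow> 0) G"
  by (simp add: absval_mult tendsto_mult_right_zero)

lemma tendsto_absval_sum:
  "(\<And>i. i \<in> I \<Longrightarrow> ((\<lambda>n. absval (f i n :: 'c)) \<longlongrightarrow> 0) G) \<Longrightarrow> ((\<lambda>n. absval (\<Sum>i\<in>I. f i n)) \<longlongrightarrow> 0) G"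
proof (induction I rule: infinite_finite_induct)
  case (insert x F)
  then show ?case using tendsto_absval_add[of "f x"] by simp
qed auto

lemma sums_add_c: "(f :: nat \<Rightarrow> 'c) sums s \<Longrightarrow> g sums t \<Longrightarrow> (\<lambda>n. f n + g n) sums (s + t)"
  unfolding sums_absval_iff using tendsto_absval_add[of "\<lambda>n. (\<Sum>i<n. f i) - s" sequentially "\<lambda>n. (\<Sum>i<n. g i) - t"]
  by (simp add: sum.distrib algebra_simps)

lemma sums_mult_c: "(f :: nat \<Rightarrow> 'c) sums s \<Longrightarrow> (\<lambda>n. c * f n) sums (c * s)"
  unfolding sums_absval_iff using tendsto_absval_mult[of "\<lambda>n. (\<Sum>i<n. f i) - s" sequentially c]
  by (simp add: right_diff_distrib sum_distrib_left)

lemma sums_sum_c: "(\<And>i. i \<in> I \<Longrightarrow> (f i :: nat \<Rightarrow> 'c) sums s i) \<Longrightarrow> (\<lambda>n. \<Sum>i\<in>I. f i n) sums (\<Sum>i\<in>I. s i)"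
proof (induction I rule: infinite_finite_induct)
  case (insert x F)
  then show ?case using sums_add_c[of "f x"] by simp
qed auto

text \<open>Non-archimedean Cauchy criterion: a block of the series is no larger than its largest
  term.\<close>

lemma sums_null:
  assumes "(\<lambda>n. absval (f n :: 'c)) \<longlonglongrightarrow> 0"
  shows "\<exists>s. f sums s"
proof -
  have "Cauchy (\<lambda>n. \<Sum>i<n. f i)"
  proof (rule metric_CauchyI)
    fix e :: real assume "e > 0"
    \<comment> \<open>The ultrametric bound for a block is not strict, so half of \<open>e\<close>
      is used.\<close>
    then obtain N where N: "\<And>n. n \<ge> N \<Longrightarrow> absval (f n) < e / 2"
      using order_tendstoD(2)[OF assms, of "e / 2"] by (auto simp: eventually_sequentially)
    have *: "absval ((\<Sum>i<n. f i) - (\<Sum>i<m. f i)) \<le> e / 2" if "m \<ge> N" "m \<le> n" for m n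
    proof -
      have "(\<Sum>i<n. f i) = (\<Sum>i<m. f i) + (\<Sum>i\<in>{m..<n}. f i)"
        using that by (simp add: ivl_disj_un_one(2) sum.union_disjoint[symmetric] ivl_disj_int_one(2))
      moreover have "absval (\<Sum>i\<in>{m..<n}. f i) \<le> e / 2"
        using N that \<open>e > 0\<close> by (intro absval_sum_le) (auto intro: less_imp_le)
      ultimately show ?thesis by simp
    qed
    have "dist (\<Sum>i<m. f i) (\<Sum>i<n. f i) < e" if "m \<ge> N" "n \<ge> N" for m n
      using *[of m n] *[of n m] that \<open>e > 0\<close> unfolding dist_eq
      by (cases "m \<le> n") (auto simp: absval_diff_commute[of "\<Sum>i<m. f i"])
    then show "\<exists>N. \<forall>m\<ge>N. \<forall>n\<ge>N. dist (\<Sum>i<m. f i) (\<Sum>i<n. f i) < e" by blast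
  qed
  then show ?thesis using complete unfolding complete_def sums_def by blast
qed

lemma sums_null_terms:
  assumes "(f :: nat \<Rightarrow> 'c) sums s"
  shows "(\<lambda>n. absval (f n)) \<longlonglongrightarrow> 0"
proof -
  have l: "(\<lambda>n. absval ((\<Sum>i<n. f i) - s)) \<longlonglongrightarrow> 0" using assms by (simp add: sums_absval_iff)
  have "(\<lambda>n. absval (((\<Sum>i<Suc n. f i) - s) + - ((\<Sum>i<n. f i) - s))) \<longlonglongrightarrow> 0"
    by (intro tendsto_absval_add LIMSEQ_Suc[OF l]) (use l in \<open>simp only: absval_minus\<close>)
  then show ?thesis by simp
qed

text \<open>If |s| exceeded B, an approximant closer to s than |s| would have absolute value |s|
  itself.\<close>

lemma limit_absval_le:
  assumes "(\<lambda>n. absval (f n - s :: 'c)) \<longlonglongrightarrow> 0" "\<And>n. absval (f n) \<le> B"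
  shows "absval s \<le> B"
proof (rule ccontr)
  assume *: "\<not> absval s \<le> B"
  have "B \<ge> 0" using assms(2)[of 0] absval_nonneg[of "f 0"] by linarith
  with * have "absval s > 0" by simp
  then obtain n where n: "absval (f n - s) < absval s"
    using order_tendstoD(2)[OF assms(1)] by (auto simp: eventually_sequentially)
  have "absval (f n - (f n - s)) \<le> max B (absval (f n - s))"
    by (rule absval_diff_le) (use assms(2)[of n] in auto)
  then have "absval s \<le> max B (absval (f n - s))" by simp
  then show False using n * by (auto simp: max_def split: if_splits)
qed

lemma sums_absval_le:
  assumes "(f :: nat \<Rightarrow> 'c) sums s" "\<And>n. absval (f n) \<le> B"
  shows "absval s \<le> B"
proof (rule limit_absval_le)
  show "(\<lambda>n. absval ((\<Sum>i<n. f i) - s)) \<longlonglongrightarrow> 0" using assms by (simp add: sums_absval_iff)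
  have "B \<ge> 0" using assms(2)[of 0] absval_nonneg[of "f 0"] by linarith
  then show "absval (\<Sum>i<n. f i) \<le> B" for n using assms(2) by (intro absval_sum_le) auto
qed

lemma sums_vec_iff: "(f :: nat \<Rightarrow> 'c ^ 'n) sums s \<longleftrightarrow> (\<forall>i. (\<lambda>n. f n $ i) sums (s $ i))"
  unfolding sums_def by (auto simp: vec_eq_iff intro: vec_tendstoI dest: tendsto_vec_nth[where i = "_"] simp flip: sum_component)

lemma sums_vec_add: "(f :: nat \<Rightarrow> 'c ^ 'n) sums s \<Longrightarrow> g sums t \<Longrightarrow> (\<lambda>n. f n + g n) sums (s + t)"
  by (simp add: sums_vec_iff sums_add_c)

lemma sums_vec_smult: "(f :: nat \<Rightarrow> 'c ^ 'n) sums s \<Longrightarrow> (\<lambda>n. c *s f n) sums (c *s s)"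
  by (simp add: sums_vec_iff sums_mult_c)

lemma sums_matrix_vector: "(f :: nat \<Rightarrow> 'c ^ 'n) sums s \<Longrightarrow> (\<lambda>n. A *v f n) sums ((A :: 'c ^ 'n ^ 'm) *v s)"
  by (simp add: sums_vec_iff matrix_vector_mult_def sums_sum_c sums_mult_c)

end

subsection \<open>The module and its two expansions\<close>

text \<open>The assumption \<open>torsion\<close> has two effects: \<open>\<delta>\<^sub>0\<close>
  vanishes on high powers of t - \<theta>, and \<open>\<Phi>'\<close> becomes invertible over power
  series.\<close>

locale dual_motive = c_infinity Fq \<theta>
  for Fq :: "'c::{field,metric_space} set" and \<theta> :: 'c +
  fixes M :: "('c, 'm::ab_group_add) tsigma_ops" and m :: "'r::finite \<Rightarrow> 'm" and w :: "'d::finite \<Rightarrow> 'm"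
    and \<Phi>' :: "'c poly ^ 'r ^ 'r"
  assumes tsigma: "tsigma_module Fq \<theta> M"
    and t_basis: "is_t_basis Fq \<theta> M UNIV m"
    and sigma_basis: "is_sigma_basis Fq \<theta> M w"
    and torsion: "\<exists>L. \<forall>x. poly_act M ([:- \<theta>, 1:] ^ L) x \<in> range (sigma M)"
    and Phi'_Kbar: "\<Phi>' $ i $ j \<in> polys_over (Kbar Fq \<theta>)"
    and Phi'_sigma: "sigma M (m i) = (\<Sum>j\<in>UNIV. poly_act M (\<Phi>' $ i $ j) (m j))"
begin

sublocale tsigma_module Fq \<theta> M by (rule tsigma)

abbreviation "PK \<equiv> polys_over KK"
abbreviation "\<sigma>\<^sub>t \<equiv> sigma_coord q \<Phi>'"

lemma smul_0_left [simp]: "smul M 0 x = 0"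
  using smul_add_left[of 0 0 x] by simp

lemma smul_0_right [simp]: "c \<in> KK \<Longrightarrow> smul M c 0 = 0"
  using smul_add_right[of c 0 0] by simp

lemma tmul_0 [simp]: "tmul M 0 = 0" using tmul_add[of 0 0] by simp

lemma sigma_0 [simp]: "sigma M 0 = 0" using sigma_add[of 0 0] by simp

lemma sigma_sum: "sigma M (sum f I) = (\<Sum>i\<in>I. sigma M (f i))"
  by (induction I rule: infinite_finite_induct) (auto simp: sigma_add)

lemma smul_sum_right: "c \<in> KK \<Longrightarrow> smul M c (sum f I) = (\<Sum>i\<in>I. smul M c (f i))"
  by (induction I rule: infinite_finite_induct) (auto simp: smul_add_right)

lemma pCons_PK [simp]: "pCons a p \<in> PK \<longleftrightarrow> a \<in> KK \<and> p \<in> PK"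
  by (auto simp: polys_over_def coeff_pCons split: nat.splits)

lemma PK_0 [simp]: "0 \<in> PK" by (simp add: polys_over_def)

lemma PK_1 [simp]: "1 \<in> PK" by (simp add: one_pCons)

lemma PK_add: "p \<in> PK \<Longrightarrow> r \<in> PK \<Longrightarrow> p + r \<in> PK"
  by (simp add: polys_over_def KK_add)

lemma PK_mult: "p \<in> PK \<Longrightarrow> r \<in> PK \<Longrightarrow> p * r \<in> PK"
  by (auto simp: polys_over_def coeff_mult intro!: KK_sum KK_mult)

lemma PK_smult: "c \<in> KK \<Longrightarrow> p \<in> PK \<Longrightarrow> smult c p \<in> PK"
  by (simp add: polys_over_def KK_mult)

lemma PK_power: "p \<in> PK \<Longrightarrow> p ^ n \<in> PK"
  by (induction n) (auto intro: PK_mult)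

lemma PK_sum: "(\<And>i. i \<in> I \<Longrightarrow> f i \<in> PK) \<Longrightarrow> sum f I \<in> PK"
  by (induction I rule: infinite_finite_induct) (auto intro: PK_add)

lemma PK_monom: "c \<in> KK \<Longrightarrow> monom c n \<in> PK"
  by (simp add: polys_over_def)

lemma PK_Fq: "a \<in> polys_over Fq \<Longrightarrow> a \<in> PK"
  by (simp add: polys_over_def KK_Fq)

lemma PK_rt: "p \<in> PK \<Longrightarrow> map_poly rt p \<in> PK"
  by (simp add: polys_over_def coeff_map_poly KK_rt)

lemma PK_linear: "[:- \<theta>, 1:] \<in> PK"
  by (simp add: KK_minus KK_theta)

section \<open>The action of polynomials in t\<close>

lemma poly_act_le:
  assumes "degree p \<le> n"
  shows "poly_act M p x = (\<Sum>i\<le>n. smul M (coeff p i) ((tmul M ^^ i) x))"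
  unfolding poly_act_def using assms
  by (intro sum.mono_neutral_left) (auto simp: coeff_eq_0)

lemma tmul_sum: "tmul M (sum f I) = (\<Sum>i\<in>I. tmul M (f i))"
  by (induction I rule: infinite_finite_induct) (auto simp: tmul_add)

lemma poly_act_0 [simp]: "poly_act M 0 x = 0" by (simp add: poly_act_def)

lemma poly_act_pCons:
  assumes "p \<in> PK"
  shows "poly_act M (pCons a p) x = smul M a x + tmul M (poly_act M p x)"
proof -
  have "poly_act M (pCons a p) x = (\<Sum>i\<le>Suc (degree p). smul M (coeff (pCons a p) i) ((tmul M ^^ i) x))"
    by (rule poly_act_le) (rule degree_pCons_le)
  also have "\<dots> = smul M a x + (\<Sum>i\<le>degree p. smul M (coeff p i) (tmul M ((tmul M ^^ i) x)))"
    by (simp add: sum.atMost_Suc_shift del: sum.atMost_Suc)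
  also have "(\<Sum>i\<le>degree p. smul M (coeff p i) (tmul M ((tmul M ^^ i) x))) = tmul M (poly_act M p x)"
    using assms by (simp add: poly_act_def tmul_sum tmul_smul polys_over_def)
  finally show ?thesis .
qed

lemma poly_act_add_right: "p \<in> PK \<Longrightarrow> poly_act M p (x + y) = poly_act M p x + poly_act M p y"
  by (induction p) (auto simp: poly_act_pCons smul_add_right tmul_add)

lemma poly_act_add_left: "p \<in> PK \<Longrightarrow> r \<in> PK \<Longrightarrow> poly_act M (p + r) x = poly_act M p x + poly_act M r x"
proof (induction p arbitrary: r)
  case (pCons a p)
  obtain b r' where r: "r = pCons b r'" by (cases r)
  with pCons show ?case by (auto simp: poly_act_pCons smul_add_left tmul_add PK_add)
qed simp

lemma poly_act_smult: "c \<in> KK \<Longrightarrow> p \<in> PK \<Longrightarrow> poly_act M (smult c p) x = smul M c (poly_act M p x)"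
  by (induction p) (auto simp: poly_act_pCons smul_add_right smul_mult tmul_smul PK_smult)

lemma poly_act_mult: "p \<in> PK \<Longrightarrow> r \<in> PK \<Longrightarrow> poly_act M (p * r) x = poly_act M p (poly_act M r x)"
proof (induction p)
  case (pCons a p)
  then have "p * r \<in> PK" "a \<in> KK" "p \<in> PK" by (auto intro: PK_mult)
  with pCons show ?case by (simp add: poly_act_pCons poly_act_add_left poly_act_smult PK_smult)
qed simp

lemma poly_act_smul: "c \<in> KK \<Longrightarrow> p \<in> PK \<Longrightarrow> poly_act M p (smul M c x) = smul M c (poly_act M p x)"
  by (induction p) (auto simp: poly_act_pCons smul_add_right tmul_smul smul_mult[symmetric] mult.commute)

lemma poly_act_const: "c \<in> KK \<Longrightarrow> poly_act M [:c:] x = smul M c x"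
  by (simp add: poly_act_pCons)

lemma poly_act_1 [simp]: "poly_act M 1 x = x"
  by (simp add: one_pCons poly_act_const smul_one)

lemma poly_act_0_right [simp]: "p \<in> PK \<Longrightarrow> poly_act M p 0 = 0"
  using poly_act_add_right[of p 0 0] by simp

lemma poly_act_sum_right: "p \<in> PK \<Longrightarrow> poly_act M p (sum f I) = (\<Sum>i\<in>I. poly_act M p (f i))"
  by (induction I rule: infinite_finite_induct) (auto simp: poly_act_add_right)

lemma poly_act_sum_left: "(\<And>i. i \<in> I \<Longrightarrow> p i \<in> PK) \<Longrightarrow> poly_act M (sum p I) x = (\<Sum>i\<in>I. poly_act M (p i) x)"
  by (induction I rule: infinite_finite_induct) (auto simp: poly_act_add_left PK_sum)

lemma sigma_poly_act: "p \<in> PK \<Longrightarrow> sigma M (poly_act M p x) = poly_act M (map_poly rt p) (sigma M x)"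
  by (induction p) (auto simp: map_poly_pCons poly_act_pCons PK_rt sigma_add sigma_smul sigma_tmul)

lemma map_poly_rt_Fq: "a \<in> polys_over Fq \<Longrightarrow> map_poly rt a = a"
  by (intro poly_eqI) (simp add: coeff_map_poly polys_over_def rt_Fq)

lemma sigma_poly_act_Fq: "a \<in> polys_over Fq \<Longrightarrow> sigma M (poly_act M a x) = poly_act M a (sigma M x)"
  by (simp add: sigma_poly_act PK_Fq map_poly_rt_Fq)

section \<open>Coordinates in the basis over polynomials in t\<close>

definition comb :: "'c poly ^ 'r \<Rightarrow> 'm" where
  "comb g = (\<Sum>i\<in>UNIV. poly_act M (g $ i) (m i))"

abbreviation "\<kappa> \<equiv> t_coords Fq \<theta> M m"

lemma t_expansion_comb: "t_expansion Fq \<theta> M UNIV m g x \<longleftrightarrow> (\<forall>i. g i \<in> PK) \<and> x = comb (\<chi> i. g i)"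
  by (auto simp: t_expansion_def comb_def)

lemma coords_PK: "\<kappa> x $ i \<in> PK" and comb_coords: "comb (\<kappa> x) = x"
proof -
  have "\<exists>!g. t_expansion Fq \<theta> M UNIV m g x" using t_basis by (simp add: is_t_basis_def)
  from theI'[OF this] show "\<kappa> x $ i \<in> PK" "comb (\<kappa> x) = x"
    by (simp_all add: t_expansion_comb t_coords_def)
qed

lemma coords_comb: assumes "\<And>i. g $ i \<in> PK" shows "\<kappa> (comb g) = g"
proof -
  have "\<exists>!g'. t_expansion Fq \<theta> M UNIV m g' (comb g)" using t_basis by (simp add: is_t_basis_def)
  moreover have "t_expansion Fq \<theta> M UNIV m (\<lambda>i. g $ i) (comb g)" using assms by (simp add: t_expansion_comb)
  ultimately have "(THE g'. t_expansion Fq \<theta> M UNIV m g' (comb g)) = (\<lambda>i. g $ i)" by (intro the1_equality)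
  then show ?thesis by (simp add: t_coords_def)
qed

lemma comb_add: "(\<And>i. g $ i \<in> PK) \<Longrightarrow> (\<And>i. h $ i \<in> PK) \<Longrightarrow> comb (g + h) = comb g + comb h"
  by (simp add: comb_def poly_act_add_left sum.distrib)

lemma comb_poly_act: "p \<in> PK \<Longrightarrow> (\<And>i. g $ i \<in> PK) \<Longrightarrow> comb (p *s g) = poly_act M p (comb g)"
  by (simp add: comb_def poly_act_mult poly_act_sum_right)

lemma sigma_coord_PK: "(\<And>i. g $ i \<in> PK) \<Longrightarrow> \<sigma>\<^sub>t g $ i \<in> PK"
  unfolding sigma_coord_def vector_matrix_mult_def using Phi'_Kbar
  by (auto intro!: PK_sum PK_mult PK_rt)

lemma sigma_comb: assumes g: "\<And>i. g $ i \<in> PK" shows "sigma M (comb g) = comb (\<sigma>\<^sub>t g)"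
proof -
  have "sigma M (comb g) = (\<Sum>i\<in>UNIV. \<Sum>j\<in>UNIV. poly_act M (map_poly rt (g $ i) * \<Phi>' $ i $ j) (m j))"
    using g Phi'_Kbar
    by (simp add: comb_def sigma_sum sigma_poly_act Phi'_sigma poly_act_sum_right PK_rt poly_act_mult)
  also have "\<dots> = (\<Sum>j\<in>UNIV. \<Sum>i\<in>UNIV. poly_act M (map_poly rt (g $ i) * \<Phi>' $ i $ j) (m j))" by (rule sum.swap)
  also have "\<dots> = comb (\<sigma>\<^sub>t g)" using g Phi'_Kbar
    by (simp add: comb_def sigma_coord_def vector_matrix_mult_def poly_act_sum_left PK_rt PK_mult mult.commute)
  finally show ?thesis .
qed

lemma coords_eq: "(\<And>i. g $ i \<in> PK) \<Longrightarrow> comb g = x \<Longrightarrow> \<kappa> x = g"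
  using coords_comb by blast

lemma coords_add: "\<kappa> (x + y) = \<kappa> x + \<kappa> y"
  by (rule coords_eq) (auto simp: PK_add coords_PK comb_add comb_coords)

lemma coords_0 [simp]: "\<kappa> 0 = 0" using coords_add[of 0 0] by simp

lemma coords_sum: "\<kappa> (sum f I) = (\<Sum>i\<in>I. \<kappa> (f i))"
  by (induction I rule: infinite_finite_induct) (auto simp: coords_add)

lemma coords_poly_act: "p \<in> PK \<Longrightarrow> \<kappa> (poly_act M p x) = p *s \<kappa> x"
  by (rule coords_eq) (auto simp: PK_mult coords_PK comb_poly_act comb_coords)

lemma coords_smul: "c \<in> KK \<Longrightarrow> \<kappa> (smul M c x) = [:c:] *s \<kappa> x"
  using coords_poly_act[of "[:c:]" x] by (simp add: poly_act_const)

lemma coords_sigma: "\<kappa> (sigma M x) = \<sigma>\<^sub>t (\<kappa> x)"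
  by (rule coords_eq) (auto simp: sigma_coord_PK coords_PK sigma_comb[symmetric] comb_coords)

lemma coords_sigma_funpow: "\<kappa> ((sigma M ^^ k) x) = (\<sigma>\<^sub>t ^^ k) (\<kappa> x)"
  by (induction k) (auto simp: coords_sigma)

lemma poly_act_comb_m: "comb (axis i 1) = m i"
proof -
  have "comb (axis i 1) = (\<Sum>j\<in>UNIV. if j = i then m i else 0)" unfolding comb_def axis_def
    by (intro sum.cong) auto
  then show ?thesis by simp
qed

lemma coords_m: "\<kappa> (m i) = axis i 1"
  by (rule coords_eq) (simp add: axis_def, rule poly_act_comb_m)

section \<open>Coefficients in the basis over skew polynomials in \<sigma>\<close>

abbreviation "sc \<equiv> sigma_coeffs Fq \<theta> M w"

text \<open>Replaces the support, which varies with the element, by a common initial segment, so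
  that expansions can be combined termwise.\<close>

lemma sigma_expansion_bound:
  assumes "\<And>i. i \<ge> N \<Longrightarrow> c i = 0"
  shows "sigma_expansion Fq \<theta> M w c x \<longleftrightarrow> (\<forall>i j. c i $ j \<in> KK) \<and>
    x = (\<Sum>i<N. \<Sum>j\<in>UNIV. smul M (c i $ j) ((sigma M ^^ i) (w j)))"
proof -
  have sub: "{i. c i \<noteq> 0} \<subseteq> {..<N}" using assms by (metis (mono_tags) lessThan_iff mem_Collect_eq not_le subsetI)
  then have "(\<Sum>i | c i \<noteq> 0. \<Sum>j\<in>UNIV. smul M (c i $ j) ((sigma M ^^ i) (w j)))
    = (\<Sum>i<N. \<Sum>j\<in>UNIV. smul M (c i $ j) ((sigma M ^^ i) (w j)))"
    by (intro sum.mono_neutral_left) auto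
  moreover have "finite {i. c i \<noteq> 0}" using sub finite_subset by blast
  ultimately show ?thesis by (simp add: sigma_expansion_def)
qed

lemma sc_expansion: "sigma_expansion Fq \<theta> M w (sc x) x"
proof -
  have "\<exists>!c. sigma_expansion Fq \<theta> M w c x" using sigma_basis by (simp add: is_sigma_basis_def)
  from theI'[OF this] show ?thesis by (simp add: sigma_coeffs_def)
qed

lemma sc_KK: "sc x i $ j \<in> KK"
  using sc_expansion by (simp add: sigma_expansion_def)

lemma sc_eqI:
  assumes "\<And>i j. c i $ j \<in> KK" "\<And>i. i \<ge> N \<Longrightarrow> c i = 0"
    "x = (\<Sum>i<N. \<Sum>j\<in>UNIV. smul M (c i $ j) ((sigma M ^^ i) (w j)))"
  shows "sc x = c"
proof -
  have "\<exists>!c. sigma_expansion Fq \<theta> M w c x" using sigma_basis by (simp add: is_sigma_basis_def)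
  moreover have "sigma_expansion Fq \<theta> M w c x" by (subst sigma_expansion_bound[of N]) (use assms in auto)
  ultimately show ?thesis unfolding sigma_coeffs_def by (intro the1_equality)
qed

lemma sc_bound_ex: "\<exists>N. \<forall>i\<ge>N. sc x i = 0"
proof -
  have "finite {i. sc x i \<noteq> 0}" using sc_expansion by (simp add: sigma_expansion_def)
  then obtain N where "{i. sc x i \<noteq> 0} \<subseteq> {..<N}" using finite_nat_iff_bounded by blast
  then show ?thesis by (intro exI[of _ N]) auto
qed

lemma sc_sum: "(\<And>i. i \<ge> N \<Longrightarrow> sc x i = 0) \<Longrightarrow> x = (\<Sum>i<N. \<Sum>j\<in>UNIV. smul M (sc x i $ j) ((sigma M ^^ i) (w j)))"
  using sigma_expansion_bound[of N "sc x" x] sc_expansion by blast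

lemma sc_add: "sc (x + y) = (\<lambda>i. sc x i + sc y i)"
proof -
  obtain N1 N2 where N: "\<forall>i\<ge>N1. sc x i = 0" "\<forall>i\<ge>N2. sc y i = 0" using sc_bound_ex by metis
  define N where "N = max N1 N2"
  have *: "\<And>i. i \<ge> N \<Longrightarrow> sc x i = 0" "\<And>i. i \<ge> N \<Longrightarrow> sc y i = 0" using N by (auto simp: N_def)
  show ?thesis
  proof (rule sc_eqI[of _ N])
    show "x + y = (\<Sum>i<N. \<Sum>j\<in>UNIV. smul M ((sc x i + sc y i) $ j) ((sigma M ^^ i) (w j)))"
      by (subst (1) sc_sum[of N x], fact *(1), subst (1) sc_sum[of N y], fact *(2))
        (simp add: smul_add_left sc_KK sum.distrib)
  qed (auto simp: * sc_KK KK_add)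
qed

lemma sc_0 [simp]: "sc 0 = (\<lambda>_. 0)"
  by (rule sc_eqI[of _ 0]) auto

lemma sc_sum_distrib: "sc (sum f I) i = (\<Sum>k\<in>I. sc (f k) i)"
  by (induction I rule: infinite_finite_induct) (auto simp: sc_add)

lemma sc_smul: assumes c: "c \<in> KK" shows "sc (smul M c x) = (\<lambda>i. c *s sc x i)"
proof -
  obtain N where N: "\<And>i. i \<ge> N \<Longrightarrow> sc x i = 0" using sc_bound_ex by metis
  show ?thesis
  proof (rule sc_eqI[of _ N])
    show "smul M c x = (\<Sum>i<N. \<Sum>j\<in>UNIV. smul M ((c *s sc x i) $ j) ((sigma M ^^ i) (w j)))"
    proof -
      have "smul M c x = smul M c (\<Sum>i<N. \<Sum>j\<in>UNIV. smul M (sc x i $ j) ((sigma M ^^ i) (w j)))"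
        by (rule arg_cong) (rule sc_sum, rule N)
      also have "\<dots> = (\<Sum>i<N. \<Sum>j\<in>UNIV. smul M ((c *s sc x i) $ j) ((sigma M ^^ i) (w j)))"
        using c by (simp add: smul_sum_right smul_mult sc_KK)
      finally show ?thesis .
    qed
  qed (auto simp: N sc_KK KK_mult c)
qed

lemma sc_sigma: "sc (sigma M x) = (\<lambda>i. case i of 0 \<Rightarrow> 0 | Suc i \<Rightarrow> (\<chi> j. rt (sc x i $ j)))"
proof -
  obtain N where N: "\<And>i. i \<ge> N \<Longrightarrow> sc x i = 0" using sc_bound_ex by metis
  show ?thesis
  proof (rule sc_eqI[of _ "Suc N"])
    show "sigma M x = (\<Sum>i<Suc N. \<Sum>j\<in>UNIV. smul M ((case i of 0 \<Rightarrow> 0 | Suc i \<Rightarrow> (\<chi> j. rt (sc x i $ j))) $ j) ((sigma M ^^ i) (w j)))"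
    proof -
      have "sigma M x = sigma M (\<Sum>i<N. \<Sum>j\<in>UNIV. smul M (sc x i $ j) ((sigma M ^^ i) (w j)))"
        by (rule arg_cong) (rule sc_sum, rule N)
      then show ?thesis
        by (simp add: sum.lessThan_Suc_shift sigma_sum sigma_smul sc_KK del: sum.lessThan_Suc)
    qed
  qed (auto simp: N sc_KK KK_rt vec_eq_iff split: nat.split)
qed

lemma sc_w: "sc (w j) = (\<lambda>i. if i = 0 then axis j 1 else 0)"
proof (rule sc_eqI[of _ 1])
  have "(\<Sum>l\<in>UNIV. smul M (axis j 1 $ l) (w l)) = (\<Sum>l\<in>UNIV. if l = j then w j else 0)"
    by (intro sum.cong) (auto simp: axis_def smul_one)
  then show "w j = (\<Sum>i<1. \<Sum>l\<in>UNIV. smul M ((if i = 0 then axis j 1 else 0) $ l) ((sigma M ^^ i) (w l)))" by simp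
qed (auto simp: axis_def)

section \<open>The map \<open>\<delta>\<^sub>0\<close> on the module\<close>

abbreviation "\<delta>\<^sub>0 \<equiv> delta0 Fq \<theta> M w"
abbreviation "\<delta>\<^sub>1 \<equiv> delta1 Fq \<theta> M w"

lemma delta0_add: "\<delta>\<^sub>0 (x + y) = \<delta>\<^sub>0 x + \<delta>\<^sub>0 y"
  and delta0_smul: "c \<in> KK \<Longrightarrow> \<delta>\<^sub>0 (smul M c x) = c *s \<delta>\<^sub>0 x"
  and delta0_sigma: "\<delta>\<^sub>0 (sigma M x) = 0"
  and delta0_w: "\<delta>\<^sub>0 (w j) = axis j 1"
  and delta0_0 [simp]: "\<delta>\<^sub>0 0 = 0"
  by (simp_all add: delta0_def sc_add sc_smul sc_sigma sc_w)

lemma delta0_sum: "\<delta>\<^sub>0 (sum f I) = (\<Sum>i\<in>I. \<delta>\<^sub>0 (f i))"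
  by (simp add: delta0_def sc_sum_distrib)

definition order0 :: nat where "order0 = delta0_order Fq \<theta> M w"

text \<open>Multiples of (t - \<theta>)^L lie in the range of \<sigma>, where the constant
  coefficient is zero. So the least exponent in \<open>delta0_order\<close> exists, and larger ones
  inherit the property.\<close>

lemma delta0_order: assumes "n \<ge> order0" shows "\<delta>\<^sub>0 (poly_act M ([:- \<theta>, 1:] ^ n) x) = 0"
proof -
  obtain L where L: "\<And>x. poly_act M ([:- \<theta>, 1:] ^ L) x \<in> range (sigma M)" using torsion by blast
  have "\<delta>\<^sub>0 (poly_act M ([:- \<theta>, 1:] ^ L) x) = 0" for x using L[of x] delta0_sigma by auto
  then have "\<forall>x. \<delta>\<^sub>0 (poly_act M ([:- \<theta>, 1:] ^ order0) x) = 0"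
    unfolding order0_def delta0_order_def
    by (intro LeastI[of "\<lambda>N. \<forall>x. \<delta>\<^sub>0 (poly_act M ([:- \<theta>, 1:] ^ N) x) = 0" L]) simp
  moreover have "[:- \<theta>, 1:] ^ n = [:- \<theta>, 1:] ^ order0 * [:- \<theta>, 1:] ^ (n - order0)"
    using assms by (simp add: power_add[symmetric])
  ultimately show ?thesis by (simp add: poly_act_mult PK_power KK_minus KK_theta)
qed

text \<open>For \<open>q\<^sup>s\<close> at least the order of \<open>\<delta>\<^sub>0\<close>, multiplication by \<open>t\<^bsup>q^s\<^esup>\<close> acts on \<open>\<delta>\<^sub>0\<close> as a scalar,
  because \<open>t\<^bsup>q^s\<^esup> - \<theta>\<^bsup>q^s\<^esup> = (t - \<theta>)\<^bsup>q^s\<^esup>\<close>.\<close>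

lemma delta0_scalar_ex: "\<exists>s. \<forall>x. \<delta>\<^sub>0 (poly_act M (monom 1 (q ^ s)) x) = \<theta> ^ (q ^ s) *s \<delta>\<^sub>0 x"
proof (intro exI allI)
  fix x
  define s where "s = order0"
  have "q ^ s \<ge> order0" using q_ge_2 by (simp add: s_def self_le_ge2_pow)
  have "monom 1 (q ^ s) = ([:- \<theta>, 1:] + [:\<theta>:]) ^ (q ^ s)" by (simp add: monom_altdef)
  also have "\<dots> = [:- \<theta>, 1:] ^ (q ^ s) + [:\<theta> ^ (q ^ s):]"
    by (subst poly_add_power_q) (simp add: poly_const_pow)
  finally show "\<delta>\<^sub>0 (poly_act M (monom 1 (q ^ order0)) x) = \<theta> ^ (q ^ order0) *s \<delta>\<^sub>0 x"
    using \<open>q ^ s \<ge> order0\<close>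
    by (simp add: s_def poly_act_add_left PK_power KK_power KK_minus KK_theta delta0_add delta0_order poly_act_const delta0_smul)
qed

subsection \<open>The extension of \<open>\<delta>\<^sub>0\<close> to power series\<close>

definition delta0_tpow :: "'r \<Rightarrow> nat \<Rightarrow> 'c ^ 'd" where
  "delta0_tpow i n = \<delta>\<^sub>0 (poly_act M (monom 1 n) (m i))"

definition delta0_linpow :: "'r \<Rightarrow> nat \<Rightarrow> 'c ^ 'd" where
  "delta0_linpow i k = \<delta>\<^sub>0 (poly_act M ([:- \<theta>, 1:] ^ k) (m i))"

text \<open>The Taylor expansion of t^n at \<theta>. It links the Taylor coefficients in the
  definition of \<open>delta0_ext\<close> with ordinary power series coefficients.\<close>

lemma delta0_tpow_taylor: "delta0_tpow i n = (\<Sum>k<order0. (of_nat (n choose k) * \<theta> ^ (n - k)) *s delta0_linpow i k)"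
proof -
  have "monom 1 n = ([:- \<theta>, 1:] + [:\<theta>:]) ^ n" by (simp add: monom_altdef)
  also have "\<dots> = (\<Sum>k\<le>n. of_nat (n choose k) * [:- \<theta>, 1:] ^ k * [:\<theta>:] ^ (n - k))" by (rule binomial_ring)
  also have "\<dots> = (\<Sum>k\<le>n. smult (of_nat (n choose k) * \<theta> ^ (n - k)) ([:- \<theta>, 1:] ^ k))"
    by (intro sum.cong) (auto simp: poly_const_pow of_nat_poly mult.commute)
  finally have *: "monom 1 n = (\<Sum>k\<le>n. smult (of_nat (n choose k) * \<theta> ^ (n - k)) ([:- \<theta>, 1:] ^ k))" .
  have K: "of_nat (n choose k) * \<theta> ^ (n - k) \<in> KK" for k
  proof -
    have "of_nat j \<in> KK" for j by (induction j) (auto intro: KK_add)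
    then show ?thesis by (intro KK_mult KK_power KK_theta)
  qed
  have "delta0_tpow i n = (\<Sum>k\<le>n. (of_nat (n choose k) * \<theta> ^ (n - k)) *s delta0_linpow i k)"
  proof -
    have "poly_act M (monom 1 n) (m i)
      = (\<Sum>k\<le>n. poly_act M (smult (of_nat (n choose k) * \<theta> ^ (n - k)) ([:- \<theta>, 1:] ^ k)) (m i))"
      unfolding * by (rule poly_act_sum_left) (intro PK_smult PK_power PK_linear K)
    then show ?thesis
      unfolding delta0_tpow_def delta0_linpow_def by (simp only: delta0_sum poly_act_smult[OF K PK_power[OF PK_linear]] delta0_smul[OF K])
  qed
  \<comment> \<open>A common range for both truncations: binomials vanish above \<open>n\<close>,
    and \<open>\<delta>\<^sub>0\<close> vanishes from \<open>order0\<close> on.\<close>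
  also have "\<dots> = (\<Sum>k<max (Suc n) order0. (of_nat (n choose k) * \<theta> ^ (n - k)) *s delta0_linpow i k)"
    by (intro sum.mono_neutral_left) (auto simp: binomial_eq_0)
  also have "\<dots> = (\<Sum>k<order0. (of_nat (n choose k) * \<theta> ^ (n - k)) *s delta0_linpow i k)"
    by (intro sum.mono_neutral_right) (auto simp: delta0_linpow_def delta0_order)
  finally show ?thesis .
qed

abbreviation "\<Lambda> \<equiv> delta0_ext Fq \<theta> M m w"

abbreviation "conv_vec g \<equiv> (\<forall>i. conv (g $ i))"

text \<open>Integers have absolute value at most 1, so the terms of each hyperderivative are
  dominated by |g_n| q^n.\<close>

lemma taylor_sums:
  assumes "conv g"
  shows "(\<lambda>n. of_nat (n choose k) * fps_nth g n * \<theta> ^ (n - k)) sums taylor_coeff \<theta> g k"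
proof -
  have "(\<lambda>n. absval (of_nat (n choose k) * fps_nth g n * \<theta> ^ (n - k))) \<longlonglongrightarrow> 0"
  proof (rule tendsto_0_sandwich[OF _ _ assms[unfolded conv_def]])
    fix n
    have "absval (of_nat (n choose k) :: 'c) * absval (fps_nth g n) * real q ^ (n - k)
      \<le> 1 * absval (fps_nth g n) * real q ^ n"
      using q_pos by (intro mult_mono absval_of_nat_le power_increasing) auto
    then show "absval (of_nat (n choose k) * fps_nth g n * \<theta> ^ (n - k)) \<le> absval (fps_nth g n) * real q ^ n"
      by (simp add: absval_mult absval_power absval_theta)
  qed simp
  from sums_null[OF this] obtain s where "(\<lambda>n. of_nat (n choose k) * fps_nth g n * \<theta> ^ (n - k)) sums s" ..
  then show ?thesis unfolding taylor_coeff_def by (intro summable_sums sums_summable)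
qed

text \<open>The working form of \<open>\<Lambda>\<close>: the Taylor sum is finite, so it may be
  exchanged with the series in n, and the truncation order disappears. Linearity, continuity and the
  action of t are read off this series.\<close>

lemma Lambda_sums:
  assumes g: "conv_vec g"
  shows "(\<lambda>n. \<Sum>i\<in>UNIV. fps_nth (g $ i) n *s delta0_tpow i n) sums \<Lambda> g"
proof -
  have "(\<lambda>n. \<Sum>i\<in>UNIV. \<Sum>k<order0. ((of_nat (n choose k) * fps_nth (g $ i) n * \<theta> ^ (n - k)) * delta0_linpow i k $ j))
    sums (\<Sum>i\<in>UNIV. \<Sum>k<order0. taylor_coeff \<theta> (g $ i) k * delta0_linpow i k $ j)" for j
  proof (intro sums_sum_c)
    fix i k
    show "(\<lambda>n. (of_nat (n choose k) * fps_nth (g $ i) n * \<theta> ^ (n - k)) * delta0_linpow i k $ j)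
      sums (taylor_coeff \<theta> (g $ i) k * delta0_linpow i k $ j)"
      using sums_mult_c[OF taylor_sums, of "g $ i" "delta0_linpow i k $ j" k] g by (simp add: mult.commute)
  qed
  then show ?thesis
    by (simp add: sums_vec_iff delta0_ext_def delta0_tpow_taylor sum_component order0_def[symmetric] delta0_linpow_def[symmetric]
        sum_distrib_left mult_ac)
qed

lemma Lambda_eqI:
  "conv_vec g \<Longrightarrow> (\<lambda>n. \<Sum>i\<in>UNIV. fps_nth (g $ i) n *s delta0_tpow i n) sums v \<Longrightarrow> \<Lambda> g = v"
  using Lambda_sums sums_unique2 by blast

lemma Lambda_add: assumes "conv_vec f" "conv_vec g" shows "\<Lambda> (f + g) = \<Lambda> f + \<Lambda> g"
proof (rule Lambda_eqI)
  show "(\<lambda>n. \<Sum>i\<in>UNIV. fps_nth ((f + g) $ i) n *s delta0_tpow i n) sums (\<Lambda> f + \<Lambda> g)"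
    using sums_vec_add[OF Lambda_sums[OF assms(1)] Lambda_sums[OF assms(2)]]
    by (simp add: vector_sadd_rdistrib sum.distrib)
qed (use assms in \<open>auto intro: conv_add\<close>)

lemma Lambda_smult: assumes "conv_vec f" shows "\<Lambda> (fps_const c *s f) = c *s \<Lambda> f"
proof (rule Lambda_eqI)
  have "c *s (\<Sum>i\<in>UNIV. fps_nth (f $ i) n *s delta0_tpow i n) = (\<Sum>i\<in>UNIV. fps_nth ((fps_const c *s f) $ i) n *s delta0_tpow i n)" for n
    by (simp add: vec_eq_iff sum_component sum_distrib_left mult.assoc)
  then show "(\<lambda>n. \<Sum>i\<in>UNIV. fps_nth ((fps_const c *s f) $ i) n *s delta0_tpow i n) sums (c *s \<Lambda> f)"
    using sums_vec_smult[OF Lambda_sums[OF assms], of c] by simp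
qed (use assms in \<open>auto intro: conv_const_mult\<close>)

lemma Lambda_0 [simp]: "\<Lambda> 0 = 0"
  by (rule Lambda_eqI) (auto simp: sums_0)

lemma Lambda_minus: assumes "conv_vec f" shows "\<Lambda> (- f) = - \<Lambda> f"
proof -
  have "\<Lambda> (f + - f) = \<Lambda> f + \<Lambda> (- f)" using assms by (intro Lambda_add) (auto simp: conv_minus)
  then show ?thesis by (simp add: eq_neg_iff_add_eq_0 add.commute)
qed

lemma Lambda_diff: "conv_vec f \<Longrightarrow> conv_vec g \<Longrightarrow> \<Lambda> (f - g) = \<Lambda> f - \<Lambda> g"
  using Lambda_add[of f "- g"] by (simp add: Lambda_minus conv_minus)

lemma Lambda_sum: "(\<And>k. k \<in> I \<Longrightarrow> conv_vec (f k)) \<Longrightarrow> \<Lambda> (sum f I) = (\<Sum>k\<in>I. \<Lambda> (f k))"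
proof (induction I rule: infinite_finite_induct)
  case (insert k I)
  then have "conv_vec (sum f I)" by (auto simp: sum_component intro: conv_sum)
  with insert show ?case by (simp add: Lambda_add)
qed auto

text \<open>Binomial coefficients have absolute value at most 1 and only finitely many vectors
  \<open>delta0_linpow i k\<close> occur, so the growth is that of \<theta>^(n-k).\<close>

lemma delta0_tpow_bound: "\<exists>C. \<forall>i n j. absval (delta0_tpow i n $ j) \<le> C * real q ^ n"
proof -
  define C where "C = (\<Sum>i\<in>UNIV. \<Sum>k<order0. \<Sum>j\<in>UNIV. absval (delta0_linpow i k $ j))"
  have h: "absval (delta0_linpow i k $ j) \<le> C" if "k < order0" for i k j
  proof -
    have "absval (delta0_linpow i k $ j) \<le> (\<Sum>j\<in>UNIV. absval (delta0_linpow i k $ j))" by (rule member_le_sum) auto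
    also have "\<dots> \<le> (\<Sum>k<order0. \<Sum>j\<in>UNIV. absval (delta0_linpow i k $ j))"
      using that by (intro member_le_sum) (auto intro: sum_nonneg)
    also have "\<dots> \<le> C" unfolding C_def by (intro member_le_sum) (auto intro!: sum_nonneg)
    finally show ?thesis .
  qed
  have C: "C \<ge> 0" unfolding C_def by (intro sum_nonneg) auto
  have "absval (delta0_tpow i n $ j) \<le> C * real q ^ n" for i n j
    unfolding delta0_tpow_taylor sum_component
  proof (rule absval_sum_le)
    fix k assume "k \<in> {..<order0}"
    then have "(absval (of_nat (n choose k) :: 'c) * real q ^ (n - k)) * absval (delta0_linpow i k $ j) \<le> (1 * real q ^ n) * C"
      using q_pos by (intro mult_mono absval_of_nat_le power_increasing h) auto
    then show "absval (((of_nat (n choose k) * \<theta> ^ (n - k)) *s delta0_linpow i k) $ j) \<le> C * real q ^ n"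
      by (simp add: absval_mult absval_power absval_theta mult.commute)
  qed (use C in auto)
  then show ?thesis by blast
qed

text \<open>Continuity for the weighted norm at radius q: the decay of g_n like q^(-n) balances the
  growth of \<open>delta0_tpow\<close>.\<close>

lemma Lambda_bound: "\<exists>C\<ge>0. \<forall>g B j. conv_vec g \<longrightarrow> (\<forall>i. bd (real q) B (g $ i)) \<longrightarrow> absval (\<Lambda> g $ j) \<le> C * B"
proof -
  obtain C where C: "\<And>i n j. absval (delta0_tpow i n $ j) \<le> C * real q ^ n" using delta0_tpow_bound by blast
  have C0: "C \<ge> 0" using C[of undefined 0 undefined] absval_nonneg[of "delta0_tpow undefined 0 $ undefined"]
    by (simp del: absval_nonneg)
  have "absval (\<Lambda> g $ j) \<le> C * B" if g: "conv_vec g" and b: "\<forall>i. bd (real q) B (g $ i)" for g B j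
  proof (rule sums_absval_le)
    show "(\<lambda>n. (\<Sum>i\<in>UNIV. fps_nth (g $ i) n *s delta0_tpow i n) $ j) sums (\<Lambda> g $ j)"
      using Lambda_sums[OF g] by (simp add: sums_vec_iff)
    have B: "B \<ge> 0" using b bd_nonneg[of "real q" B] by auto
    show "absval ((\<Sum>i\<in>UNIV. fps_nth (g $ i) n *s delta0_tpow i n) $ j) \<le> C * B" for n
      unfolding sum_component
    proof (rule absval_sum_le)
      fix i
      have "absval (fps_nth (g $ i) n) * absval (delta0_tpow i n $ j) \<le> absval (fps_nth (g $ i) n) * (C * real q ^ n)"
        using C by (intro mult_left_mono) auto
      also have "\<dots> = C * (absval (fps_nth (g $ i) n) * real q ^ n)" by simp
      also have "\<dots> \<le> C * B" using b C0 by (intro mult_left_mono) (auto simp: bd_def)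
      finally show "absval ((fps_nth (g $ i) n *s delta0_tpow i n) $ j) \<le> C * B" by (simp add: absval_mult)
    qed (use B C0 in auto)
  qed
  with C0 show ?thesis by blast
qed

definition fps_vec :: "'c poly ^ 'r \<Rightarrow> 'c fps ^ 'r" where
  "fps_vec g = (\<chi> i. fps_of_poly (g $ i))"

lemma conv_fps_vec: "conv_vec (fps_vec g)"
  by (simp add: fps_vec_def conv_fps_of_poly)

lemma fps_vec_add: "fps_vec (f + g) = fps_vec f + fps_vec g"
  by (simp add: fps_vec_def vec_eq_iff fps_of_poly_add)

lemma fps_vec_0 [simp]: "fps_vec 0 = 0"
  by (simp add: fps_vec_def vec_eq_iff)

lemma fps_vec_sum: "fps_vec (sum f I) = (\<Sum>k\<in>I. fps_vec (f k))"
  by (induction I rule: infinite_finite_induct) (auto simp: fps_vec_add)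

lemma fps_vec_smult: "fps_vec (p *s g) = fps_of_poly p *s fps_vec g"
  by (simp add: fps_vec_def vec_eq_iff fps_of_poly_mult)

lemma Lambda_fps_vec: assumes g: "\<And>i. g $ i \<in> PK" shows "\<Lambda> (fps_vec g) = \<delta>\<^sub>0 (comb g)"
proof (rule Lambda_eqI[OF conv_fps_vec])
  define N where "N = Suc (Max (range (\<lambda>i. degree (g $ i))))"
  have N: "degree (g $ i) < N" for i unfolding N_def by (simp add: le_imp_less_Suc)
  have "(\<lambda>n. \<Sum>i\<in>UNIV. fps_nth (fps_vec g $ i) n *s delta0_tpow i n) sums (\<Sum>n<N. \<Sum>i\<in>UNIV. fps_nth (fps_vec g $ i) n *s delta0_tpow i n)"
  proof (rule sums_finite)
    fix n assume "n \<notin> {..<N}"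
    then have "coeff (g $ i) n = 0" for i using N[of i] by (intro coeff_eq_0) auto
    then show "(\<Sum>i\<in>UNIV. fps_nth (fps_vec g $ i) n *s delta0_tpow i n) = 0" by (simp add: fps_vec_def)
  qed simp
  also have "(\<Sum>n<N. \<Sum>i\<in>UNIV. fps_nth (fps_vec g $ i) n *s delta0_tpow i n) = (\<Sum>i\<in>UNIV. \<Sum>n<N. coeff (g $ i) n *s delta0_tpow i n)"
    by (subst sum.swap) (simp add: fps_vec_def)
  also have "\<dots> = \<delta>\<^sub>0 (comb g)" unfolding comb_def delta0_sum
  proof (rule sum.cong)
    fix i
    have p: "g $ i = (\<Sum>n<N. smult (coeff (g $ i) n) (monom 1 n))"
      using N[of i] by (intro poly_eqI) (auto simp: coeff_sum coeff_eq_0 if_distrib cong: if_cong)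
    have c: "coeff (g $ i) n \<in> KK" for n using g[of i] by (simp add: polys_over_def)
    have "poly_act M (g $ i) (m i) = (\<Sum>n<N. smul M (coeff (g $ i) n) (poly_act M (monom 1 n) (m i)))"
      by (subst p, subst poly_act_sum_left) (auto simp: PK_smult PK_monom c poly_act_smult)
    then show "(\<Sum>n<N. coeff (g $ i) n *s delta0_tpow i n) = \<delta>\<^sub>0 (poly_act M (g $ i) (m i))"
      by (simp add: delta0_sum delta0_smul c delta0_tpow_def)
  qed simp
  finally show "(\<lambda>n. \<Sum>i\<in>UNIV. fps_nth (fps_vec g $ i) n *s delta0_tpow i n) sums \<delta>\<^sub>0 (comb g)" .
qed

lemma Lambda_coords: "\<Lambda> (fps_vec (\<kappa> x)) = \<delta>\<^sub>0 x"
  by (simp add: Lambda_fps_vec coords_PK comb_coords)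

end

subsection \<open>Twisted power series\<close>

lemma matrix_mul_sum_left: "(\<Sum>i\<in>I. A i) ** B = (\<Sum>i\<in>I. A i ** (B :: 'a::semiring_1 ^ 'n ^ 'm))"
  by (simp add: vec_eq_iff matrix_matrix_mult_def sum_component sum_distrib_right sum.swap[of _ I])

lemma matrix_mul_sum_right: "(B :: 'a::semiring_1 ^ 'n ^ 'm) ** (\<Sum>i\<in>I. A i) = (\<Sum>i\<in>I. B ** A i)"
  by (induction I rule: infinite_finite_induct) (auto simp: matrix_add_ldistrib)

lemma matrix_vector_sum_left: "(\<Sum>i\<in>I. A i) *v x = (\<Sum>i\<in>I. A i *v (x :: 'a::semiring_1 ^ 'n))"
  by (induction I rule: infinite_finite_induct) (auto simp: matrix_vector_mult_add_rdistrib)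

lemma matrix_vector_sum_right: "(A :: 'a::semiring_1 ^ 'n ^ 'm) *v (\<Sum>i\<in>I. x i) = (\<Sum>i\<in>I. A *v x i)"
  by (induction I rule: infinite_finite_induct) (auto simp: matrix_vector_right_distrib)

lemma map_matrix_nth [simp]: "map_matrix f A $ i $ j = f (A $ i $ j)"
  by (simp add: map_matrix_def)

lemma map_matrix_fps_mult:
  "map_matrix fps_to_fls (A ** B) = map_matrix fps_to_fls A ** map_matrix fps_to_fls (B :: 'a::field fps ^ 'k ^ 'l)"
  by (simp add: vec_eq_iff matrix_matrix_mult_def fps_to_fls_sum fls_times_fps_to_fls)

text \<open>The action on a series in z with coefficient sequence \<open>x\<close>, where \<tau>
  fixes z and each \<tau> comes with a factor z. It is the z-deformation, written on sequences of
  vectors.\<close>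

definition tau_vec :: "nat \<Rightarrow> ('c::field, 'd::finite) tau_series \<Rightarrow> (nat \<Rightarrow> 'c ^ 'd) \<Rightarrow> nat \<Rightarrow> 'c ^ 'd" where
  "tau_vec q S x n = (\<Sum>i\<le>n. S i *v frob_vec q (int i) (x (n - i)))"

lemma deformed_act_nth:
  "fps_nth (deformed_act q S x $ j) n = tau_vec q S (\<lambda>n. \<chi> l. fps_nth (x $ l) n) n $ j"
  by (simp add: deformed_act_def tau_vec_def)

fun tau_right_inverse :: "nat \<Rightarrow> ('c::field, 'd::finite) tau_series \<Rightarrow> ('c, 'd) tau_series" where
  "tau_right_inverse q S n = (if n = 0 then mat 1
     else - (\<Sum>i\<in>{1..n}. S i ** map_matrix (frob q (int i)) (tau_right_inverse q S (n - i))))"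

declare tau_right_inverse.simps [simp del]

context c_infinity
begin

section \<open>Algebra of twisted series\<close>

abbreviation "mfr k A \<equiv> map_matrix (frob q (int k)) (A :: 'c ^ 'n ^ 'm)"
abbreviation "vfr k x \<equiv> frob_vec q (int k) (x :: 'c ^ 'n)"

lemma vfr_nth [simp]: "vfr k x $ j = (x $ j) ^ (q ^ k)"
  by (simp add: frob_vec_def)

lemma frob_0 [simp]: "frob q 0 x = (x :: 'c)" "map_matrix (frob q 0) A = (A :: 'c ^ 'n ^ 'm)" "frob_vec q 0 y = (y :: 'c ^ 'n)"
  using frob_int[of 0] by (auto simp: vec_eq_iff map_matrix_def frob_vec_def)

lemma mfr_mult: "mfr k (A ** B) = mfr k A ** mfr k B"
  by (simp add: vec_eq_iff matrix_matrix_mult_def sum_power_q power_mult_distrib)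

lemma mfr_mult_vec: "vfr k (A *v x) = mfr k A *v vfr k x"
  by (simp add: vec_eq_iff matrix_vector_mult_def sum_power_q power_mult_distrib)

lemma mfr_mfr: "mfr k (mfr l A) = mfr (k + l) A"
  by (simp del: of_nat_add add: vec_eq_iff power_mult[symmetric] power_add mult.commute)

lemma vfr_vfr: "vfr k (vfr l x) = vfr (k + l) x"
  by (simp del: of_nat_add add: vec_eq_iff power_mult[symmetric] power_add mult.commute)

lemma mfr_sum: "mfr k (\<Sum>i\<in>I. A i) = (\<Sum>i\<in>I. mfr k (A i))"
  by (simp add: vec_eq_iff sum_component sum_power_q)

lemma vfr_sum: "vfr k (\<Sum>i\<in>I. x i) = (\<Sum>i\<in>I. vfr k (x i))"
  by (simp add: vec_eq_iff sum_component sum_power_q)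

lemma vfr_diff: "vfr k (x - y) = vfr k x - vfr k y"
  by (simp add: vec_eq_iff diff_power_q)

lemma vfr_add: "vfr k (x + y) = vfr k x + vfr k y"
  by (simp add: vec_eq_iff add_power_q)

lemma vfr_0 [simp]: "vfr k 0 = 0"
  by (simp add: vec_eq_iff)



lemma mfr_zero [simp]: "mfr k 0 = 0"
  by (simp add: vec_eq_iff)

lemma mfr_mat: "mfr k (mat c) = mat (c ^ (q ^ k))"
  using q_power_pos[of k] by (simp add: vec_eq_iff mat_def)

text \<open>Both sides add the same triple products over exponents i + k + l = n, because in either
  bracketing the twist of the third factor accumulates to i + k.\<close>

lemma tau_mult_assoc: "tau_mult q (tau_mult q S T) U = tau_mult q S (tau_mult q T (U :: ('c, 'd::finite) tau_series))"
proof
  fix n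
  define F where "F i k l = S i ** mfr i (T k) ** mfr (i + k) (U l)" for i k l
  have "tau_mult q (tau_mult q S T) U n = (\<Sum>j=0..n. \<Sum>i=0..j. F i (j - i) (n - j))"
    by (simp add: tau_mult_def F_def matrix_mul_sum_left atMost_atLeast0)
  also have "\<dots> = (\<Sum>j=0..n. \<Sum>i=0..n - j. F j i (n - j - i))" by (rule fps_mult_assoc_lemma)
  also have "\<dots> = tau_mult q S (tau_mult q T U) n"
    by (simp add: tau_mult_def F_def mfr_sum matrix_mul_sum_right atMost_atLeast0 mfr_mult mfr_mfr matrix_mul_assoc)
  finally show "tau_mult q (tau_mult q S T) U n = tau_mult q S (tau_mult q T U) n" .
qed

lemma tau_vec_assoc: "tau_vec q (tau_mult q S T) x = tau_vec q S (tau_vec q T (x :: nat \<Rightarrow> 'c ^ 'd::finite))"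
proof
  fix n
  define F where "F i k l = S i *v (mfr i (T k) *v vfr (i + k) (x l))" for i k l
  have "tau_vec q (tau_mult q S T) x n = (\<Sum>j=0..n. \<Sum>i=0..j. F i (j - i) (n - j))"
    by (simp add: tau_vec_def tau_mult_def F_def matrix_vector_sum_left atMost_atLeast0 matrix_vector_mul_assoc)
  also have "\<dots> = (\<Sum>j=0..n. \<Sum>i=0..n - j. F j i (n - j - i))" by (rule fps_mult_assoc_lemma)
  also have "\<dots> = tau_vec q S (tau_vec q T x) n"
    by (simp add: tau_vec_def F_def vfr_sum matrix_vector_sum_right atMost_atLeast0 mfr_mult_vec vfr_vfr)
  finally show "tau_vec q (tau_mult q S T) x n = tau_vec q S (tau_vec q T x) n" .
qed

lemma tau_const_mult: "tau_mult q (tau_const B) S n = B ** (S :: ('c, 'd::finite) tau_series) n"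
proof -
  have "tau_mult q (tau_const B) S n = (\<Sum>i\<le>n. if i = 0 then B ** S n else 0)"
    unfolding tau_mult_def tau_const_def by (intro sum.cong) auto
  then show ?thesis by simp
qed

lemma tau_mult_const: "tau_mult q S (tau_const B) n = (S :: ('c, 'd::finite) tau_series) n ** mfr n B"
proof -
  have "tau_mult q S (tau_const B) n = (\<Sum>i\<le>n. if i = n then S n ** mfr n B else 0)"
    unfolding tau_mult_def tau_const_def by (intro sum.cong) auto
  then show ?thesis by simp
qed

lemma tau_vec_const: "tau_vec q (tau_const B) x n = B *v (x :: nat \<Rightarrow> 'c ^ 'd::finite) n"
proof -
  have "tau_vec q (tau_const B) x n = (\<Sum>i\<le>n. if i = 0 then B *v x n else 0)"
    unfolding tau_vec_def tau_const_def by (intro sum.cong) auto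
  then show ?thesis by simp
qed

lemma tau_mult_1_left: "tau_mult q (tau_const (mat 1)) S = (S :: ('c, 'd::finite) tau_series)"
  by (rule ext) (simp add: tau_const_mult)

lemma tau_mult_1_right: "tau_mult q S (tau_const (mat 1)) = (S :: ('c, 'd::finite) tau_series)"
  by (rule ext) (simp add: tau_mult_const mfr_mat)

lemma tau_vec_1: "tau_vec q (tau_const (mat 1)) x = (x :: nat \<Rightarrow> 'c ^ 'd::finite)"
  by (rule ext) (simp add: tau_vec_const)

lemma tau_vec_single: "tau_vec q S (\<lambda>n. if n = 0 then u else 0) n = S n *v vfr n (u :: 'c ^ 'd::finite)"
proof -
  have "tau_vec q S (\<lambda>n. if n = 0 then u else 0) n = (\<Sum>i\<le>n. if i = n then S n *v vfr n u else 0)"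
    unfolding tau_vec_def by (intro sum.cong) auto
  then show ?thesis by simp
qed

lemma tau_right_inverse:
  fixes S :: "('c, 'd::finite) tau_series"
  assumes "S 0 = mat 1"
  shows "tau_mult q S (tau_right_inverse q S) = tau_const (mat 1)"
proof
  fix n
  let ?R = "tau_right_inverse q S"
  have "tau_mult q S ?R n = S 0 ** ?R n + (\<Sum>i\<in>{1..n}. S i ** mfr i (?R (n - i)))"
    by (simp add: tau_mult_def atMost_atLeast0 sum.atLeast_Suc_atMost)
  then show "tau_mult q S ?R n = tau_const (mat 1) n"
    using assms by (subst (asm) tau_right_inverse.simps) (auto simp: tau_const_def)
qed

text \<open>The right inverse \<open>R\<close> has a right inverse \<open>U\<close> of its own, and
  associativity forces U = S; so \<open>R\<close> is two-sided.\<close>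

lemma tau_inverse_ex:
  fixes S :: "('c, 'd::finite) tau_series"
  assumes "S 0 = mat 1"
  obtains R where "R 0 = mat 1" "tau_mult q S R = tau_const (mat 1)" "tau_mult q R S = tau_const (mat 1)"
proof -
  define R where "R = tau_right_inverse q S"
  define U where "U = tau_right_inverse q R"
  have R0: "R 0 = mat 1" by (simp add: R_def tau_right_inverse.simps)
  have SR: "tau_mult q S R = tau_const (mat 1)" unfolding R_def using assms by (intro tau_right_inverse)
  have RU: "tau_mult q R U = tau_const (mat 1)" unfolding U_def using R0 by (intro tau_right_inverse)
  have "S = tau_mult q S (tau_mult q R U)" by (simp add: RU tau_mult_1_right)
  also have "\<dots> = U" by (simp add: tau_mult_assoc[symmetric] SR tau_mult_1_left)
  finally show ?thesis using that R0 SR RU by simp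
qed

text \<open>At a point of size R the operator \<tau>^n produces size R^(q^n); hence the doubly
  exponential weight.\<close>

definition entire :: "('c, 'd::finite) tau_series \<Rightarrow> bool" where
  "entire S \<longleftrightarrow> (\<forall>R>0. \<forall>i j. (\<lambda>n. absval (S n $ i $ j) * R ^ (q ^ n)) \<longlonglongrightarrow> 0)"

text \<open>For large i the factor s_i is small uniformly in the bounded r; for the finitely many
  other i, the index N - i is large and r is small.\<close>

lemma twisted_convolution_null:
  fixes s r :: "nat \<Rightarrow> 'c"
  assumes X: "X > 0" "\<And>k. absval (r k) \<le> X" and s: "(\<lambda>i. absval (s i) * X ^ (q ^ i)) \<longlonglongrightarrow> 0"
    and r: "(\<lambda>k. absval (r k)) \<longlonglongrightarrow> 0"
  shows "(\<lambda>N. absval (\<Sum>i<N. s i * r (N - i) ^ (q ^ i))) \<longlonglongrightarrow> 0"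
proof (rule order_tendstoI)
  fix \<epsilon> :: real assume "\<epsilon> > 0"
  then have e: "\<epsilon> / 2 > 0" by simp
  obtain I where I: "\<And>i. i \<ge> I \<Longrightarrow> absval (s i) * X ^ (q ^ i) < \<epsilon> / 2"
    using order_tendstoD(2)[OF s e] by (auto simp: eventually_sequentially)
  have "\<forall>\<^sub>F k in sequentially. \<forall>i\<in>{..<I}. absval (s i) * absval (r k) ^ (q ^ i) < \<epsilon> / 2"
  proof (rule eventually_ball_finite)
    show "\<forall>i\<in>{..<I}. \<forall>\<^sub>F k in sequentially. absval (s i) * absval (r k) ^ (q ^ i) < \<epsilon> / 2"
    proof
      fix i
      have "(\<lambda>k. absval (s i) * absval (r k) ^ (q ^ i)) \<longlonglongrightarrow> absval (s i) * 0 ^ (q ^ i)"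
        by (intro tendsto_intros r)
      then show "\<forall>\<^sub>F k in sequentially. absval (s i) * absval (r k) ^ (q ^ i) < \<epsilon> / 2"
        using e q_power_pos[of i] by (intro order_tendstoD(2)) (auto simp: power_0_left)
    qed
  qed simp
  then obtain K where K: "\<And>k i. k \<ge> K \<Longrightarrow> i < I \<Longrightarrow> absval (s i) * absval (r k) ^ (q ^ i) < \<epsilon> / 2"
    by (auto simp: eventually_sequentially)
  have "absval (\<Sum>i<N. s i * r (N - i) ^ (q ^ i)) < \<epsilon>" if "N \<ge> I + K" for N
  proof -
    have "absval (\<Sum>i<N. s i * r (N - i) ^ (q ^ i)) \<le> \<epsilon> / 2"
    proof (rule absval_sum_le)
      fix i
      show "absval (s i * r (N - i) ^ (q ^ i)) \<le> \<epsilon> / 2"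
      proof (cases "i < I")
        case True
        with that have "N - i \<ge> K" by simp
        with K[of "N - i" i] True show ?thesis by (simp add: absval_mult absval_power less_imp_le)
      next
        case False
        have "absval (s i) * absval (r (N - i)) ^ (q ^ i) \<le> absval (s i) * X ^ (q ^ i)"
          using X by (intro mult_left_mono power_mono) auto
        also have "\<dots> \<le> \<epsilon> / 2" using I[of i] False by simp
        finally show ?thesis by (simp add: absval_mult absval_power)
      qed
    qed (use e in simp)
    also have "\<dots> < \<epsilon>" using e by simp
    finally show ?thesis .
  qed
  then show "\<forall>\<^sub>F N in sequentially. absval (\<Sum>i<N. s i * r (N - i) ^ (q ^ i)) < \<epsilon>"
    by (auto simp: eventually_sequentially)
qed (auto intro!: always_eventually intro: less_le_trans[OF _ absval_nonneg])

lemma sum_triangle: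
  fixes a :: "nat \<Rightarrow> nat \<Rightarrow> 'b::comm_monoid_add"
  shows "(\<Sum>n<N. \<Sum>i\<le>n. a i (n - i)) = (\<Sum>i<N. \<Sum>k<N - i. a i k)"
proof (induction N)
  case (Suc N)
  have "(\<Sum>i<Suc N. \<Sum>k<Suc N - i. a i k) = (\<Sum>i\<le>N. (\<Sum>k<N - i. a i k) + a i (N - i))"
    unfolding lessThan_Suc_atMost by (intro sum.cong) (auto simp: Suc_diff_le)
  also have "\<dots> = (\<Sum>i\<le>N. \<Sum>k<N - i. a i k) + (\<Sum>i\<le>N. a i (N - i))" by (rule sum.distrib)
  also have "(\<Sum>i\<le>N. \<Sum>k<N - i. a i k) = (\<Sum>i<N. \<Sum>k<N - i. a i k)"
    by (simp add: lessThan_Suc_atMost[symmetric])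
  finally show ?case using Suc by simp
qed simp

text \<open>Evaluation at z = 1. If r_k is the error of the k-th partial sum of \<open>x\<close>,
  the two N-th partial sums differ by the sum of S_i applied to the q^i-th power of r_(N-i), for i <
  N. This is a null sequence by \<open>twisted_convolution_null\<close>.\<close>

lemma tau_vec_sums_iff:
  fixes x :: "nat \<Rightarrow> 'c ^ 'd::finite"
  assumes S: "entire S" and x: "x sums \<zeta>"
  shows "tau_vec q S x sums T \<longleftrightarrow> (\<lambda>n. S n *v vfr n \<zeta>) sums T"
proof -
  define r where "r N = (\<Sum>k<N. x k) - \<zeta>" for N
  have r0: "(\<lambda>k. absval (r k $ l)) \<longlonglongrightarrow> 0" for l
    using x by (simp add: sums_vec_iff sums_absval_iff r_def sum_component)
  have diff: "((\<Sum>n<N. tau_vec q S x n) - (\<Sum>n<N. S n *v vfr n \<zeta>)) $ j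
      = (\<Sum>l\<in>UNIV. \<Sum>i<N. S i $ j $ l * (r (N - i) $ l) ^ (q ^ i))" for N j
  proof -
    have "(\<Sum>n<N. tau_vec q S x n) = (\<Sum>i<N. \<Sum>k<N - i. S i *v vfr i (x k))"
      unfolding tau_vec_def by (rule sum_triangle)
    also have "\<dots> = (\<Sum>i<N. S i *v vfr i (\<Sum>k<N - i. x k))" by (simp add: vfr_sum matrix_vector_sum_right)
    finally have "(\<Sum>n<N. tau_vec q S x n) - (\<Sum>n<N. S n *v vfr n \<zeta>) = (\<Sum>i<N. S i *v vfr i (r (N - i)))"
      by (simp add: r_def sum_subtractf[symmetric] vfr_diff matrix_vector_mult_diff_distrib)
    then have "((\<Sum>n<N. tau_vec q S x n) - (\<Sum>n<N. S n *v vfr n \<zeta>)) $ j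
      = (\<Sum>i<N. \<Sum>l\<in>UNIV. S i $ j $ l * (r (N - i) $ l) ^ (q ^ i))"
      by (simp add: sum_component matrix_vector_mult_def)
    then show ?thesis by (simp add: sum.swap[of _ _ UNIV])
  qed
  have "(\<lambda>N. absval (((\<Sum>n<N. tau_vec q S x n) - (\<Sum>n<N. S n *v vfr n \<zeta>)) $ j)) \<longlonglongrightarrow> 0" for j
    unfolding diff
  proof (rule tendsto_absval_sum)
    fix l
    have "Bseq (\<lambda>k. absval (r k $ l))" using r0[of l] by (intro convergent_imp_Bseq convergentI)
    then obtain X where X: "X > 0" "\<forall>k. norm (absval (r k $ l)) \<le> X" by (auto simp: Bseq_def)
    show "(\<lambda>N. absval (\<Sum>i<N. S i $ j $ l * (r (N - i) $ l) ^ (q ^ i))) \<longlonglongrightarrow> 0"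
      using S X by (intro twisted_convolution_null[OF X(1)] r0) (auto simp: entire_def)
  qed
  then have D: "(\<lambda>N. absval ((\<Sum>n<N. tau_vec q S x n $ j) - (\<Sum>n<N. (S n *v vfr n \<zeta>) $ j))) \<longlonglongrightarrow> 0" for j
    by (simp add: sum_component)
  have "(\<lambda>n. tau_vec q S x n $ j) sums (T $ j) \<longleftrightarrow> (\<lambda>n. (S n *v vfr n \<zeta>) $ j) sums (T $ j)" for j
    unfolding sums_absval_iff
  proof
    assume "(\<lambda>n. absval ((\<Sum>i<n. tau_vec q S x i $ j) - T $ j)) \<longlonglongrightarrow> 0"
    moreover have "(\<lambda>N. absval (- ((\<Sum>n<N. tau_vec q S x n $ j) - (\<Sum>n<N. (S n *v vfr n \<zeta>) $ j)))) \<longlonglongrightarrow> 0"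
      using D[of j] by (simp only: absval_minus)
    ultimately show "(\<lambda>n. absval ((\<Sum>i<n. (S i *v vfr i \<zeta>) $ j) - T $ j)) \<longlonglongrightarrow> 0"
      by (rule tendsto_absval_add[THEN back_subst[of "\<lambda>f. f \<longlonglongrightarrow> 0"]]) auto
  next
    assume "(\<lambda>n. absval ((\<Sum>i<n. (S i *v vfr i \<zeta>) $ j) - T $ j)) \<longlonglongrightarrow> 0"
    from tendsto_absval_add[OF this D[of j]]
    show "(\<lambda>n. absval ((\<Sum>i<n. tau_vec q S x i $ j) - T $ j)) \<longlonglongrightarrow> 0" by simp
  qed
  then show ?thesis by (simp add: sums_vec_iff)
qed

text \<open>An operator \<open>A\<close> whose constant coefficient is the scalar \<open>\<theta>\<^bsup>q^s\<^esup>\<close> turns the functional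
  equation of the exponential into a recursion without matrix inversion.\<close>

lemma exp_recursion:
  fixes A Q :: "('c, 'd::finite) tau_series"
  assumes A0: "A 0 = mat (\<theta> ^ (q ^ s))"
    and eq: "tau_mult q Q (tau_const (A 0)) = tau_mult q A Q"
  shows "(\<theta> ^ (q ^ (s + n)) - \<theta> ^ (q ^ s)) * Q n $ i $ j = (\<Sum>k\<in>{1..n}. (A k ** mfr k (Q (n - k))) $ i $ j)"
proof -
  have "Q n ** mat (\<theta> ^ (q ^ (s + n))) = (\<Sum>k\<in>{0..n}. A k ** mfr k (Q (n - k)))"
    using fun_cong[OF eq, of n]
    by (simp add: tau_mult_const A0 mfr_mat power_mult[symmetric] power_add) (simp add: tau_mult_def atMost_atLeast0)
  also have "\<dots> = mat (\<theta> ^ (q ^ s)) ** Q n + (\<Sum>k\<in>{1..n}. A k ** mfr k (Q (n - k)))"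
    by (simp add: sum.atLeast_Suc_atMost A0)
  finally have "(Q n ** mat (\<theta> ^ (q ^ (s + n)))) $ i $ j = (mat (\<theta> ^ (q ^ s)) ** Q n) $ i $ j + (\<Sum>k\<in>{1..n}. (A k ** mfr k (Q (n - k))) $ i $ j)"
    by (simp add: sum_component)
  moreover have "(Q n ** mat c) $ i $ j = c * Q n $ i $ j" "(mat c ** Q n) $ i $ j = c * Q n $ i $ j" for c
    by (simp_all add: matrix_matrix_mult_def mat_def if_distrib if_distribR mult.commute cong: if_cong)
  ultimately show ?thesis by (simp add: left_diff_distrib)
qed

text \<open>The two powers have different absolute values, so the larger one decides.\<close>

lemma absval_theta_diff: assumes "n > 0" shows "absval (\<theta> ^ (q ^ (s + n)) - \<theta> ^ (q ^ s)) = real q ^ (q ^ (s + n))"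
proof (rule antisym)
  have lt: "q ^ s < q ^ (s + n)" using assms q_ge_2 by (intro power_strict_increasing) auto
  then have l: "real q ^ (q ^ s) < real q ^ (q ^ (s + n))" using q_ge_2 by (intro power_strict_increasing) auto
  then show "absval (\<theta> ^ (q ^ (s + n)) - \<theta> ^ (q ^ s)) \<le> real q ^ (q ^ (s + n))"
    by (intro absval_diff_le) (auto simp: absval_power absval_theta)
  have "absval (\<theta> ^ (q ^ (s + n))) \<le> max (absval (\<theta> ^ (q ^ (s + n)) - \<theta> ^ (q ^ s))) (absval (\<theta> ^ (q ^ s)))"
    using absval_add[of "\<theta> ^ (q ^ (s + n)) - \<theta> ^ (q ^ s)" "\<theta> ^ (q ^ s)"] by simp
  then show "real q ^ (q ^ (s + n)) \<le> absval (\<theta> ^ (q ^ (s + n)) - \<theta> ^ (q ^ s))"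
    using l by (auto simp: absval_power absval_theta max_def split: if_splits)
qed

text \<open>The divisor in \<open>exp_recursion\<close> is nonzero for n > 0, so the functional
  equation for a single operator with scalar constant coefficient determines every
  coefficient.\<close>

lemma exp_unique:
  fixes A Q :: "('c, 'd::finite) tau_series"
  assumes A0: "A 0 = mat (\<theta> ^ (q ^ s))"
    and Q: "tau_mult q Q (tau_const (A 0)) = tau_mult q A Q" "Q 0 = mat 1"
    and Q': "tau_mult q Q' (tau_const (A 0)) = tau_mult q A Q'" "Q' 0 = mat 1"
  shows "Q = Q'"
proof
  fix n show "Q n = Q' n"
  proof (induction n rule: less_induct)
    case (less n)
    show ?case
    proof (cases "n = 0")
      case False
      then have "absval (\<theta> ^ (q ^ (s + n)) - \<theta> ^ (q ^ s)) \<noteq> 0" using q_pos by (simp add: absval_theta_diff del: absval_eq_0)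
      then have nz: "\<theta> ^ (q ^ (s + n)) - \<theta> ^ (q ^ s) \<noteq> 0" by auto
      have "(\<theta> ^ (q ^ (s + n)) - \<theta> ^ (q ^ s)) * Q n $ i $ j = (\<theta> ^ (q ^ (s + n)) - \<theta> ^ (q ^ s)) * Q' n $ i $ j" for i j
        unfolding exp_recursion[OF A0 Q(1)] exp_recursion[OF A0 Q'(1)] using less by (intro sum.cong) auto
      with nz show ?thesis by (simp add: vec_eq_iff)
    qed (use Q Q' in simp)
  qed
qed

lemma matrix_bound_ex: "\<exists>b\<ge>0. \<forall>i j. absval ((B :: 'c ^ 'd ^ 'd::finite) $ i $ j) \<le> b"
proof (intro exI conjI allI)
  fix i j
  have "absval (B $ i $ j) \<le> (\<Sum>j\<in>UNIV. absval (B $ i $ j))" by (rule member_le_sum) auto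
  also have "\<dots> \<le> (\<Sum>i\<in>UNIV. \<Sum>j\<in>UNIV. absval (B $ i $ j))" by (rule member_le_sum) (auto intro: sum_nonneg)
  finally show "absval (B $ i $ j) \<le> (\<Sum>i\<in>UNIV. \<Sum>j\<in>UNIV. absval (B $ i $ j))" .
qed (auto intro!: sum_nonneg)

text \<open>The claim |Q_n| <= (D lam^n)^(q^n) with lam < 1 is proved by induction. The recursion
  divides by something of size at least q^(q^n), while its right-hand side exceeds the target by at
  most the factor \<epsilon> / lam^(K q^n); since q lam^K >= 3/2, the division wins for large
  n.\<close>

lemma exp_entire:
  fixes A Q :: "('c, 'd::finite) tau_series"
  assumes A0: "A 0 = mat (\<theta> ^ (q ^ s))" and K: "\<And>k. k > K \<Longrightarrow> A k = 0"
    and eq: "tau_mult q Q (tau_const (A 0)) = tau_mult q A Q"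
  shows "entire Q"
proof -
  have "\<forall>n. \<exists>b\<ge>0. \<forall>i j. absval (A n $ i $ j) \<le> b" using matrix_bound_ex by blast
  then obtain a where a: "\<And>n. a n \<ge> 0" "\<And>n i j. absval (A n $ i $ j) \<le> a n" by metis
  define \<epsilon> where "\<epsilon> = 1 + (\<Sum>k\<le>K. a k)"
  have eps: "\<epsilon> \<ge> 1" using a by (simp add: \<epsilon>_def sum_nonneg)
  have A: "absval (A k $ i $ j) \<le> \<epsilon>" for k i j
  proof (cases "k \<le> K")
    case True
    then have "a k \<le> (\<Sum>k\<le>K. a k)" using a by (intro member_le_sum) auto
    with a(2)[of k i j] show ?thesis by (simp add: \<epsilon>_def)
  next
    case False
    with K[of k] eps show ?thesis by simp
  qed
  \<comment> \<open>So close to 1 that Bernoulli's inequality yields lam^K >= 3/4;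
    \<open>Suc K\<close> avoids a zero denominator when K = 0.\<close>
  define lam :: real where "lam = 1 - 1 / (4 * real (Suc K))"
  have lam: "0 < lam" "lam < 1" by (auto simp: lam_def field_simps)
  have "1 + real (Suc K) * (lam - 1) \<le> (1 + (lam - 1)) ^ Suc K"
    by (rule Bernoulli_inequality) (use lam in simp)
  moreover have "real (Suc K) * (lam - 1) = - (1 / 4)"
    unfolding lam_def by (simp add: field_simps)
  ultimately have "3 / 4 \<le> lam ^ Suc K" by (simp del: power_Suc)
  also have "\<dots> \<le> lam ^ K" using lam by (intro power_decreasing) auto
  finally have lamK: "lam ^ K \<ge> 3 / 4" .
  \<comment> \<open>Beyond \<open>n0\<close> the power (3/2)^(q^n) absorbs the bound \<epsilon> on
    the coefficients of \<open>A\<close>.\<close>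
  obtain n0 where n0: "\<epsilon> < (3 / 2) ^ n0" using real_arch_pow[of "3 / 2" \<epsilon>] by auto
  have "\<forall>n. \<exists>b\<ge>0. \<forall>i j. absval (Q n $ i $ j) \<le> b" using matrix_bound_ex by blast
  then obtain b where b: "\<And>n. b n \<ge> 0" "\<And>n i j. absval (Q n $ i $ j) \<le> b n" by metis
  \<comment> \<open>Makes the claim true up to \<open>n0\<close>. The 1 added to \<open>b n\<close>
    ensures D lam^n >= 1 there, so that raising to the power q^n cannot spoil the bound.\<close>
  define D where "D = 1 + (\<Sum>n\<le>n0. (b n + 1) / lam ^ n)"
  have D: "D \<ge> 1" using b lam by (simp add: D_def sum_nonneg)
  have Q: "absval (Q n $ i $ j) \<le> (D * lam ^ n) ^ (q ^ n)" for n i j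
  proof (induction n arbitrary: i j rule: less_induct)
    case (less n)
    show ?case
    proof (cases "n \<le> n0")
      case True
      have "(b n + 1) / lam ^ n \<le> (\<Sum>n\<le>n0. (b n + 1) / lam ^ n)"
        by (rule member_le_sum[of n "{..n0}" "\<lambda>n. (b n + 1) / lam ^ n"]) (use True b lam in auto)
      also have "\<dots> \<le> D" by (simp add: D_def)
      finally have "b n + 1 \<le> D * lam ^ n" using lam by (simp add: field_simps)
      then have "b n \<le> D * lam ^ n" "1 \<le> D * lam ^ n" using b[of n] by auto
      then have "b n \<le> (D * lam ^ n) ^ (q ^ n)"
        using self_le_power[of "D * lam ^ n" "q ^ n"] q_power_pos[of n] by linarith
      with b(2)[of n i j] show ?thesis by linarith
    next
      case False
      \<comment> \<open>Bounds one summand of the recursion: going from n - k to n with k <= K costs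
        at most a factor 1 / lam^K inside the q^n-th power.\<close>
      define B where "B = \<epsilon> * (D * lam ^ n) ^ (q ^ n) / (lam ^ K) ^ (q ^ n)"
      have B0: "B \<ge> 0" unfolding B_def using eps D lam by auto
      have "absval (\<Sum>k\<in>{1..n}. (A k ** mfr k (Q (n - k))) $ i $ j) \<le> B"
      proof (rule absval_sum_le[OF B0])
        fix k assume k: "k \<in> {1..n}"
        show "absval ((A k ** mfr k (Q (n - k))) $ i $ j) \<le> B"
        proof (cases "k \<le> K")
          case True
          have "lam ^ (n - k) * lam ^ K \<le> lam ^ n"
            unfolding power_add[symmetric] using lam k True by (intro power_decreasing) auto
          then have "D * lam ^ (n - k) * lam ^ K \<le> D * lam ^ n" using D by simp
          then have "(D * lam ^ (n - k) * lam ^ K) ^ (q ^ n) \<le> (D * lam ^ n) ^ (q ^ n)"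
            using D lam by (intro power_mono) auto
          then have "(D * lam ^ (n - k)) ^ (q ^ n) \<le> (D * lam ^ n) ^ (q ^ n) / (lam ^ K) ^ (q ^ n)"
            using lam by (simp add: power_mult_distrib field_simps)
          then have le: "\<epsilon> * (D * lam ^ (n - k)) ^ (q ^ n) \<le> B"
            unfolding B_def using eps mult_left_mono[of _ _ \<epsilon>] by fastforce
          show ?thesis unfolding matrix_matrix_mult_def vec_lambda_beta
          proof (rule absval_sum_le[OF B0])
            fix l
            have "absval (A k $ i $ l) * absval (Q (n - k) $ l $ j) ^ (q ^ k) \<le> \<epsilon> * ((D * lam ^ (n - k)) ^ (q ^ (n - k))) ^ (q ^ k)"
              using less[of "n - k" l j] k eps by (intro mult_mono power_mono A) auto
            also have "\<dots> = \<epsilon> * (D * lam ^ (n - k)) ^ (q ^ n)"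
              using k by (simp add: power_mult[symmetric] power_add[symmetric])
            finally show "absval (A k $ i $ l * mfr k (Q (n - k)) $ l $ j) \<le> B"
              using le by (simp add: absval_mult absval_power)
          qed
        qed (use K B0 in simp)
      qed
      then have "real q ^ (q ^ (s + n)) * absval (Q n $ i $ j) \<le> B"
        using exp_recursion[OF A0 eq, of n i j] False absval_theta_diff[of n s] by (metis absval_mult gr0I le0)
      moreover have "real q ^ (q ^ n) \<le> real q ^ (q ^ (s + n))"
        using q_ge_2 by (intro power_increasing) (auto simp: power_add)
      then have "real q ^ (q ^ n) * absval (Q n $ i $ j) \<le> real q ^ (q ^ (s + n)) * absval (Q n $ i $ j)"
        by (intro mult_right_mono) auto
      ultimately have "real q ^ (q ^ n) * absval (Q n $ i $ j) \<le> B" by linarith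
      then have 1: "(real q * lam ^ K) ^ (q ^ n) * absval (Q n $ i $ j) \<le> \<epsilon> * (D * lam ^ n) ^ (q ^ n)"
        using lam by (simp add: B_def power_mult_distrib field_simps)
      have "3 / 2 \<le> real q * lam ^ K"
        using mult_mono[of 2 "real q" "3 / 4" "lam ^ K"] q_ge_2 lamK by simp
      then have "(3 / 2) ^ (q ^ n) \<le> (real q * lam ^ K) ^ (q ^ n)" by (intro power_mono) auto
      moreover have "(3 / 2 :: real) ^ n0 \<le> (3 / 2) ^ (q ^ n)"
      proof (rule power_increasing)
        have "n \<le> q ^ n" using q_ge_2 by (intro self_le_ge2_pow)
        then show "n0 \<le> q ^ n" using False by simp
      qed simp
      ultimately have "\<epsilon> \<le> (real q * lam ^ K) ^ (q ^ n)" using n0 by linarith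
      then have "\<epsilon> * absval (Q n $ i $ j) \<le> \<epsilon> * (D * lam ^ n) ^ (q ^ n)"
        using 1 mult_right_mono[of \<epsilon> _ "absval (Q n $ i $ j)"] by fastforce
      then show ?thesis using eps by simp
    qed
  qed
  show ?thesis unfolding entire_def
  proof (intro allI impI)
    fix R :: real and i j assume R: "R > 0"
    \<comment> \<open>Once R D lam^n drops below 1/2, its q^n-th power is at most (1/2)^n.\<close>
    have "(\<lambda>n. R * D * lam ^ n) \<longlonglongrightarrow> 0" using lam by (intro tendsto_mult_right_zero LIMSEQ_power_zero) auto
    then have ev: "\<forall>\<^sub>F n in sequentially. R * D * lam ^ n < 1 / 2" by (rule order_tendstoD) simp
    show "(\<lambda>n. absval (Q n $ i $ j) * R ^ (q ^ n)) \<longlonglongrightarrow> 0"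
    proof (rule tendsto_sandwich[of "\<lambda>_. 0" _ _ "\<lambda>n. (1 / 2) ^ n"])
      show "\<forall>\<^sub>F n in sequentially. absval (Q n $ i $ j) * R ^ (q ^ n) \<le> (1 / 2) ^ n"
        using ev
      proof eventually_elim
        case (elim n)
        have "absval (Q n $ i $ j) * R ^ (q ^ n) \<le> (D * lam ^ n) ^ (q ^ n) * R ^ (q ^ n)"
          using R Q by (intro mult_right_mono) auto
        also have "\<dots> = (R * D * lam ^ n) ^ (q ^ n)" by (simp add: power_mult_distrib mult_ac)
        also have "\<dots> \<le> (1 / 2) ^ (q ^ n)" using elim R D lam by (intro power_mono) auto
        also have "\<dots> \<le> (1 / 2) ^ n" using self_le_ge2_pow[OF q_ge_2, of n] by (intro power_decreasing) auto
        finally show ?case .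
      qed
      show "(\<lambda>n. (1 / 2 :: real) ^ n) \<longlonglongrightarrow> 0" by (intro LIMSEQ_power_zero) simp
    qed (use R in \<open>auto intro!: always_eventually\<close>)
  qed
qed

end

subsection \<open>The associated t-module\<close>

text \<open>A polynomial with infinitely many roots is zero, and the exponents q^k are distinct, so
  the \<open>d k\<close> are its coefficients. This recovers the coefficients of \<open>E a\<close>
  from its action on algebraic points.\<close>

lemma (in c_infinity) additive_polynomial_zero:
  assumes z: "\<And>c. c \<in> KK \<Longrightarrow> (\<Sum>k<N. d k * c ^ (q ^ k)) = (0 :: 'c)" and "k < N"
  shows "d k = 0"
proof -
  define p where "p = (\<Sum>k<N. monom (d k) (q ^ k))"
  have "KK \<subseteq> {c. poly p c = 0}" using z by (auto simp: p_def poly_sum poly_monom)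
  then have "infinite {c. poly p c = 0}" using KK_infinite finite_subset by blast
  then have "p = 0" using poly_roots_finite by blast
  moreover have "q ^ i = q ^ j \<longleftrightarrow> i = j" for i j using q_ge_2 by simp
  then have "coeff p (q ^ k) = d k" using \<open>k < N\<close> by (simp add: p_def coeff_sum)
  ultimately show ?thesis by simp
qed

context dual_motive
begin

definition wcomb :: "'c ^ 'd \<Rightarrow> 'm" where
  "wcomb c = (\<Sum>j\<in>UNIV. smul M (c $ j) (w j))"

lemma sc_wcomb: assumes c: "\<And>j. c $ j \<in> KK" shows "sc (wcomb c) = (\<lambda>i. if i = 0 then c else 0)"
proof (rule sc_eqI[of _ 1])
  show "(if i = 0 then c else 0) $ j \<in> KK" for i j using c by simp
qed (auto simp: wcomb_def)

lemma sc_poly_act_wcomb: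
  assumes "\<And>j. c $ j \<in> KK" "a \<in> PK"
  shows "sc (poly_act M a (wcomb c)) i = (\<chi> l j. sc (poly_act M a (w j)) i $ l) *v c"
  using assms by (simp add: wcomb_def poly_act_sum_right poly_act_smul sc_sum_distrib sc_smul vec_eq_iff
      sum_component matrix_vector_mult_def mult.commute)

lemma delta1_sum: assumes "\<And>i. i \<ge> N \<Longrightarrow> sc x i = 0" shows "\<delta>\<^sub>1 x = (\<Sum>i<N. vfr i (sc x i))"
  unfolding delta1_def
proof (rule sum.mono_neutral_left)
  show "{i. sc x i \<noteq> 0} \<subseteq> {..<N}" using assms by (metis (mono_tags) lessThan_iff mem_Collect_eq not_le subsetI)
qed auto

lemma delta1_wcomb: assumes "\<And>j. c $ j \<in> KK" shows "\<delta>\<^sub>1 (wcomb c) = c"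
  using delta1_sum[of 1 "wcomb c"] assms by (simp add: sc_wcomb)

text \<open>Without a constant term the expansion can be divided by \<sigma>: shift the index down
  and replace scalars by their q-th powers, which undoes the roots taken by \<sigma>.\<close>

lemma range_sigma_if: assumes "sc x 0 = 0" shows "x \<in> range (sigma M)"
proof -
  obtain N where N: "\<And>i. i \<ge> N \<Longrightarrow> sc x i = 0" using sc_bound_ex by metis
  define y where "y = (\<Sum>i<N. \<Sum>j\<in>UNIV. smul M ((sc x (Suc i) $ j) ^ q) ((sigma M ^^ i) (w j)))"
  have "x = (\<Sum>i<Suc N. \<Sum>j\<in>UNIV. smul M (sc x i $ j) ((sigma M ^^ i) (w j)))"
    by (rule sc_sum) (use N in auto)
  also have "\<dots> = (\<Sum>i<N. \<Sum>j\<in>UNIV. smul M (sc x (Suc i) $ j) (sigma M ((sigma M ^^ i) (w j))))"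
    by (simp add: sum.lessThan_Suc_shift assms del: sum.lessThan_Suc)
  also have "\<dots> = sigma M y"
    by (simp add: y_def sigma_sum sigma_smul sc_KK KK_power)
  finally show ?thesis by simp
qed

end

locale dual_motive_module = dual_motive Fq \<theta> M m w \<Phi>'
  for Fq :: "'c::{field,metric_space} set" and \<theta> :: 'c
    and M :: "('c, 'm::ab_group_add) tsigma_ops" and m :: "'r::finite \<Rightarrow> 'm" and w :: "'d::finite \<Rightarrow> 'm"
    and \<Phi>' :: "'c poly ^ 'r ^ 'r" +
  fixes E :: "('c, 'd) t_module"
  assumes E: "associated_t_module Fq \<theta> M w E"
begin

definition B :: "'c poly \<Rightarrow> nat \<Rightarrow> 'c ^ 'd ^ 'd" where
  "B a i = (\<chi> l j. sc (poly_act M a (w j)) i $ l)"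

lemma B_bound_ex: "\<exists>N. \<forall>i\<ge>N. B a i = 0"
proof -
  have "\<forall>j. \<exists>N. \<forall>i\<ge>N. sc (poly_act M a (w j)) i = 0" using sc_bound_ex by blast
  then obtain N where N: "\<And>i j. i \<ge> N j \<Longrightarrow> sc (poly_act M a (w j)) i = 0" by metis
  have "N j \<le> Max (range N)" for j by simp
  then have "\<forall>i\<ge>Max (range N). B a i = 0"
    using N by (auto simp: B_def vec_eq_iff intro: order_trans)
  then show ?thesis by blast
qed

lemma E_bound_ex: assumes "a \<in> polys_over Fq" shows "\<exists>N. \<forall>i\<ge>N. E a i = 0"
proof -
  have "finite {k. E a k \<noteq> 0}"
    using E assms unfolding associated_t_module_def by (auto intro: anderson_t_module.finite_support)
  then obtain N where "{k. E a k \<noteq> 0} \<subseteq> {..<N}" using finite_nat_iff_bounded by blast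
  then show ?thesis by (intro exI[of _ N]) auto
qed

text \<open>The association with the module prescribes only how \<open>E a\<close> acts on points.
  Evaluated on \<open>wcomb c\<close>, whose image under \<open>\<delta>\<^sub>1\<close> is c, it
  becomes an identity of additive polynomials in the entries of c, hence of their
  coefficients.\<close>

lemma E_eq: assumes a: "a \<in> polys_over Fq" shows "E a k = mfr k (B a k)"
proof -
  obtain N1 where N1: "\<And>i. i \<ge> N1 \<Longrightarrow> E a i = 0" using E_bound_ex[OF a] by blast
  obtain N2 where N2: "\<And>i. i \<ge> N2 \<Longrightarrow> B a i = 0" using B_bound_ex by blast
  \<comment> \<open>Beyond both supports, and beyond \<open>k\<close> so that the coefficient in
    question is among those compared.\<close>
  define N where "N = Suc (N1 + N2 + k)"
  have N: "E a i = 0" "B a i = 0" if "i \<ge> N" for i using N1 N2 that by (auto simp: N_def)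
  have *: "(\<Sum>i<N. E a i *v vfr i c) = (\<Sum>i<N. mfr i (B a i) *v vfr i c)" if c: "\<And>j. c $ j \<in> KK" for c
  proof -
    have sc: "sc (poly_act M a (wcomb c)) i = B a i *v c" for i
      using sc_poly_act_wcomb[OF c PK_Fq[OF a]] by (simp add: B_def)
    have "(\<Sum>i<N. E a i *v vfr i c) = t_module_act q (E a) c"
      unfolding t_module_act_def using N(1)
      by (intro sum.mono_neutral_right) (auto simp: not_less[symmetric])
    also have "\<dots> = \<delta>\<^sub>1 (poly_act M a (wcomb c))"
      using E a delta1_wcomb[OF c] unfolding associated_t_module_def by metis
    also have "\<dots> = (\<Sum>i<N. vfr i (B a i *v c))"
      using delta1_sum[of N "poly_act M a (wcomb c)"] N(2) by (simp add: sc)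
    finally show ?thesis by (simp add: mfr_mult_vec)
  qed
  have "E a k $ i $ j - mfr k (B a k) $ i $ j = 0" for i j
  proof (rule additive_polynomial_zero[where N = N and d = "\<lambda>k. E a k $ i $ j - mfr k (B a k) $ i $ j"])
    show "k < N" by (simp add: N_def)
    fix c assume c: "c \<in> KK"
    have v: "(A *v vfr n (axis j c)) $ i = A $ i $ j * c ^ (q ^ n)" for A :: "'c ^ 'd ^ 'd" and n
    proof -
      have "(A *v vfr n (axis j c)) $ i = (\<Sum>l\<in>UNIV. if l = j then A $ i $ j * c ^ (q ^ n) else 0)"
        unfolding matrix_vector_mult_def vec_lambda_beta by (intro sum.cong) (auto simp: axis_def)
      then show ?thesis by simp
    qed
    have "(\<Sum>n<N. E a n *v vfr n (axis j c)) $ i = (\<Sum>n<N. mfr n (B a n) *v vfr n (axis j c)) $ i"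
      using *[of "axis j c"] c by (simp add: axis_def)
    then show "(\<Sum>n<N. (E a n $ i $ j - mfr n (B a n) $ i $ j) * c ^ (q ^ n)) = 0"
      unfolding sum_component v by (simp add: left_diff_distrib sum_subtractf)
  qed
  then show ?thesis by (simp add: vec_eq_iff)
qed

text \<open>Modulo the range of \<sigma> every element is a combination of the w_j, and
  multiplication by \<open>a\<close> commutes with \<sigma> because its coefficients lie in the
  finite field.\<close>

lemma delta0_poly_act: assumes a: "a \<in> polys_over Fq" shows "\<delta>\<^sub>0 (poly_act M a x) = E a 0 *v \<delta>\<^sub>0 x"
proof -
  define c where "c = sc x 0"
  have c: "c $ j \<in> KK" for j by (simp add: c_def sc_KK)
  have wc: "sc (wcomb c) = (\<lambda>i. if i = 0 then c else 0)" by (rule sc_wcomb[OF c])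
  have "x = wcomb c + (x - wcomb c)" by simp
  then have "sc x 0 = sc (wcomb c) 0 + sc (x - wcomb c) 0" by (metis sc_add)
  moreover have "sc (wcomb c) 0 = sc x 0" unfolding wc by (simp add: c_def)
  ultimately have "sc (x - wcomb c) 0 = 0" by (metis add_cancel_left_right)
  then obtain y where "x - wcomb c = sigma M y" using range_sigma_if by blast
  then have x: "x = wcomb c + sigma M y" by (metis add.commute diff_add_cancel)
  have "poly_act M a x = poly_act M a (wcomb c) + sigma M (poly_act M a y)"
    using a by (simp add: x poly_act_add_right PK_Fq sigma_poly_act_Fq)
  then have "\<delta>\<^sub>0 (poly_act M a x) = \<delta>\<^sub>0 (poly_act M a (wcomb c))" by (simp add: delta0_add delta0_sigma)
  also have "\<dots> = B a 0 *v c"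
    using sc_poly_act_wcomb[OF c PK_Fq[OF a], of 0] by (simp add: delta0_def B_def)
  also have "B a 0 = E a 0" using E_eq[OF a, of 0] by simp
  finally show ?thesis by (simp add: delta0_def c_def)
qed

lemma monom_Fq: "monom 1 n \<in> polys_over Fq"
  using subfield_0[OF Fq_subfield] subfield_1[OF Fq_subfield] by (simp add: polys_over_def)

text \<open>Supplies the operator with scalar constant coefficient for \<open>exp_unique\<close> and
  \<open>exp_entire\<close>.\<close>

lemma E_scalar_ex: "\<exists>s. E (monom 1 (q ^ s)) 0 = mat (\<theta> ^ (q ^ s))"
proof -
  obtain s where s: "\<And>x. \<delta>\<^sub>0 (poly_act M (monom 1 (q ^ s)) x) = \<theta> ^ (q ^ s) *s \<delta>\<^sub>0 x"
    using delta0_scalar_ex by blast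
  have "B (monom 1 (q ^ s)) 0 $ l $ j = mat (\<theta> ^ (q ^ s)) $ l $ j" for l j
    using s[of "w j"] delta0_w[of j] by (simp add: B_def delta0_def mat_def axis_def)
  then have "E (monom 1 (q ^ s)) 0 = mat (\<theta> ^ (q ^ s))"
    using E_eq[OF monom_Fq, of "q ^ s" 0] by (simp add: vec_eq_iff)
  then show ?thesis by blast
qed

lemma sums_shift: "(\<lambda>n. f (Suc n)) sums s \<Longrightarrow> f 0 = 0 \<Longrightarrow> (f :: nat \<Rightarrow> 'c ^ 'd) sums s"
proof -
  assume *: "(\<lambda>n. f (Suc n)) sums s" and 0: "f 0 = 0"
  have "(\<Sum>i<n. f (Suc i)) = (\<Sum>i<Suc n. f i)" for n
    by (simp add: sum.lessThan_Suc_shift 0 del: sum.lessThan_Suc)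
  with * have "(\<lambda>n. \<Sum>i<Suc n. f i) \<longlonglongrightarrow> s" by (simp add: sums_def del: sum.lessThan_Suc)
  then show ?thesis unfolding sums_def by (rule LIMSEQ_imp_Suc)
qed

lemma conv_X: assumes "conv g" shows "conv (fps_X * g)"
  unfolding conv_def
proof (rule LIMSEQ_imp_Suc)
  have "(\<lambda>n. real q * (absval (fps_nth g n) * real q ^ n)) \<longlonglongrightarrow> 0"
    using assms unfolding conv_def by (rule tendsto_mult_right_zero)
  then show "(\<lambda>n. absval (fps_nth (fps_X * g) (Suc n)) * real q ^ Suc n) \<longlonglongrightarrow> 0" by (simp add: mult_ac)
qed

lemma fps_of_poly_pCons': "fps_of_poly (pCons a p) * g = fps_const a * g + fps_X * (fps_of_poly p * (g :: 'c fps))"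
  by (simp only: fps_of_poly_pCons distrib_right mult.assoc mult.left_commute)

lemma conv_poly_mult: "conv g \<Longrightarrow> conv (fps_of_poly a * g)"
  by (induction a) (auto simp: fps_of_poly_pCons' intro: conv_add conv_const_mult conv_X)

text \<open>Multiplication by t shifts the coefficients by one, and on each t^n m_i the extra t acts
  through \<open>\<delta>\<^sub>0\<close> as a fixed matrix, which passes through the
  series.\<close>

lemma Lambda_X: assumes g: "conv_vec g" shows "\<Lambda> (fps_X *s g) = E (monom 1 1) 0 *v \<Lambda> g"
proof (rule Lambda_eqI)
  have e: "delta0_tpow i (Suc n) = E (monom 1 1) 0 *v delta0_tpow i n" for i n
  proof -
    have "monom 1 (Suc n) = monom 1 1 * (monom 1 n :: 'c poly)" by (simp only: mult_monom mult_1 plus_1_eq_Suc)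
    then show ?thesis unfolding delta0_tpow_def
      by (simp only: poly_act_mult[OF PK_monom[OF KK_1] PK_monom[OF KK_1]] delta0_poly_act[OF monom_Fq])
  qed
  have "E (monom 1 1) 0 *v (\<Sum>i\<in>UNIV. fps_nth (g $ i) n *s delta0_tpow i n)
    = (\<Sum>i\<in>UNIV. fps_nth (g $ i) n *s delta0_tpow i (Suc n))" for n
    by (simp add: matrix_vector_sum_right e vec.scale)
  then show "(\<lambda>n. \<Sum>i\<in>UNIV. fps_nth ((fps_X *s g) $ i) n *s delta0_tpow i n) sums (E (monom 1 1) 0 *v \<Lambda> g)"
    using sums_matrix_vector[OF Lambda_sums[OF g], of "E (monom 1 1) 0"]
    by - (rule sums_shift[of "\<lambda>n. \<Sum>i\<in>UNIV. fps_nth ((fps_X *s g) $ i) n *s delta0_tpow i n"], simp_all)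
qed (use g in \<open>auto intro: conv_X\<close>)

text \<open>Read off from multiplication on the module: the vectors
  \<open>\<delta>\<^sub>0 (w j)\<close> are the unit vectors, so they determine a matrix.\<close>

lemma E0_pCons:
  assumes "pCons a p \<in> polys_over Fq"
  shows "E (pCons a p) 0 *v x = a *s x + E (monom 1 1) 0 *v (E p 0 *v x)"
proof -
  have a: "a \<in> Fq" and p: "p \<in> polys_over Fq"
    using assms unfolding polys_over_def by (auto simp: coeff_pCons split: nat.splits)
  have "E (pCons a p) 0 = mat a + E (monom 1 1) 0 ** E p 0"
  proof -
    have col: "A $ l $ j = (A *v \<delta>\<^sub>0 (w j)) $ l" for A :: "'c ^ 'd ^ 'd" and l j
      by (simp add: delta0_w matrix_vector_mult_def axis_def if_distrib cong: if_cong)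
    have pc: "pCons a p = [:a:] + monom 1 1 * p" by (simp add: monom_altdef)
    have "E (pCons a p) 0 *v \<delta>\<^sub>0 (w j) = (mat a + E (monom 1 1) 0 ** E p 0) *v \<delta>\<^sub>0 (w j)" for j
    proof -
      have "E (pCons a p) 0 *v \<delta>\<^sub>0 (w j) = \<delta>\<^sub>0 (poly_act M (pCons a p) (w j))"
        by (simp add: delta0_poly_act assms)
      also have "poly_act M (pCons a p) (w j) = smul M a (w j) + poly_act M (monom 1 1) (poly_act M p (w j))"
        unfolding pc using a p by (subst poly_act_add_left) (auto simp: KK_Fq PK_mult PK_monom PK_Fq poly_act_const poly_act_mult)
      also have "\<delta>\<^sub>0 \<dots> = a *s \<delta>\<^sub>0 (w j) + E (monom 1 1) 0 *v (E p 0 *v \<delta>\<^sub>0 (w j))"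
        using a p by (simp only: delta0_add delta0_smul[OF KK_Fq] delta0_poly_act[OF monom_Fq] delta0_poly_act)
      also have "a *s \<delta>\<^sub>0 (w j) = mat a *v \<delta>\<^sub>0 (w j)"
        by (simp add: vec_eq_iff matrix_vector_mult_def mat_def if_distrib if_distribR cong: if_cong)
      finally show ?thesis by (simp only: matrix_vector_mult_add_rdistrib matrix_vector_mul_assoc)
    qed
    then have "E (pCons a p) 0 $ l $ j = (mat a + E (monom 1 1) 0 ** E p 0) $ l $ j" for l j
      unfolding col by simp
    then show ?thesis by (simp only: vec_eq_iff) blast
  qed
  moreover have "mat a *v x = a *s x"
    by (simp add: vec_eq_iff matrix_vector_mult_def mat_def if_distrib if_distribR cong: if_cong)
  ultimately show ?thesis by (simp only: matrix_vector_mult_add_rdistrib matrix_vector_mul_assoc)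
qed

lemma Lambda_poly_mult:
  assumes "a \<in> polys_over Fq" "conv_vec g"
  shows "\<Lambda> (fps_of_poly a *s g) = E a 0 *v \<Lambda> g"
  using assms(1)
proof (induction a)
  case 0
  have "B 0 0 = 0" by (simp add: B_def vec_eq_iff)
  then have "E 0 0 = 0" using E_eq[OF 0, of 0] by simp
  then show ?case by simp
next
  case (pCons a p)
  have p: "p \<in> polys_over Fq"
    using pCons.prems unfolding polys_over_def by (auto simp: coeff_pCons split: nat.splits)
  have c: "conv_vec (fps_of_poly p *s g)" using assms(2) by (auto intro: conv_poly_mult)
  have "fps_of_poly (pCons a p) *s g = fps_const a *s g + fps_X *s (fps_of_poly p *s g)"
    by (simp add: vec_eq_iff fps_of_poly_pCons')
  then have "\<Lambda> (fps_of_poly (pCons a p) *s g) = a *s \<Lambda> g + E (monom 1 1) 0 *v \<Lambda> (fps_of_poly p *s g)"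
    using assms(2) c
    by (simp add: Lambda_add Lambda_smult Lambda_X[OF c] conv_const_mult conv_X conv_poly_mult del: vector_smult_assoc)
  then show ?case by (simp add: pCons.IH[OF p] E0_pCons[OF pCons.prems])
qed

end

subsection \<open>Inverting \<open>\<sigma>\<close> on power series\<close>

context dual_motive
begin

abbreviation "\<Phi>f \<equiv> map_matrix fps_of_poly \<Phi>'"

lemma fps_vec_sigma_coord: "fps_vec (\<sigma>\<^sub>t g) = (\<chi> i. fps_rt (fps_of_poly (g $ i))) v* \<Phi>f"
  by (simp add: fps_vec_def sigma_coord_def vec_eq_iff vector_matrix_mult_def fps_of_poly_sum fps_of_poly_mult rt.fps_map_of_poly)

text \<open>Writing (t - \<theta>)^L m_i = \<sigma>(y_i), the twisted coordinates of the y_i form a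
  matrix G with G \<open>\<Phi>'\<close> = (t - \<theta>)^L. As \<theta> is nonzero, t - \<theta> is
  a unit among power series, which gives a left inverse. Over the field of Laurent series it is also
  a right inverse.\<close>

lemma Theta_ex: "\<exists>T C. \<Phi>f ** T = mat 1 \<and> T ** \<Phi>f = mat 1 \<and> (\<forall>i j. bd (real q) C (T $ i $ j))"
proof -
  obtain L where L: "\<And>x. poly_act M ([:- \<theta>, 1:] ^ L) x \<in> range (sigma M)" using torsion by blast
  define p where "p = [:- \<theta>, 1:] ^ L"
  have "\<forall>i. \<exists>y. poly_act M p (m i) = sigma M y" using L by (auto simp: p_def)
  then obtain y where y: "\<And>i. poly_act M p (m i) = sigma M (y i)" by metis
  have row: "\<sigma>\<^sub>t (\<kappa> (y i)) = p *s axis i 1" for i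
    unfolding coords_sigma[symmetric] y[symmetric] p_def
    by (simp only: coords_poly_act[OF PK_power[OF PK_linear]] coords_m)
  define G where "G = (\<chi> i j. fps_rt (fps_of_poly (\<kappa> (y i) $ j)))"
  \<comment> \<open>The geometric series of 1 / (t - \<theta>).\<close>
  define U where "U = Abs_fps (\<lambda>n. - (inverse \<theta> ^ Suc n))"
  have U: "U * fps_of_poly [:- \<theta>, 1:] = 1"
  proof (rule fps_ext)
    fix n
    have "fps_of_poly [:- \<theta>, 1:] = fps_X - fps_const \<theta>"
      by (rule fps_ext) (simp add: coeff_pCons fps_X_def split: nat.split)
    then have "U * fps_of_poly [:- \<theta>, 1:] = fps_X * U - fps_const \<theta> * U"
      by (simp only: right_diff_distrib mult.commute)
    then show "fps_nth (U * fps_of_poly [:- \<theta>, 1:]) n = fps_nth 1 n"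
      using theta_nz by (cases n) (simp_all add: U_def)
  qed
  define V where "V = U ^ L"
  have V: "V * fps_of_poly p = 1"
    by (simp only: V_def p_def fps_of_poly_power power_mult_distrib[symmetric] U power_one)
  define T where "T = (\<chi> i j. V * G $ i $ j)"
  have T1: "T ** \<Phi>f = mat 1"
  proof -
    have "(T ** \<Phi>f) $ i $ j = V * fps_vec (\<sigma>\<^sub>t (\<kappa> (y i))) $ j" for i j
      by (simp add: fps_vec_sigma_coord matrix_matrix_mult_def vector_matrix_mult_def T_def G_def sum_distrib_left mult_ac)
    then show ?thesis
      using V by (auto simp: vec_eq_iff mat_def row fps_vec_def axis_def)
  qed
  have "map_matrix fps_to_fls T ** map_matrix fps_to_fls \<Phi>f = mat 1"
    by (simp add: map_matrix_fps_mult[symmetric] T1) (simp add: vec_eq_iff mat_def)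
  then have "map_matrix fps_to_fls \<Phi>f ** map_matrix fps_to_fls T = mat 1"
    by (rule matrix_left_right_inverse1)
  then have "map_matrix fps_to_fls (\<Phi>f ** T) = mat 1" by (simp add: map_matrix_fps_mult)
  then have "fps_to_fls ((\<Phi>f ** T) $ i $ j) = mat 1 $ i $ j" for i j
    by (metis map_matrix_nth)
  then have "fps_to_fls ((\<Phi>f ** T) $ i $ j) = fps_to_fls (mat 1 $ i $ j)" for i j
    by (simp add: mat_def)
  then have T2: "\<Phi>f ** T = mat 1" by (simp add: vec_eq_iff)
  \<comment> \<open>At radius q every weighted coefficient has size 1/q: bounded but not null,
    because of the pole at \<theta>. Hence the bound on the inverse is stated with \<open>bd\<close>
    and not with \<open>conv\<close>.\<close>
  have "bd (real q) 1 U" unfolding bd_def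
  proof
    fix n
    have "absval (fps_nth U n) = inverse (real q) ^ Suc n"
      unfolding U_def by (simp only: Abs_fps_inverse fps_nth_Abs_fps absval_minus absval_inverse absval_power absval_theta)
    then have "absval (fps_nth U n) * real q ^ n = inverse (real q)"
      using q_pos by (simp add: power_inverse)
    moreover have "inverse (real q) \<le> 1" using q_pos by (simp add: field_simps)
    ultimately show "absval (fps_nth U n) * real q ^ n \<le> 1" by simp
  qed
  then have V1: "bd (real q) 1 V" unfolding V_def
  proof (induction L)
    case 0
    then show ?case by (auto simp: bd_def)
  next
    case (Suc L)
    then show ?case using bd_mult[of "real q" 1 U 1 "U ^ L"] q_pos by simp
  qed
  have "\<forall>i j. \<exists>C. bd (real q) C (G $ i $ j)"
    unfolding G_def by (simp add: rt.fps_map_of_poly bd_fps_of_poly)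
  then obtain C where C: "\<And>i j. bd (real q) (C i j) (G $ i $ j)" by metis
  define C' where "C' = (\<Sum>i\<in>UNIV. \<Sum>j\<in>UNIV. C i j)"
  have "bd (real q) C' (T $ i $ j)" for i j
  proof -
    have C0: "C i j \<ge> 0" for i j using C bd_nonneg[of "real q"] by fastforce
    have "C i j \<le> (\<Sum>j\<in>UNIV. C i j)" using C0 by (intro member_le_sum) auto
    also have "\<dots> \<le> C'" unfolding C'_def using C0 by (intro member_le_sum) (auto intro: sum_nonneg)
    finally have "C i j \<le> C'" .
    moreover have "bd (real q) (1 * C i j) (T $ i $ j)"
      using bd_mult[OF _ V1 C] q_pos by (simp add: T_def)
    ultimately show ?thesis by (auto intro: bd_mono)
  qed
  with T1 T2 show ?thesis by blast
qed

definition "Theta = (SOME T. \<Phi>f ** T = mat 1 \<and> T ** \<Phi>f = mat 1 \<and> (\<exists>C. \<forall>i j. bd (real q) C (T $ i $ j)))"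

lemma Theta: "\<Phi>f ** Theta = mat 1" "Theta ** \<Phi>f = mat 1" "\<exists>C. \<forall>i j. bd (real q) C (Theta $ i $ j)"
proof -
  have "\<exists>T. \<Phi>f ** T = mat 1 \<and> T ** \<Phi>f = mat 1 \<and> (\<exists>C. \<forall>i j. bd (real q) C (T $ i $ j))" using Theta_ex by blast
  from someI_ex[OF this]
  show "\<Phi>f ** Theta = mat 1" "Theta ** \<Phi>f = mat 1" "\<exists>C. \<forall>i j. bd (real q) C (Theta $ i $ j)"
    unfolding Theta_def by blast+
qed

text \<open>The inverse of \<sigma> on columns of power series: h^(-1) \<open>\<Phi>'\<close> = g is
  solved by h = (g \<open>Theta\<close>)^(1).\<close>

definition S :: "'c fps ^ 'r \<Rightarrow> 'c fps ^ 'r" where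
  "S g = (\<chi> i. fps_fr ((g v* Theta) $ i))"

lemma S_nth: "S g $ i = (\<Sum>j\<in>UNIV. fps_fr (g $ j) * fps_fr (Theta $ j $ i))"
  by (simp add: S_def vector_matrix_mult_def power_q.fps_map_sum power_q.fps_map_mult mult.commute)

lemma S_add: "S (f + g) = S f + S g"
  by (simp add: vec_eq_iff S_nth power_q.fps_map_add distrib_right sum.distrib)

lemma S_smult: "S (b *s g) = fps_fr b *s S g"
  by (simp add: vec_eq_iff S_nth power_q.fps_map_mult sum_distrib_left mult.assoc)

lemma S_0 [simp]: "S 0 = 0"
  by (simp add: vec_eq_iff S_nth)

lemma S_sum: "S (sum f I) = (\<Sum>i\<in>I. S (f i))"
  by (induction I rule: infinite_finite_induct) (auto simp: S_add)

lemma S_rt: "S ((\<chi> i. fps_rt (g $ i)) v* \<Phi>f) = g"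
  by (simp add: S_def vector_matrix_mul_assoc Theta vec_eq_iff)

lemma S_sigma_coord: "S (fps_vec (\<sigma>\<^sub>t g)) = fps_vec g"
  unfolding fps_vec_sigma_coord using S_rt[of "fps_vec g"] by (simp add: fps_vec_def)

lemma S_funpow_add: "(S ^^ k) (f + g) = (S ^^ k) f + (S ^^ k) g"
  by (induction k) (auto simp: S_add)

lemma S_funpow_sum: "(S ^^ k) (sum f I) = (\<Sum>i\<in>I. (S ^^ k) (f i))"
  by (induction k) (auto simp: S_sum)

lemma S_funpow_const: "(S ^^ k) (fps_const c *s g) = fps_const (c ^ (q ^ k)) *s (S ^^ k) g"
proof (induction k)
  case (Suc k)
  have "fps_fr (fps_const (c ^ (q ^ k))) = fps_const (c ^ (q ^ Suc k))"
    using q_pos by (intro fps_ext) (auto simp: power_mult[symmetric] mult.commute)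
  then show ?case using Suc by (simp add: S_smult)
qed simp

lemma S_funpow_Fq: "a \<in> polys_over Fq \<Longrightarrow> (S ^^ k) (fps_of_poly a *s g) = fps_of_poly a *s (S ^^ k) g"
  by (induction k) (auto simp: S_smult fps_map_Fq)

lemma S_funpow_sigma_coord: "(S ^^ k) (fps_vec ((\<sigma>\<^sub>t ^^ k) g)) = fps_vec g"
proof (induction k)
  case (Suc k)
  have "(S ^^ Suc k) (fps_vec ((\<sigma>\<^sub>t ^^ Suc k) g))
    = (S ^^ k) (S (fps_vec (\<sigma>\<^sub>t ((\<sigma>\<^sub>t ^^ k) g))))" by (simp add: funpow_swap1)
  then show ?case using Suc by (simp add: S_sigma_coord)
qed simp

lemma sigma_coord_add: "\<sigma>\<^sub>t (f + g) = \<sigma>\<^sub>t f + \<sigma>\<^sub>t g"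
  by (simp add: sigma_coord_def vec_eq_iff vector_matrix_mult_def rt.map_poly_hom_add distrib_right distrib_left sum.distrib)

lemma sigma_coord_0 [simp]: "\<sigma>\<^sub>t 0 = 0"
  using sigma_coord_add[of 0 0] by simp

lemma sigma_coord_sum: "\<sigma>\<^sub>t (sum f I) = (\<Sum>i\<in>I. \<sigma>\<^sub>t (f i))"
  by (induction I rule: infinite_finite_induct) (auto simp: sigma_coord_add)

lemma sigma_coord_const: "\<sigma>\<^sub>t ([:c:] *s g) = [:rt c:] *s \<sigma>\<^sub>t g"
proof -
  have "map_poly rt ([:c:] * p) = [:rt c:] * map_poly rt p" for p :: "'c poly"
    unfolding rt.map_poly_hom_mult by (simp add: map_poly_pCons)
  then show ?thesis
    by (simp only: sigma_coord_def vec_eq_iff vector_matrix_mult_def vec_lambda_beta vector_smult_component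
        sum_distrib_left mult_ac) simp
qed

lemma sigma_coord_funpow_sum: "(\<sigma>\<^sub>t ^^ k) (sum f I) = (\<Sum>i\<in>I. (\<sigma>\<^sub>t ^^ k) (f i))"
  by (induction k) (auto simp: sigma_coord_sum)

lemma sigma_coord_funpow_const: "(\<sigma>\<^sub>t ^^ k) ([:c ^ (q ^ k):] *s g) = [:c:] *s (\<sigma>\<^sub>t ^^ k) g"
proof (induction k arbitrary: c)
  case (Suc k)
  have "(\<sigma>\<^sub>t ^^ Suc k) ([:c ^ (q ^ Suc k):] *s g) = \<sigma>\<^sub>t ((\<sigma>\<^sub>t ^^ k) ([:(c ^ q) ^ (q ^ k):] *s g))"
    by (simp add: power_mult)
  then show ?case using Suc[of "c ^ q"] by (simp add: sigma_coord_const)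
qed simp

text \<open>The column \<open>g\<close> may have coefficients outside the scalars of the module. It
  is a linear combination over the completed field of the coordinates of t^n m_i, and for these
  genuine elements \<open>\<delta>\<^sub>0\<close> kills the range of \<sigma>.\<close>

lemma Lambda_sigma_coord: "\<Lambda> (fps_vec (\<sigma>\<^sub>t g)) = 0"
proof -
  define N where "N = Suc (Max (range (\<lambda>i. degree (g $ i))))"
  have N: "degree (g $ i) < N" for i unfolding N_def by (simp add: le_imp_less_Suc)

  have k: "\<kappa> (poly_act M (monom 1 n) (m i)) = monom 1 n *s axis i 1" for n i
    by (simp add: coords_poly_act PK_monom coords_m)
  have g: "g = (\<Sum>i\<in>UNIV. \<Sum>n<N. [:coeff (g $ i) n:] *s \<kappa> (poly_act M (monom 1 n) (m i)))"
  proof -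
    have "(\<Sum>i\<in>UNIV. \<Sum>n<N. [:coeff (g $ i) n:] *s \<kappa> (poly_act M (monom 1 n) (m i))) $ j = g $ j" for j
    proof -
      have "(\<Sum>i\<in>UNIV. \<Sum>n<N. [:coeff (g $ i) n:] *s \<kappa> (poly_act M (monom 1 n) (m i))) $ j
        = (\<Sum>i\<in>UNIV. if i = j then (\<Sum>n<N. monom (coeff (g $ j) n) n) else 0)"
        unfolding sum_component by (intro sum.cong) (auto simp: k axis_def smult_monom)
      also have "\<dots> = (\<Sum>n<N. monom (coeff (g $ j) n) n)" by simp
      also have "\<dots> = g $ j" using N[of j] by (intro poly_eqI) (auto simp: coeff_sum coeff_eq_0)
      finally show ?thesis .
    qed
    then show ?thesis by (simp add: vec_eq_iff)
  qed
  have "fps_vec (\<sigma>\<^sub>t g)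
    = fps_vec (\<sigma>\<^sub>t (\<Sum>i\<in>UNIV. \<Sum>n<N. [:coeff (g $ i) n:] *s \<kappa> (poly_act M (monom 1 n) (m i))))"
    by (rule arg_cong[OF g])
  also have "\<dots> = (\<Sum>i\<in>UNIV. \<Sum>n<N. fps_const (rt (coeff (g $ i) n)) *s
      fps_vec (\<kappa> (sigma M (poly_act M (monom 1 n) (m i)))))"
    by (simp only: sigma_coord_sum sigma_coord_const fps_vec_sum fps_vec_smult coords_sigma fps_of_poly_const)
  also have "\<Lambda> \<dots> = (\<Sum>i\<in>UNIV. \<Sum>n<N. rt (coeff (g $ i) n) *s \<Lambda> (fps_vec (\<kappa> (sigma M (poly_act M (monom 1 n) (m i))))))"
  proof -
    define v where "v n i = fps_vec (\<kappa> (sigma M (poly_act M (monom 1 n) (m i))))" for n i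
    define c where "c n i = rt (coeff (g $ i) n)" for n i
    have v: "conv_vec (v n i)" for n i unfolding v_def by (rule conv_fps_vec)
    then have cv: "conv_vec (fps_const (c n i) *s v n i)" for n i by (auto intro: conv_const_mult)
    have cs: "conv_vec (\<Sum>n<N. fps_const (c n i) *s v n i)" for i
      unfolding sum_component using cv by (auto intro: conv_sum)
    have "\<Lambda> (\<Sum>n<N. fps_const (c n i) *s v n i) = (\<Sum>n<N. c n i *s \<Lambda> (v n i))" for i
      by (subst Lambda_sum[OF cv]) (simp only: Lambda_smult[OF v])
    then have "\<Lambda> (\<Sum>i\<in>UNIV. \<Sum>n<N. fps_const (c n i) *s v n i) = (\<Sum>i\<in>UNIV. \<Sum>n<N. c n i *s \<Lambda> (v n i))"
      by (subst Lambda_sum[OF cs]) (simp only:)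
    then show ?thesis by (simp only: v_def c_def)
  qed
  finally show ?thesis by (simp add: Lambda_coords delta0_sigma)
qed

lemma conv_vec_bd: assumes "conv_vec g" shows "\<exists>B. \<forall>i. bd (real q) B (g $ i)"
proof -
  have "\<forall>i. \<exists>b. bd (real q) b (g $ i)" using assms conv_bd by blast
  then obtain b where b: "\<And>i. bd (real q) (b i) (g $ i)" by metis
  have "b i \<le> Max (range b)" for i by simp
  then show ?thesis using bd_mono[OF b] by blast
qed

lemma S_bd:
  assumes R: "R > 0" and g: "\<And>i. bd R B' (fps_fr (g $ i))" and T: "\<And>i j. bd R C (fps_fr (Theta $ i $ j))"
  shows "bd R (B' * C) (S g $ i)"
  unfolding S_nth
proof (rule bd_sum[OF R])
  have "B' \<ge> 0" "C \<ge> 0" using bd_nonneg[OF _ g] bd_nonneg[OF _ T] R by simp_all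
  then show "0 \<le> B' * C" by simp
qed (rule bd_mult[OF R g T])

text \<open>The twisted inverse is bounded at radius q^q, which serves convergence; the bound at
  radius q, which serves interpolation, follows from q <= q^q.\<close>

lemma Theta_bd: obtains C where "C \<ge> 0" "\<And>i j. bd (real q) C (Theta $ i $ j)"
    "\<And>i j. bd (real q ^ q) (C ^ q) (fps_fr (Theta $ i $ j))" "\<And>i j. bd (real q) (C ^ q) (fps_fr (Theta $ i $ j))"
proof -
  obtain C where C: "\<And>i j. bd (real q) C (Theta $ i $ j)" using Theta(3) by blast
  then have C': "bd (real q ^ q) (C ^ q) (fps_fr (Theta $ i $ j))" for i j by (intro bd_fps_fr) auto
  have "real q \<le> real q ^ q" using q_ge_2 self_le_power[of "real q" q] by simp
  then have "bd (real q) (C ^ q) (fps_fr (Theta $ i $ j))" for i j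
    using bd_antimono_radius[OF C'] by simp
  moreover have "C \<ge> 0" by (rule bd_nonneg[OF _ C]) simp
  ultimately show ?thesis using C C' that[of C] by simp
qed

text \<open>\<open>Theta\<close> may have a pole at \<theta>, but the final twist makes the result
  bounded at radius q^q > q.\<close>

lemma conv_S: assumes "conv_vec g" shows "conv_vec (S g)"
proof
  fix i
  obtain B' where B': "\<And>i. bd (real q) B' (g $ i)" using conv_vec_bd[OF assms] by blast
  obtain C where "C \<ge> 0" "\<And>i j. bd (real q) C (Theta $ i $ j)"
    and C: "\<And>i j. bd (real q ^ q) (C ^ q) (fps_fr (Theta $ i $ j))"
    and "\<And>i j. bd (real q) (C ^ q) (fps_fr (Theta $ i $ j))" by (rule Theta_bd) blast
  have "bd (real q ^ q) (B' ^ q * C ^ q) (S g $ i)"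
    by (rule S_bd[OF _ bd_fps_fr[OF _ B'] C]) (use q_pos in auto)
  moreover have "real q ^ 1 < real q ^ q" using q_ge_2 by (intro power_strict_increasing) auto
  ultimately show "conv (S g $ i)" by (intro conv_if_bd) auto
qed

lemma conv_S_funpow: "conv_vec g \<Longrightarrow> conv_vec ((S ^^ k) g)"
  by (induction k) (auto simp: conv_S)

end

subsection \<open>Logarithm and exponential\<close>

context dual_motive
begin

text \<open>The coordinates of the formal combination of the w_j with coefficients u_j in the
  completed field, which need not act on the module.\<close>

definition wv :: "'c ^ 'd \<Rightarrow> 'c poly ^ 'r" where
  "wv u = (\<Sum>j\<in>UNIV. [:u $ j:] *s \<kappa> (w j))"

definition P :: "('c, 'd) tau_series" where
  "P k = (\<chi> l j. \<Lambda> ((S ^^ k) (fps_vec (\<kappa> (w j)))) $ l)"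

lemma P_mult: "P k *v vfr k u = \<Lambda> ((S ^^ k) (fps_vec (wv u)))"
proof -
  have c: "conv_vec ((S ^^ k) (fps_vec (\<kappa> (w j))))" for j
    by (intro conv_S_funpow conv_fps_vec)
  then have c': "conv_vec (fps_const a *s (S ^^ k) (fps_vec (\<kappa> (w j))))" for j a
    by (auto intro: conv_const_mult)
  have "(S ^^ k) (fps_vec (wv u)) = (\<Sum>j\<in>UNIV. fps_const ((u $ j) ^ (q ^ k)) *s (S ^^ k) (fps_vec (\<kappa> (w j))))"
    by (simp only: wv_def fps_vec_sum fps_vec_smult fps_of_poly_const S_funpow_sum S_funpow_const)
  then have "\<Lambda> ((S ^^ k) (fps_vec (wv u))) = (\<Sum>j\<in>UNIV. (u $ j) ^ (q ^ k) *s \<Lambda> ((S ^^ k) (fps_vec (\<kappa> (w j)))))"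
    by (simp only: Lambda_sum[OF c'] Lambda_smult[OF c])
  then show ?thesis
    by (simp add: vec_eq_iff P_def matrix_vector_mult_def sum_component mult.commute)
qed

lemma P_axis: "P k *v axis j 1 = \<Lambda> ((S ^^ k) (fps_vec (\<kappa> (w j))))"
  by (simp add: vec_eq_iff P_def matrix_vector_mult_def axis_def if_distrib cong: if_cong)

lemma P_0: "P 0 = mat 1"
  by (simp add: vec_eq_iff P_def Lambda_coords delta0_w mat_def axis_def)

text \<open>Each \<open>S\<close> cancels one \<sigma>. Copies of \<open>S\<close> left over produce
  a coefficient of the logarithm; a \<sigma> left over is killed by
  \<open>\<Lambda>\<close>.\<close>

lemma Lambda_S_sigma:
  "\<Lambda> ((S ^^ n) (fps_vec ((\<sigma>\<^sub>t ^^ k) (wv u)))) = (if k \<le> n then P (n - k) *v vfr (n - k) u else 0)"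
proof (cases "k \<le> n")
  case True
  then have "S ^^ n = (S ^^ (n - k)) \<circ> (S ^^ k)" by (simp add: funpow_add[symmetric])
  then have "(S ^^ n) (fps_vec ((\<sigma>\<^sub>t ^^ k) (wv u))) = (S ^^ (n - k)) (fps_vec (wv u))"
    by (simp add: S_funpow_sigma_coord)
  with True show ?thesis by (simp only: P_mult if_True)
next
  case False
  define l where "l = k - Suc n"
  have k: "k = n + Suc l" using False by (simp add: l_def)
  have "(\<sigma>\<^sub>t ^^ k) (wv u) = (\<sigma>\<^sub>t ^^ n) (\<sigma>\<^sub>t ((\<sigma>\<^sub>t ^^ l) (wv u)))"
    by (simp only: k funpow_add o_apply funpow.simps)
  then have "(S ^^ n) (fps_vec ((\<sigma>\<^sub>t ^^ k) (wv u))) = fps_vec (\<sigma>\<^sub>t ((\<sigma>\<^sub>t ^^ l) (wv u)))"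
    by (simp only: S_funpow_sigma_coord)
  with False show ?thesis by (simp only: Lambda_sigma_coord if_False)
qed

text \<open>A scalar pulled inside \<sigma>^k becomes its q^k-th power, which is how the twisted
  coefficients of \<open>\<delta>\<^sub>1\<close> arise.\<close>

lemma coords_decomposition:
  assumes "\<And>i. i \<ge> N \<Longrightarrow> sc x i = 0"
  shows "\<kappa> x = (\<Sum>k<N. (\<sigma>\<^sub>t ^^ k) (wv (vfr k (sc x k))))"
proof -
  have "\<kappa> x = \<kappa> (\<Sum>i<N. \<Sum>j\<in>UNIV. smul M (sc x i $ j) ((sigma M ^^ i) (w j)))"
    by (rule arg_cong[OF sc_sum]) (rule assms)
  also have "\<dots> = (\<Sum>i<N. \<Sum>j\<in>UNIV. [:sc x i $ j:] *s (\<sigma>\<^sub>t ^^ i) (\<kappa> (w j)))"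
    by (simp only: coords_sum coords_smul[OF sc_KK] coords_sigma_funpow)
  also have "\<dots> = (\<Sum>k<N. (\<sigma>\<^sub>t ^^ k) (wv (vfr k (sc x k))))"
    by (simp only: wv_def sigma_coord_funpow_sum vfr_nth sigma_coord_funpow_const)
  finally show ?thesis .
qed

lemma Lambda_S_coords: "\<Lambda> ((S ^^ n) (fps_vec (\<kappa> x))) = (\<Sum>k\<le>n. P (n - k) *v vfr n (sc x k))"
proof -
  obtain N0 where N0: "\<And>i. i \<ge> N0 \<Longrightarrow> sc x i = 0" using sc_bound_ex by metis
  define N where "N = Suc (N0 + n)"
  have N: "\<And>i. i \<ge> N \<Longrightarrow> sc x i = 0" using N0 by (simp add: N_def)
  have c: "conv_vec ((S ^^ n) (fps_vec ((\<sigma>\<^sub>t ^^ k) (wv (vfr k (sc x k))))))" for k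
    by (intro conv_S_funpow conv_fps_vec)
  have "\<Lambda> ((S ^^ n) (fps_vec (\<kappa> x))) = (\<Sum>k<N. \<Lambda> ((S ^^ n) (fps_vec ((\<sigma>\<^sub>t ^^ k) (wv (vfr k (sc x k)))))))"
    by (simp only: coords_decomposition[OF N] fps_vec_sum S_funpow_sum Lambda_sum[OF c])
  also have "\<dots> = (\<Sum>k<N. if k \<le> n then P (n - k) *v vfr n (sc x k) else 0)"
    by (intro sum.cong) (simp_all del: of_nat_add of_nat_diff add: Lambda_S_sigma vfr_vfr)
  also have "\<dots> = (\<Sum>k\<le>n. P (n - k) *v vfr n (sc x k))"
    by (rule sum.mono_neutral_cong_right) (auto simp: N_def)
  finally show ?thesis .
qed

lemma tau_vec_rev: "tau_vec q T x n = (\<Sum>k\<le>n. T (n - k) *v vfr (n - k) (x k :: 'c ^ 'd))"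
  unfolding tau_vec_def by (rule sum.reindex_bij_witness[of _ "\<lambda>i. n - i" "\<lambda>i. n - i"]) auto

text \<open>The sequence on the right is that of the coefficients of delta_(1,z)(x), so this is the
  z^n-coefficient of the deformed logarithm of delta_(1,z)(x), once \<open>P\<close> is known to be
  the logarithm.\<close>

lemma Lambda_S_tau_vec: "\<Lambda> ((S ^^ n) (fps_vec (\<kappa> x))) = tau_vec q P (\<lambda>k. vfr k (sc x k)) n"
  unfolding Lambda_S_coords tau_vec_rev
  by (intro sum.cong) (auto simp only: vfr_vfr atMost_iff le_add_diff_inverse2)

end

context dual_motive_module
begin

text \<open>On the j-th unit vector both sides equal \<open>\<Lambda>\<close> of the n-th iterate of
  \<open>S\<close> on a(t) w_j: either expand a(t) w_j in powers of \<sigma>, or pull a(t) out,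
  since its coefficients in the finite field are fixed by the twist.\<close>

lemma P_intertwines: assumes a: "a \<in> polys_over Fq"
  shows "tau_mult q P (E a) = tau_mult q (tau_const (E a 0)) P"
proof
  fix n
  have "(tau_mult q P (E a) n *v axis j 1) = E a 0 *v (P n *v axis j 1)" for j
  proof -
    have B: "mfr n (B a k) *v axis j 1 = vfr n (sc (poly_act M a (w j)) k)" for k
      by (simp add: vec_eq_iff B_def matrix_vector_mult_def axis_def if_distrib cong: if_cong)
    have "tau_mult q P (E a) n = (\<Sum>i\<le>n. P i ** mfr n (B a (n - i)))"
      unfolding tau_mult_def by (intro sum.cong) (auto simp only: E_eq[OF a] mfr_mfr atMost_iff le_add_diff_inverse)
    also have "\<dots> = (\<Sum>k\<le>n. P (n - k) ** mfr n (B a k))"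
      by (rule sum.reindex_bij_witness[of _ "\<lambda>i. n - i" "\<lambda>i. n - i"]) auto
    finally have "tau_mult q P (E a) n *v axis j 1 = (\<Sum>k\<le>n. P (n - k) *v (mfr n (B a k) *v axis j 1))"
      by (simp only: matrix_vector_sum_left matrix_vector_mul_assoc)
    also have "\<dots> = \<Lambda> ((S ^^ n) (fps_vec (\<kappa> (poly_act M a (w j)))))"
      by (simp only: B Lambda_S_coords)
    also have "\<dots> = \<Lambda> (fps_of_poly a *s (S ^^ n) (fps_vec (\<kappa> (w j))))"
      by (simp only: coords_poly_act[OF PK_Fq[OF a]] fps_vec_smult S_funpow_Fq[OF a])
    also have "\<dots> = E a 0 *v \<Lambda> ((S ^^ n) (fps_vec (\<kappa> (w j))))"
      by (rule Lambda_poly_mult[OF a conv_S_funpow[OF conv_fps_vec]])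
    finally show ?thesis by (simp only: P_axis)
  qed
  then have "(tau_mult q P (E a) n *v axis j 1) $ l = ((E a 0 ** P n) *v axis j 1) $ l" for j l
    by (simp only: matrix_vector_mul_assoc)
  moreover have "(A *v axis j 1) $ l = A $ l $ j" for A :: "'c ^ 'd ^ 'd" and l j
    by (simp add: matrix_vector_mult_def axis_def if_distrib cong: if_cong)
  ultimately show "tau_mult q P (E a) n = tau_mult q (tau_const (E a 0)) P n"
    by (simp add: vec_eq_iff tau_const_mult)
qed

abbreviation "Q \<equiv> exp_series Fq E"

text \<open>Multiplying \<open>P_intertwines\<close> by the inverse \<open>R\<close> of
  \<open>P\<close> on both sides gives the functional equation of the exponential for
  \<open>R\<close>. Uniqueness, for one operator with scalar constant coefficient, then identifies
  \<open>R\<close> and \<open>P\<close> with the two definite descriptions.\<close>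

lemma exp_log_facts:
  shows exp_equation: "a \<in> polys_over Fq \<Longrightarrow> tau_mult q Q (tau_const (E a 0)) = tau_mult q (E a) Q"
    and exp_P: "tau_mult q Q P = tau_const (mat 1)"
    and log_series_eq: "log_series Fq E = P"
    and exp_series_entire: "entire Q"
proof -
  obtain R where R: "R 0 = mat 1" "tau_mult q P R = tau_const (mat 1)" "tau_mult q R P = tau_const (mat 1)"
    using tau_inverse_ex[of P] P_0 by blast
  have eq: "tau_mult q R (tau_const (E a 0)) = tau_mult q (E a) R" if a: "a \<in> polys_over Fq" for a
  proof -
    have "tau_mult q (E a) R = tau_mult q (tau_mult q R P) (tau_mult q (E a) R)"
      by (simp only: R tau_mult_1_left)
    also have "\<dots> = tau_mult q R (tau_mult q (tau_mult q P (E a)) R)" by (simp only: tau_mult_assoc)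
    also have "\<dots> = tau_mult q (tau_mult q R (tau_const (E a 0))) (tau_mult q P R)"
      by (simp only: P_intertwines[OF a] tau_mult_assoc)
    finally show ?thesis by (simp only: R tau_mult_1_right)
  qed
  obtain s where s: "E (monom 1 (q ^ s)) 0 = mat (\<theta> ^ (q ^ s))" using E_scalar_ex by blast
  have Q: "Q = R" unfolding exp_series_def
  proof (rule the_equality)
    show "R 0 = mat 1 \<and> (\<forall>a\<in>polys_over Fq. tau_mult q R (tau_const (E a 0)) = tau_mult q (E a) R)"
      using R eq by blast
  next
    fix R' assume R': "R' 0 = mat 1 \<and> (\<forall>a\<in>polys_over Fq. tau_mult q R' (tau_const (E a 0)) = tau_mult q (E a) R')"
    show "R' = R"
    proof (rule exp_unique[where A = "E (monom 1 (q ^ s))" and s = s])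
      show "tau_mult q R' (tau_const (E (monom 1 (q ^ s)) 0)) = tau_mult q (E (monom 1 (q ^ s))) R'"
        using R' monom_Fq by blast
      show "tau_mult q R (tau_const (E (monom 1 (q ^ s)) 0)) = tau_mult q (E (monom 1 (q ^ s))) R"
        by (rule eq[OF monom_Fq])
    qed (use s R R' in auto)
  qed
  show "a \<in> polys_over Fq \<Longrightarrow> tau_mult q Q (tau_const (E a 0)) = tau_mult q (E a) Q"
    "tau_mult q Q P = tau_const (mat 1)"
    using R eq by (simp_all only: Q)
  show "log_series Fq E = P" unfolding log_series_def Q
  proof (rule the_equality)
    fix P' assume "tau_mult q P' R = tau_const (mat 1) \<and> tau_mult q R P' = tau_const (mat 1)"
    then have "P' = tau_mult q (tau_mult q P R) P'" "tau_mult q R P' = tau_const (mat 1)"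
      by (simp_all only: R tau_mult_1_left)
    then show "P' = P" by (simp only: tau_mult_assoc tau_mult_1_right)
  qed (use R in blast)
  obtain N where N: "\<And>i. i \<ge> N \<Longrightarrow> E (monom 1 (q ^ s)) i = 0" using E_bound_ex[OF monom_Fq] by blast
  show "entire Q" unfolding Q
    by (rule exp_entire[where A = "E (monom 1 (q ^ s))" and s = s and K = N, OF s _ eq[OF monom_Fq]]) (use N in simp)
qed

lemma log_sums: "u \<in> log_domain Fq E \<Longrightarrow> (\<lambda>k. P k *v vfr k u) sums t_log Fq E u"
  unfolding log_domain_def t_log_def log_series_eq mem_Collect_eq by (rule summable_sums)

text \<open>As twisted series, Exp d[a] Log = E_a. Applied to the constant \<open>u\<close>, the
  right-hand side has finitely many terms, and \<open>tau_vec_sums_iff\<close> passes to z = 1 on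
  the left without assuming convergence of the exponential series beforehand.\<close>

lemma exp_log:
  assumes a: "a \<in> polys_over Fq" and u: "u \<in> log_domain Fq E"
  shows "(\<lambda>n. Q n *v vfr n (E a 0 *v t_log Fq E u)) sums t_module_act q (E a) u"
proof -
  define \<delta> where "\<delta> n = (if n = 0 then u else 0)" for n :: nat
  have P: "tau_vec q P \<delta> = (\<lambda>k. P k *v vfr k u)" unfolding \<delta>_def by (rule ext) (rule tau_vec_single)
  have "tau_vec q Q (\<lambda>k. E a 0 *v (P k *v vfr k u)) = tau_vec q Q (tau_vec q (tau_const (E a 0)) (tau_vec q P \<delta>))"
    unfolding P by (simp add: tau_vec_const[abs_def])
  also have "\<dots> = tau_vec q (tau_mult q (tau_mult q Q (tau_const (E a 0))) P) \<delta>"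
    by (simp only: tau_vec_assoc)
  also have "tau_mult q (tau_mult q Q (tau_const (E a 0))) P = E a"
    by (simp only: exp_equation[OF a] tau_mult_assoc exp_P tau_mult_1_right)
  finally have *: "tau_vec q Q (\<lambda>k. E a 0 *v (P k *v vfr k u)) = (\<lambda>n. E a n *v vfr n u)"
    unfolding \<delta>_def by (simp add: tau_vec_single fun_eq_iff)
  obtain N where N: "\<And>i. i \<ge> N \<Longrightarrow> E a i = 0" using E_bound_ex[OF a] by blast
  have "(\<lambda>n. E a n *v vfr n u) sums (\<Sum>n | E a n \<noteq> 0. E a n *v vfr n u)"
  proof (rule sums_finite)
    have "{n. E a n \<noteq> 0} \<subseteq> {..<N}" using N by (metis (mono_tags) lessThan_iff mem_Collect_eq not_le subsetI)
    then show "finite {n. E a n \<noteq> 0}" using finite_subset by blast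
  qed auto
  then have "tau_vec q Q (\<lambda>k. E a 0 *v (P k *v vfr k u)) sums t_module_act q (E a) u"
    unfolding * t_module_act_def .
  then show ?thesis
    using tau_vec_sums_iff[OF exp_series_entire sums_matrix_vector[OF log_sums[OF u], of "E a 0"]] by simp
qed

lemma sums_delay: "f sums s \<Longrightarrow> (\<lambda>k. if l \<le> k then f (k - l) else 0) sums (s :: 'c ^ 'd)"
proof (induction l)
  case (Suc l)
  have "(\<lambda>k. if Suc l \<le> Suc k then f (Suc k - Suc l) else 0) sums s"
    unfolding Suc_le_mono diff_Suc_Suc using Suc .
  then show ?case using sums_shift[of "\<lambda>k. if Suc l \<le> k then f (k - Suc l) else 0" s] by simp
qed simp

text \<open>The power \<sigma>^l only delays the logarithm series of \<open>u\<close> by l steps and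
  t^n multiplies it by a fixed matrix, so the sum of the contribution of a triple does not depend on
  l.\<close>

lemma split_logarithm_sums:
  assumes "\<And>l n u. (l, n, u) \<in> set us \<Longrightarrow> u \<in> log_domain Fq E"
  shows "(\<lambda>k. \<Lambda> ((S ^^ k) (fps_vec (\<Sum>(l, n, u)\<leftarrow>us. monom 1 n *s (\<sigma>\<^sub>t ^^ l) (wv u)))))
    sums (\<Sum>(l, n, u)\<leftarrow>us. E (monom 1 n) 0 *v t_log Fq E u)"
  using assms
proof (induction us)
  case Nil
  have "(S ^^ k) 0 = 0" for k by (induction k) auto
  then show ?case by simp
next
  case (Cons x us)
  obtain l n u where x: "x = (l, n, u)" by (cases x)
  have u: "u \<in> log_domain Fq E" using Cons.prems x by auto
  define g where "g = (\<Sum>(l, n, u)\<leftarrow>us. monom 1 n *s (\<sigma>\<^sub>t ^^ l) (wv u))"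
  have "\<Lambda> ((S ^^ k) (fps_vec (monom 1 n *s (\<sigma>\<^sub>t ^^ l) (wv u) + g)))
    = E (monom 1 n) 0 *v (if l \<le> k then P (k - l) *v vfr (k - l) u else 0) + \<Lambda> ((S ^^ k) (fps_vec g))" for k
  proof -
    have c: "conv_vec ((S ^^ k) (fps_vec f))" for f by (intro conv_S_funpow conv_fps_vec)
    have c': "conv_vec (fps_of_poly (monom 1 n) *s (S ^^ k) (fps_vec f))" for f
      using c by (auto intro: conv_poly_mult)
    have "(S ^^ k) (fps_vec (monom 1 n *s (\<sigma>\<^sub>t ^^ l) (wv u) + g))
      = fps_of_poly (monom 1 n) *s (S ^^ k) (fps_vec ((\<sigma>\<^sub>t ^^ l) (wv u))) + (S ^^ k) (fps_vec g)"
      by (simp only: fps_vec_add fps_vec_smult S_funpow_add S_funpow_Fq[OF monom_Fq])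
    then show ?thesis
      by (simp only: Lambda_add[OF c' c] Lambda_poly_mult[OF monom_Fq c] Lambda_S_sigma)
  qed
  moreover have "(\<lambda>k. E (monom 1 n) 0 *v (if l \<le> k then P (k - l) *v vfr (k - l) u else 0)) sums (E (monom 1 n) 0 *v t_log Fq E u)"
    by (rule sums_matrix_vector) (rule sums_delay[OF log_sums[OF u]])
  moreover have "(\<lambda>k. \<Lambda> ((S ^^ k) (fps_vec g))) sums (\<Sum>(l, n, u)\<leftarrow>us. E (monom 1 n) 0 *v t_log Fq E u)"
    unfolding g_def using Cons by auto
  ultimately show ?case by (simp add: x g_def[symmetric] sums_vec_add)
qed

lemma exp_split_logarithm:
  assumes "\<And>l n u. (l, n, u) \<in> set us \<Longrightarrow> u \<in> log_domain Fq E"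
  shows "(\<lambda>i. Q i *v vfr i (\<Sum>(l, n, u)\<leftarrow>us. E (monom 1 n) 0 *v t_log Fq E u))
    sums (\<Sum>(l, n, u)\<leftarrow>us. t_module_act q (E (monom 1 n)) u)"
  using assms
proof (induction us)
  case (Cons x us)
  obtain l n u where x: "x = (l, n, u)" by (cases x)
  have u: "u \<in> log_domain Fq E" using Cons.prems x by auto
  have "(\<lambda>i. Q i *v vfr i (\<Sum>(l, n, u)\<leftarrow>us. E (monom 1 n) 0 *v t_log Fq E u))
    sums (\<Sum>(l, n, u)\<leftarrow>us. t_module_act q (E (monom 1 n)) u)"
    using Cons by auto
  from sums_vec_add[OF exp_log[OF monom_Fq u] this] show ?case
    by (simp add: x vfr_add matrix_vector_right_distrib)
qed simp

end

subsection \<open>Convergence of \<open>\<Sum> \<sigma>\<^sup>-\<^sup>k(f)\<close>\<close>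

text \<open>What is retained of the matrices: the equation of the last row of their inverse under
  \<sigma>, and a bound in the Gauss norm, tending to zero, for the iterates of that row.\<close>

locale dual_motive_extension = dual_motive_module Fq \<theta> M m w \<Phi>' E
  for Fq :: "'c::{field,metric_space} set" and \<theta> :: 'c
    and M :: "('c, 'm::ab_group_add) tsigma_ops" and m :: "'r::finite \<Rightarrow> 'm" and w :: "'d::finite \<Rightarrow> 'm"
    and \<Phi>' :: "'c poly ^ 'r ^ 'r" and E :: "('c, 'd) t_module" +
  fixes f :: "'c poly ^ 'r" and \<upsilon> :: "'c fps ^ 'r" and \<eta> :: "nat \<Rightarrow> real"
  assumes f_Kbar: "f $ i \<in> polys_over (Kbar Fq \<theta>)"
    and upsilon: "\<upsilon> = (\<chi> i. fps_map (frob (card Fq) (- 1)) (\<upsilon> $ i)) v* map_matrix fps_of_poly \<Phi>' + (\<chi> i. fps_of_poly (f $ i))"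
    and S_upsilon_bd: "bd 1 (\<eta> k) ((S ^^ k) \<upsilon> $ i)" and eta: "\<eta> \<longlonglongrightarrow> 0"
begin

definition y :: "nat \<Rightarrow> 'c fps ^ 'r" where
  "y k = (S ^^ k) (fps_vec f)"

definition s :: "nat \<Rightarrow> 'c fps ^ 'r" where
  "s k = (S ^^ k) \<upsilon>"

lemma s_bd: "bd 1 (\<eta> k) (s k $ i)"
  unfolding s_def by (rule S_upsilon_bd)

lemma y_Suc: "y (Suc k) = S (y k)"
  by (simp add: y_def)

lemma conv_y: "conv_vec (y k)"
  unfolding y_def by (intro conv_S_funpow conv_fps_vec)

text \<open>Applying \<open>S\<close> to \<upsilon> = \<sigma>(\<upsilon>) + f gives the telescoping
  relation between consecutive iterates.\<close>

lemma s_Suc: "s (Suc k) = s k + y (Suc k)"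
proof -
  have "S ((\<chi> i. fps_rt (\<upsilon> $ i)) v* \<Phi>f) = \<upsilon>" by (rule S_rt)
  moreover have "S \<upsilon> = S ((\<chi> i. fps_rt (\<upsilon> $ i)) v* \<Phi>f) + S (fps_vec f)"
    using arg_cong[OF upsilon, of S] by (simp only: fps_vec_def S_add)
  ultimately have "S \<upsilon> = \<upsilon> + S (fps_vec f)" by simp
  then have "(S ^^ k) (S \<upsilon>) = s k + (S ^^ k) (S (fps_vec f))" by (simp add: s_def S_funpow_add)
  then show ?thesis by (simp add: y_def s_def funpow_swap1)
qed

lemma s_diff: "k \<le> l \<Longrightarrow> s k = s l - (\<Sum>i\<in>{k..<l}. y (Suc i))"
  by (induction l rule: dec_induct) (simp_all add: s_Suc algebra_simps)

lemma eta_nonneg: "\<eta> k \<ge> 0"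
  using bd_nonneg[OF _ s_bd] by simp

lemma y_bd_1: "bd 1 (\<eta> k + \<eta> (Suc k)) (y (Suc k) $ i)"
proof -
  have "y (Suc k) $ i = s (Suc k) $ i - s k $ i" unfolding s_Suc by simp
  then show ?thesis
    using bd_diff[of 1 "\<eta> k + \<eta> (Suc k)" "s (Suc k) $ i" "s k $ i"]
      bd_mono[OF s_bd] eta_nonneg[of k] eta_nonneg[of "Suc k"] by simp
qed

text \<open>Interpolation between the radii \<open>1\<close> and \<open>q\<close>: \<open>\<parallel>S g\<parallel>\<^sub>q \<le> C\<^sup>q \<parallel>g\<parallel>\<^sub>1\<^bsup>q-1\<^esup> \<parallel>g\<parallel>\<^sub>q\<close>, so decay of the
  iterates in the Gauss norm forces decay on the disk of radius \<open>|\<theta>|\<close>.\<close>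

lemma bd_interpolation:
  assumes "bd 1 \<epsilon> g" "bd (real q) Y g"
  shows "bd (real q) (\<epsilon> ^ (q - 1) * Y) (fps_fr g)"
  unfolding bd_def
proof
  fix n
  have "absval (fps_nth g n) ^ q = absval (fps_nth g n) ^ (q - 1) * absval (fps_nth g n)"
    using power_minus_mult[OF q_pos, of "absval (fps_nth g n)"] by simp
  then have "absval (fps_nth (fps_fr g) n) * real q ^ n
    = absval (fps_nth g n) ^ (q - 1) * (absval (fps_nth g n) * real q ^ n)" by (simp add: absval_power)
  also have "\<dots> \<le> \<epsilon> ^ (q - 1) * Y"
    using assms bd_nonneg[OF _ assms(1)] by (intro mult_mono power_mono) (auto simp: bd_def)
  finally show "absval (fps_nth (fps_fr g) n) * real q ^ n \<le> \<epsilon> ^ (q - 1) * Y" .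
qed

text \<open>One step multiplies the bound at radius q by \<epsilon>^(q-1) C^q, where \<epsilon>
  bounds the Gauss norm. Since q >= 2 this factor tends to zero, and the bounds eventually decay
  geometrically.\<close>

lemma y_null: "\<exists>Y. Y \<longlonglongrightarrow> 0 \<and> (\<forall>k i. bd (real q) (Y k) (y (Suc k) $ i))"
proof -
  obtain C where "C \<ge> 0" "\<And>i j. bd (real q) C (Theta $ i $ j)"
    and "\<And>i j. bd (real q ^ q) (C ^ q) (fps_fr (Theta $ i $ j))"
    and C: "\<And>i j. bd (real q) (C ^ q) (fps_fr (Theta $ i $ j))" by (rule Theta_bd) blast
  obtain Y0 where Y0: "\<And>i. bd (real q) Y0 (y 1 $ i)" using conv_vec_bd[OF conv_y] by blast
  define \<epsilon> where "\<epsilon> k = \<eta> k + \<eta> (Suc k)" for k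
  \<comment> \<open>The bound at radius q carried along by \<open>bd_interpolation\<close> and the
    bound on the twisted \<open>Theta\<close>.\<close>
  define Y where "Y = rec_nat Y0 (\<lambda>k Y. \<epsilon> k ^ (q - 1) * Y * C ^ q)"
  have Y: "bd (real q) (Y k) (y (Suc k) $ i)" for k i
  proof (induction k arbitrary: i)
    case 0
    show ?case using Y0 by (simp add: Y_def)
  next
    case (Suc k)
    have "bd (real q) (\<epsilon> k ^ (q - 1) * Y k * C ^ q) (S (y (Suc k)) $ i)"
      by (rule S_bd[OF _ bd_interpolation[OF _ Suc] C]) (use q_pos y_bd_1 in \<open>auto simp: \<epsilon>_def\<close>)
    then show ?case by (simp add: Y_def y_Suc)
  qed
  have Y_nonneg: "Y k \<ge> 0" for k using bd_nonneg[OF _ Y] by simp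
  have "\<epsilon> \<longlonglongrightarrow> 0 + 0" unfolding \<epsilon>_def by (intro tendsto_add eta LIMSEQ_Suc)
  then have "(\<lambda>k. \<epsilon> k ^ (q - 1) * C ^ q) \<longlonglongrightarrow> 0 ^ (q - 1) * C ^ q"
    by (intro tendsto_intros) simp
  then have "(\<lambda>k. \<epsilon> k ^ (q - 1) * C ^ q) \<longlonglongrightarrow> 0" using q_ge_2 by (simp add: power_0_left)
  then have "\<forall>\<^sub>F k in sequentially. \<epsilon> k ^ (q - 1) * C ^ q < 1 / 2" by (rule order_tendstoD) simp
  then obtain K where K: "\<And>k. k \<ge> K \<Longrightarrow> \<epsilon> k ^ (q - 1) * C ^ q < 1 / 2"
    unfolding eventually_sequentially by blast
  have "summable Y"
  proof (rule summable_ratio_test)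
    fix k assume "K \<le> k"
    then have "(\<epsilon> k ^ (q - 1) * C ^ q) * Y k \<le> 1 / 2 * Y k"
      using K[of k] Y_nonneg by (intro mult_right_mono) auto
    then show "norm (Y (Suc k)) \<le> 1 / 2 * norm (Y k)"
      using Y_nonneg[of k] Y_nonneg[of "Suc k"] by (simp add: Y_def mult_ac)
  qed simp
  then show ?thesis using Y summable_LIMSEQ_zero by blast
qed

text \<open>No prior bound on \<open>s\<close> at radius q is at hand. For one coefficient, decay in
  the Gauss norm makes a later iterate smaller than the present one, so the ultrametric inequality
  leaves only the intermediate terms \<open>y\<close> to bound it.\<close>

lemma s_null: assumes "\<epsilon> > 0" shows "\<exists>K. \<forall>k\<ge>K. \<forall>i. bd (real q) \<epsilon> (s k $ i)"
proof -
  obtain Y where Y: "Y \<longlonglongrightarrow> 0" "\<And>k i. bd (real q) (Y k) (y (Suc k) $ i)" using y_null by blast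
  obtain K where K: "\<And>k. k \<ge> K \<Longrightarrow> Y k < \<epsilon>"
    using order_tendstoD(2)[OF Y(1) assms] by (auto simp: eventually_sequentially)
  have "absval (fps_nth (s k $ i) n) * real q ^ n \<le> \<epsilon>" if k: "k \<ge> K" for k i n
  proof (rule ccontr)
    assume *: "\<not> absval (fps_nth (s k $ i) n) * real q ^ n \<le> \<epsilon>"
    then have pos: "absval (fps_nth (s k $ i) n) > 0" using assms by (cases "fps_nth (s k $ i) n = 0") (auto simp: less_le)
    \<comment> \<open>This threshold depends on the coefficient \<open>n\<close>; the final bound
      does not.\<close>
    obtain L where L: "\<And>l. l \<ge> L \<Longrightarrow> \<eta> l < absval (fps_nth (s k $ i) n)"
      using order_tendstoD(2)[OF eta pos] by (auto simp: eventually_sequentially)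
    define l where "l = max k L"
    have "absval (fps_nth (s l $ i) n) \<le> \<eta> l" using s_bd[of l i] by (simp add: bd_def)
    also have "\<dots> < absval (fps_nth (s k $ i) n)" by (rule L) (simp add: l_def)
    finally have 1: "absval (fps_nth (s l $ i) n) < absval (fps_nth (s k $ i) n)" .
    have 2: "absval (\<Sum>j\<in>{k..<l}. fps_nth (y (Suc j) $ i) n) \<le> \<epsilon> / real q ^ n"
    proof (rule absval_sum_le)
      fix j assume "j \<in> {k..<l}"
      then have "bd (real q) \<epsilon> (y (Suc j) $ i)" using K[of j] k by (intro bd_mono[OF Y(2)]) auto
      then show "absval (fps_nth (y (Suc j) $ i) n) \<le> \<epsilon> / real q ^ n"
        using q_pos by (simp add: bd_def field_simps)
    qed (use assms in auto)
    have "fps_nth (s k $ i) n = fps_nth (s l $ i) n - (\<Sum>j\<in>{k..<l}. fps_nth (y (Suc j) $ i) n)"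
      by (subst s_diff[of k l]) (simp_all add: l_def sum_component fps_sum_nth)
    then have "absval (fps_nth (s k $ i) n) \<le> max (absval (fps_nth (s l $ i) n)) (\<epsilon> / real q ^ n)"
      using 2 by (simp only:) (rule absval_diff_le, auto)
    with 1 have "absval (fps_nth (s k $ i) n) \<le> \<epsilon> / real q ^ n" by (auto simp: max_def split: if_splits)
    with * show False using q_pos by (simp add: field_simps)
  qed
  then show ?thesis unfolding bd_def by blast
qed

lemma upsilon_eq: "\<upsilon> = s k - (\<Sum>i<k. y (Suc i))"
  using s_diff[of 0 k] by (simp add: s_def[of 0] atLeast0LessThan)

text \<open>The hypotheses bound \<upsilon> only on the unit disk. Up to \<open>s K\<close>, which
  is uniformly small at radius q, it is a finite sum of convergent columns.\<close>

lemma conv_upsilon: "conv_vec \<upsilon>"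
proof
  fix i show "conv (\<upsilon> $ i)" unfolding conv_def
  proof (rule order_tendstoI)
    fix \<epsilon> :: real assume "\<epsilon> > 0"
    then obtain K where K: "\<And>k i. k \<ge> K \<Longrightarrow> bd (real q) (\<epsilon> / 2) (s k $ i)" using s_null[of "\<epsilon> / 2"] by auto
    have "conv (\<Sum>j<K. y (Suc j) $ i)" using conv_y by (intro conv_sum) auto
    then have "\<forall>\<^sub>F n in sequentially. absval (fps_nth (\<Sum>j<K. y (Suc j) $ i) n) * real q ^ n < \<epsilon>"
      using order_tendstoD(2) \<open>\<epsilon> > 0\<close> unfolding conv_def by blast
    then show "\<forall>\<^sub>F n in sequentially. absval (fps_nth (\<upsilon> $ i) n) * real q ^ n < \<epsilon>"
    proof eventually_elim
      case (elim n)
      have "fps_nth (\<upsilon> $ i) n = fps_nth (s K $ i) n - fps_nth (\<Sum>j<K. y (Suc j) $ i) n"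
        by (subst (1) upsilon_eq[of K]) (simp add: sum_component)
      moreover have "absval (fps_nth (s K $ i) n) * real q ^ n \<le> \<epsilon> / 2" using K by (simp add: bd_def)
      then have "absval (fps_nth (s K $ i) n) < \<epsilon> / real q ^ n"
        using \<open>\<epsilon> > 0\<close> q_pos by (simp add: field_simps)
      moreover have "absval (fps_nth (\<Sum>j<K. y (Suc j) $ i) n) < \<epsilon> / real q ^ n"
        using elim q_pos by (simp add: field_simps)
      ultimately have "absval (fps_nth (\<upsilon> $ i) n) < \<epsilon> / real q ^ n"
        using absval_diff_le[of "fps_nth (s K $ i) n" "max (absval (fps_nth (s K $ i) n)) (absval (fps_nth (\<Sum>j<K. y (Suc j) $ i) n))" "fps_nth (\<Sum>j<K. y (Suc j) $ i) n"]
        by (simp only:) linarith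
      then show ?case using q_pos by (simp add: field_simps)
    qed
  qed (auto intro!: always_eventually less_le_trans[of _ 0])
qed

definition \<zeta> :: "'c ^ 'd" where
  "\<zeta> = \<Lambda> (fps_vec f - \<upsilon>)"

text \<open>The sum of the first n + 1 terms differs from the limit by exactly
  \<open>\<Lambda> (s n)\<close>, which tends to zero by \<open>s_null\<close> and the continuity of
  \<open>\<Lambda>\<close>.\<close>

lemma Lambda_y_sums: "(\<lambda>k. \<Lambda> (y k)) sums \<zeta>"
proof -
  have cs: "conv_vec (s k)" for k unfolding s_def by (rule conv_S_funpow[OF conv_upsilon])
  have part: "(\<Sum>k<Suc n. \<Lambda> (y k)) - \<zeta> = \<Lambda> (s n)" for n
  proof -
    have "(\<Sum>k<Suc n. y k) = fps_vec f + (\<Sum>k<n. y (Suc k))"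
      by (simp add: sum.lessThan_Suc_shift y_def del: sum.lessThan_Suc)
    then have "(\<Sum>k<Suc n. y k) - (fps_vec f - \<upsilon>) = s n" using upsilon_eq[of n] by (simp add: algebra_simps)
    moreover have "conv_vec (\<Sum>k<Suc n. y k)" unfolding sum_component using conv_y by (auto intro!: conv_add conv_sum)
    moreover have "conv_vec (fps_vec f - \<upsilon>)" using conv_fps_vec conv_upsilon by (auto intro: conv_diff)
    ultimately have "\<Lambda> (s n) = \<Lambda> (\<Sum>k<Suc n. y k) - \<Lambda> (fps_vec f - \<upsilon>)" by (metis Lambda_diff)
    also have "\<Lambda> (\<Sum>k<Suc n. y k) = (\<Sum>k<Suc n. \<Lambda> (y k))" by (rule Lambda_sum) (rule conv_y)
    finally show ?thesis by (simp only: \<zeta>_def)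
  qed
  obtain C where C: "C \<ge> 0" "\<And>g B j. conv_vec g \<Longrightarrow> (\<And>i. bd (real q) B (g $ i)) \<Longrightarrow> absval (\<Lambda> g $ j) \<le> C * B"
    using Lambda_bound by blast
  have null: "(\<lambda>n. absval (\<Lambda> (s n) $ j)) \<longlonglongrightarrow> 0" for j
  proof (rule order_tendstoI)
    fix \<epsilon> :: real assume e: "\<epsilon> > 0"
    \<comment> \<open>The denominator contains C + 1 because C may be zero.\<close>
    define \<epsilon>' where "\<epsilon>' = \<epsilon> / (2 * (C + 1))"
    have e': "\<epsilon>' > 0" "C * \<epsilon>' < \<epsilon>"
      using C(1) e add_nonneg_pos[of "C * \<epsilon>" "\<epsilon> * 2"] by (auto simp: \<epsilon>'_def field_simps)
    obtain K where "\<And>k i. k \<ge> K \<Longrightarrow> bd (real q) \<epsilon>' (s k $ i)" using s_null[OF e'(1)] by auto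
    then have "absval (\<Lambda> (s k) $ j) < \<epsilon>" if "k \<ge> K" for k
      using C(2)[OF cs[of k], of \<epsilon>' j] that e'(2) by fastforce
    then show "\<forall>\<^sub>F n in sequentially. absval (\<Lambda> (s n) $ j) < \<epsilon>" by (auto simp: eventually_sequentially)
  qed (auto intro!: always_eventually less_le_trans[of _ 0])
  have "(\<lambda>n. absval ((\<Sum>k<n. \<Lambda> (y k) $ j) - \<zeta> $ j)) \<longlonglongrightarrow> 0" for j
  proof (rule LIMSEQ_imp_Suc)
    have "(\<Sum>k<Suc n. \<Lambda> (y k) $ j) - \<zeta> $ j = \<Lambda> (s n) $ j" for n
      using part[of n] by (simp only: sum_component[symmetric] vector_minus_component[symmetric])
    then show "(\<lambda>n. absval ((\<Sum>k<Suc n. \<Lambda> (y k) $ j) - \<zeta> $ j)) \<longlonglongrightarrow> 0" using null[of j] by (simp only:)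
  qed
  then show ?thesis by (simp add: sums_vec_iff sums_absval_iff)
qed

definition c :: "nat \<Rightarrow> 'c ^ 'd" where "c = sc (comb f)"

lemma coords_f: "\<kappa> (comb f) = f"
  by (rule coords_comb) (rule f_Kbar)

lemma Lambda_y: "(\<lambda>k. \<Lambda> (y k)) = tau_vec q P (\<lambda>k. vfr k (c k))"
  using Lambda_S_tau_vec[of _ "comb f"] by (simp add: fun_eq_iff y_def coords_f c_def)

lemma exp_Lambda_y: "tau_vec q Q (\<lambda>k. \<Lambda> (y k)) = (\<lambda>k. vfr k (c k))"
  by (simp only: Lambda_y tau_vec_assoc[symmetric] exp_P tau_vec_1)

text \<open>The witness is the deformed logarithm of delta_(1,z)(f); the deformed exponential
  returns the polynomial delta_(1,z)(f), which has algebraic coefficients.\<close>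

lemma stark_unit: "stark_unit Fq \<theta> E \<zeta>"
proof -
  obtain N where N: "\<And>i. i \<ge> N \<Longrightarrow> c i = 0" unfolding c_def using sc_bound_ex by metis
  define X where "X = (\<chi> j. Abs_fps (\<lambda>k. \<Lambda> (y k) $ j))"
  define p where "p = (\<chi> j. \<Sum>k<N. monom ((c k $ j) ^ (q ^ k)) k)"
  have sums: "fps_nth (X $ j) sums (\<zeta> $ j)" for j
    using Lambda_y_sums by (simp add: sums_vec_iff X_def Abs_fps_inverse)
  have "X $ j \<in> tate" for j
    \<comment> \<open>Convergence at z = 1 already makes the coefficients a null sequence.\<close>
    unfolding tate_def using sums_null_terms[OF sums[of j]] by simp
  moreover have "p $ j \<in> polys_over KK" for j
    by (auto simp: p_def c_def intro!: PK_sum PK_monom KK_power sc_KK)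
  moreover have "deformed_act q Q X = (\<chi> j. fps_of_poly (p $ j))"
  proof -
    have "fps_nth (deformed_act q Q X $ j) n = coeff (p $ j) n" for j n
    proof -
      have "fps_nth (deformed_act q Q X $ j) n = (c n $ j) ^ (q ^ n)"
        by (simp add: deformed_act_nth X_def exp_Lambda_y)
      also have "\<dots> = coeff (p $ j) n" using N[of n] by (auto simp: p_def coeff_sum)
      finally show ?thesis .
    qed
    then show ?thesis by (auto simp: vec_eq_iff intro!: fps_ext)
  qed
  ultimately show ?thesis unfolding stark_unit_def using sums by blast
qed

lemma exp_zeta: "(\<lambda>i. Q i *v vfr i \<zeta>) sums \<delta>\<^sub>1 (comb f)"
proof -
  obtain N where N: "\<And>i. i \<ge> N \<Longrightarrow> c i = 0" unfolding c_def using sc_bound_ex by metis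
  have "(\<lambda>k. vfr k (c k)) sums (\<Sum>k<N. vfr k (c k))"
    by (rule sums_finite) (auto simp: N)
  also have "(\<Sum>k<N. vfr k (c k)) = \<delta>\<^sub>1 (comb f)"
    unfolding c_def using N by (subst delta1_sum[of N]) (simp_all add: c_def)
  finally show ?thesis
    using tau_vec_sums_iff[OF exp_series_entire Lambda_y_sums] by (simp add: exp_Lambda_y)
qed

lemma stark_log_identity: "stark_log_identity Fq \<theta> E (\<delta>\<^sub>1 (comb f)) \<zeta>"
  unfolding stark_log_identity_def using stark_unit exp_zeta by blast

text \<open>\<open>\<delta>\<^sub>1\<close> cannot be applied to the single summands, as the
  \<open>u\<close> need not be algebraic. Instead the exponential of the same point is computed in
  two ways, and limits are unique.\<close>

lemma split_log_identity:
  assumes us: "\<And>l n u. (l, n, u) \<in> set us \<Longrightarrow> u \<in> log_domain Fq E"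
    and f: "f = (\<Sum>(l, n, u)\<leftarrow>us. monom 1 n *s (\<sigma>\<^sub>t ^^ l) (wv u))"
  shows "split_log_identity Fq E (\<delta>\<^sub>1 (comb f)) \<zeta>"
proof -
  have "(\<lambda>k. \<Lambda> (y k)) sums (\<Sum>(l, n, u)\<leftarrow>us. E (monom 1 n) 0 *v t_log Fq E u)"
    unfolding y_def using split_logarithm_sums[of us] us by (simp only: f[symmetric])
  then have z: "\<zeta> = (\<Sum>(l, n, u)\<leftarrow>us. E (monom 1 n) 0 *v t_log Fq E u)"
    using Lambda_y_sums sums_unique2 by blast
  have "(\<lambda>i. Q i *v vfr i \<zeta>) sums (\<Sum>(l, n, u)\<leftarrow>us. t_module_act q (E (monom 1 n)) u)"
    unfolding z by (rule exp_split_logarithm) (rule us)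
  then have Z: "\<delta>\<^sub>1 (comb f) = (\<Sum>(l, n, u)\<leftarrow>us. t_module_act q (E (monom 1 n)) u)"
    using exp_zeta sums_unique2 by blast
  \<comment> \<open>The exponent l is dropped, since \<sigma>^l changes neither sum.\<close>
  define aus :: "('c poly \<times> ('c ^ 'd)) list" where "aus = map (\<lambda>(l, n, u). (monom 1 n, u)) us"
  have "\<forall>(a, u) \<in> set aus. a \<in> polys_over Fq \<and> u \<in> log_domain Fq E"
    using us monom_Fq by (auto simp: aus_def)
  moreover have "\<zeta> = (\<Sum>(a, u)\<leftarrow>aus. E a 0 *v t_log Fq E u)"
    unfolding z aus_def by (simp add: o_def split_def)
  moreover have "\<delta>\<^sub>1 (comb f) = (\<Sum>(a, u)\<leftarrow>aus. t_module_act q (E a) u)"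
    unfolding Z aus_def by (simp add: o_def split_def)
  ultimately show ?thesis unfolding split_log_identity_def by blast
qed

lemma zeta_if_delta0_eq_0: assumes "\<delta>\<^sub>0 (comb f) = 0" shows "\<zeta> = \<Lambda> (- \<upsilon>)"
  using assms Lambda_fps_vec[OF f_Kbar]
  by (simp add: \<zeta>_def Lambda_diff[OF conv_fps_vec conv_upsilon] Lambda_minus[OF conv_upsilon])

end

subsection \<open>The matrices \<open>\<Psi>\<close> and \<open>\<Upsilon>\<close>\<close>

lemma sum_option: "(\<Sum>i\<in>(UNIV :: 'r::finite option set). g i) = g None + (\<Sum>i\<in>UNIV. g (Some i))"
proof -
  have "(\<Sum>i\<in>(UNIV :: 'r option set). g i) = g None + (\<Sum>i\<in>range Some. g i)"
    unfolding UNIV_option_conv by (rule sum.insert) auto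
  then show ?thesis by (simp add: sum.reindex)
qed

lemma block_nth [simp]:
  "block X x $ Some i $ Some j = X $ i $ j" "block X x $ Some i $ None = 0"
  "block X x $ None $ Some j = x $ j" "block X x $ None $ None = 1"
  by (simp_all add: block_def)

lemma (in c_infinity) bd_tate: assumes "g \<in> tate" shows "\<exists>B. bd 1 B g"
proof -
  have "Bseq (\<lambda>n. absval (fps_nth g n))"
    using assms unfolding tate_def by (auto intro: convergent_imp_Bseq convergentI)
  then obtain B where "\<forall>n. norm (absval (fps_nth g n)) \<le> B" by (auto simp: Bseq_def)
  then show ?thesis unfolding bd_def by (intro exI[of _ B]) auto
qed

lemma (in dual_motive) S_minus: "S (- g) = - S g"
  by (simp add: vec_eq_iff S_nth power_q.fps_map_minus sum_negf)

text \<open>The iterates \<open>\<sigma>\<^sup>-\<^sup>k \<upsilon>\<close> equal \<open>- \<psi>\<^bsup>(k)\<^esup> \<Upsilon>'\<close>; here \<open>h = F \<psi>\<close>.\<close>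

lemma (in dual_motive) S_upsilon_bound:
  fixes h :: "'c fps ^ 'r"
  assumes F: "F \<in> polys_over Fq" "F \<noteq> 0"
    and h: "fps_of_poly F *s \<upsilon> = - (h v* \<Upsilon>')"
    and Ups: "\<Upsilon>' = map_matrix fps_rt \<Upsilon>' ** \<Phi>f"
    and U: "\<And>i j. bd 1 U (\<Upsilon>' $ i $ j)"
    and G: "\<And>k j. bd 1 (G k) (fps_map (\<lambda>x. x ^ (q ^ k)) (h $ j))"
  shows "bd 1 (G k * U) ((S ^^ k) \<upsilon> $ i)"
proof -
  define hk where "hk k = (\<chi> j. fps_map (\<lambda>x. x ^ (q ^ k)) (h $ j))" for k
  \<comment> \<open>The rows of \<open>\<Upsilon>'\<close> are fixed by \<sigma>, so its inverse
    only twists the multipliers g.\<close>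
  have Sh: "S (g v* \<Upsilon>') = (\<chi> j. fps_fr (g $ j)) v* \<Upsilon>'" for g
  proof -
    have "g v* \<Upsilon>' = (g v* map_matrix fps_rt \<Upsilon>') v* \<Phi>f"
      unfolding vector_matrix_mul_assoc using arg_cong[OF Ups, of "\<lambda>X. g v* X"] .
    also have "g v* map_matrix fps_rt \<Upsilon>' = (\<chi> i. fps_rt (((\<chi> j. fps_fr (g $ j)) v* \<Upsilon>') $ i))"
      by (simp add: vec_eq_iff vector_matrix_mult_def rt.fps_map_sum rt.fps_map_mult)
    finally have "g v* \<Upsilon>' = (\<chi> i. fps_rt (((\<chi> j. fps_fr (g $ j)) v* \<Upsilon>') $ i)) v* \<Phi>f" .
    then show ?thesis by (simp only: S_rt)
  qed
  have "fps_of_poly F *s (S ^^ k) \<upsilon> = - (hk k v* \<Upsilon>')"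
  proof (induction k)
    case 0
    have "fps_map (\<lambda>x. x) (h $ j) = h $ j" for j by (rule fps_ext) simp
    then have "hk 0 = h" by (simp add: hk_def vec_eq_iff)
    then show ?case using h by (simp only: funpow_0)
  next
    case (Suc k)
    have "fps_of_poly F *s (S ^^ Suc k) \<upsilon> = S (fps_of_poly F *s (S ^^ k) \<upsilon>)"
      by (simp only: S_smult fps_map_Fq[OF F(1)] funpow.simps o_apply)
    also have "\<dots> = - ((\<chi> j. fps_fr (hk k $ j)) v* \<Upsilon>')" by (simp only: Suc S_minus Sh)
    also have "(\<chi> j. fps_fr (hk k $ j)) = hk (Suc k)"
    proof -
      have "(x ^ (q ^ k)) ^ q = x ^ (q ^ Suc k)" for x :: 'c by (simp add: power_mult[symmetric] mult.commute)
      then have "fps_fr (fps_map (\<lambda>x. x ^ (q ^ k)) g) = fps_map (\<lambda>x. x ^ (q ^ Suc k)) g" for g :: "'c fps"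
        by (intro fps_ext) (simp only: fps_map_nth)
      then show ?thesis by (simp only: hk_def vec_lambda_beta)
    qed
    finally show ?case .
  qed
  then have "(fps_of_poly F *s (S ^^ k) \<upsilon>) $ i = (- (hk k v* \<Upsilon>')) $ i" by (rule arg_cong)
  then have "fps_of_poly F * (S ^^ k) \<upsilon> $ i = - ((hk k v* \<Upsilon>') $ i)" by simp
  moreover have "bd 1 (G k * U) ((hk k v* \<Upsilon>') $ i)"
    unfolding vector_matrix_mult_def vec_lambda_beta
  proof (rule bd_sum)
    have "0 \<le> G k" using bd_nonneg[OF _ G] by simp
    moreover have "0 \<le> U" using bd_nonneg[OF _ U] by simp
    ultimately show "0 \<le> G k * U" by simp
    show "bd 1 (G k * U) (hk k $ j * \<Upsilon>' $ j $ i)" for j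
      unfolding hk_def vec_lambda_beta by (rule bd_mult[OF _ G U]) simp
  qed simp
  ultimately have "bd 1 (G k * U) (fps_of_poly F * (S ^^ k) \<upsilon> $ i)" by (simp only: bd_minus)
  then show ?thesis by (rule bd_cancel_Fq[OF F])
qed

context c_infinity
begin

text \<open>Twisting \<Upsilon> \<Psi> = 1 and inserting \<Psi>^(-1) = \<Phi> \<Psi> gives
  \<Upsilon>^(-1) \<Phi> \<Psi> = 1, where (-1) denotes the twist. Cancelling \<Psi> happens over
  Laurent series, and the result descends to power series by injectivity.\<close>

lemma rt_inverse_block:
  fixes \<Psi> :: "'c fls ^ 'n ^ 'n" and \<Upsilon> :: "'c fps ^ 'n ^ 'n"
  assumes Psi_eq: "map_matrix (frob_fls q (- 1)) \<Psi> = map_matrix fls_of_poly \<Phi> ** \<Psi>"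
    and inv: "map_matrix fps_to_fls \<Upsilon> ** \<Psi> = mat 1" "\<Psi> ** map_matrix fps_to_fls \<Upsilon> = mat 1"
  shows "map_matrix fps_rt \<Upsilon> ** map_matrix fps_of_poly \<Phi> = \<Upsilon>"
proof -
  define R :: "'c fls ^ 'n ^ 'n \<Rightarrow> 'c fls ^ 'n ^ 'n" where "R = map_matrix (fls_map rt)"
  have R: "R (A ** B) = R A ** R B" for A B
    by (simp add: R_def vec_eq_iff matrix_matrix_mult_def rt.fls_map_sum rt.fls_map_mult)
  have R1: "R (mat 1) = mat 1" by (simp add: R_def vec_eq_iff mat_def)
  let ?Y = "map_matrix fps_to_fls \<Upsilon>" and ?P = "map_matrix fls_of_poly \<Phi>"
  have RPsi: "R \<Psi> = ?P ** \<Psi>" using Psi_eq by (simp add: R_def frob_fls_rt[abs_def])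
  have "R ?Y ** (?P ** \<Psi>) = mat 1" using arg_cong[OF inv(1), of R] by (simp only: R R1 RPsi)
  then have "(R ?Y ** ?P) ** (\<Psi> ** ?Y) = ?Y" by (metis matrix_mul_assoc matrix_mul_lid)
  then have "R ?Y ** ?P = ?Y" by (simp add: inv)
  moreover have "R ?Y = map_matrix fps_to_fls (map_matrix fps_rt \<Upsilon>)"
    by (simp add: R_def vec_eq_iff rt.fls_map_fps)
  moreover have "?P = map_matrix fps_to_fls (map_matrix fps_of_poly \<Phi>)"
    by (simp add: vec_eq_iff fls_of_poly_def)
  ultimately have "map_matrix fps_to_fls (map_matrix fps_rt \<Upsilon> ** map_matrix fps_of_poly \<Phi>) = ?Y"
    by (simp only: map_matrix_fps_mult)
  then have "fps_to_fls ((map_matrix fps_rt \<Upsilon> ** map_matrix fps_of_poly \<Phi>) $ i $ j) = fps_to_fls (\<Upsilon> $ i $ j)" for i j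
    by (metis map_matrix_nth)
  then show ?thesis by (simp add: vec_eq_iff)
qed

text \<open>A real supremum is an upper bound only for a bounded family; any finite \<open>B\<close>
  secures this.\<close>

lemma gauss_norm_bd:
  assumes "bd 1 B g"
  shows "bd 1 (gauss_norm (fps_to_fls g)) g"
  unfolding bd_def
proof
  fix n
  have B: "0 \<le> B" using bd_nonneg[OF _ assms] by simp
  have "bdd_above (range (\<lambda>n. absval (fls_nth (fps_to_fls g) n)))"
    using assms B by (intro bdd_aboveI2[of _ _ B]) (auto simp: bd_def)
  then have "absval (fls_nth (fps_to_fls g) (int n)) \<le> gauss_norm (fps_to_fls g)"
    unfolding gauss_norm_def by (rule cSUP_upper[rotated]) simp
  then show "absval (fps_nth g n) * 1 ^ n \<le> gauss_norm (fps_to_fls g)" by simp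
qed

end

theorem theorem3p5:
  fixes Fq :: "'c::{field,metric_space} set" and \<theta> :: 'c
    and M :: "('c, 'm::ab_group_add) tsigma_ops"
    and m :: "'r::finite \<Rightarrow> 'm" and w :: "'d::finite \<Rightarrow> 'm"
    and E :: "('c, 'd) t_module"
    and \<Phi>' :: "'c poly ^ 'r ^ 'r" and f :: "'c poly ^ 'r"
    and \<Psi>' :: "'c fls ^ 'r ^ 'r" and \<psi> :: "'c fls ^ 'r"
    and \<Upsilon>' :: "'c fps ^ 'r ^ 'r" and \<upsilon> :: "'c fps ^ 'r"
    and \<Phi> :: "'c poly ^ 'r option ^ 'r option"
    and \<Psi> :: "'c fls ^ 'r option ^ 'r option"
    and \<Upsilon> :: "'c fps ^ 'r option ^ 'r option"
    and F :: "'c poly" and v :: "'c ^ 'd"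
  assumes C_infty: "c_infinity Fq \<theta>"
    and motive: "effective_dual_t_motive Fq \<theta> M"
    and t_basis: "is_t_basis Fq \<theta> M UNIV m"
    and sigma_basis: "is_sigma_basis Fq \<theta> M w"
    and Phi'_Kbar: "\<And>i j. \<Phi>' $ i $ j \<in> polys_over (Kbar Fq \<theta>)"
    and Phi'_sigma: "\<And>i. sigma M (m i) = (\<Sum>j\<in>UNIV. poly_act M (\<Phi>' $ i $ j) (m j))"
    and E: "associated_t_module Fq \<theta> M w E"
    and f_Kbar: "\<And>i. f $ i \<in> polys_over (Kbar Fq \<theta>)"
    and Phi: "\<Phi> = block \<Phi>' f"
    and Psi: "\<Psi> = block \<Psi>' \<psi>"
    and Psi_frac: "\<And>i j. \<Psi> $ i $ j \<in> tate_frac"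
    and Psi_GL: "invertible \<Psi>"
    and Psi_eq: "map_matrix (frob_fls (card Fq) (- 1)) \<Psi> = map_matrix fls_of_poly \<Phi> ** \<Psi>"
    and Upsilon: "\<Upsilon> = block \<Upsilon>' \<upsilon>"
    and Upsilon_tate: "\<And>i j. \<Upsilon> $ i $ j \<in> tate"
    and Upsilon_inv: "map_matrix fps_to_fls \<Upsilon> = matrix_inv \<Psi>"
    and v: "v = delta1 Fq \<theta> M w (\<Sum>i\<in>UNIV. poly_act M (f $ i) (m i))"
    and F: "F \<in> polys_over Fq" "F \<noteq> 0"
    and F_Psi: "\<And>i j. fls_of_poly F * \<Psi> $ i $ j \<in> fps_to_fls ` tate"
    and F_psi_lim: "(\<lambda>k. gauss_norm_vec (\<chi> j. fls_of_poly F * frob_fls (card Fq) (int k) (\<psi> $ j))) \<longlonglongrightarrow> 0"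
  shows "stark_unit Fq \<theta> E (delta0_ext Fq \<theta> M m w (\<chi> i. fps_of_poly (f $ i) - \<upsilon> $ i))
    \<and> stark_log_identity Fq \<theta> E v (delta0_ext Fq \<theta> M m w (\<chi> i. fps_of_poly (f $ i) - \<upsilon> $ i))
    \<and> ((\<exists>us :: (nat \<times> nat \<times> ('c ^ 'd)) list.
          (\<forall>(l, n, u) \<in> set us. u \<in> log_domain Fq E) \<and>
          f = (\<Sum>(l, n, u)\<leftarrow>us.
                 monom 1 n *s (sigma_coord (card Fq) \<Phi>' ^^ l)
                   (\<Sum>j\<in>UNIV. [:u $ j:] *s t_coords Fq \<theta> M m (w j))))
       \<longrightarrow> split_log_identity Fq E v (delta0_ext Fq \<theta> M m w (\<chi> i. fps_of_poly (f $ i) - \<upsilon> $ i)))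
    \<and> (delta0 Fq \<theta> M w (\<Sum>i\<in>UNIV. poly_act M (f $ i) (m i)) = 0
       \<longrightarrow> delta0_ext Fq \<theta> M m w (\<chi> i. fps_of_poly (f $ i) - \<upsilon> $ i)
           = delta0_ext Fq \<theta> M m w (\<chi> i. - \<upsilon> $ i))"
proof -
  interpret c_infinity Fq \<theta> by (rule C_infty)
  interpret dual_motive_module Fq \<theta> M m w \<Phi>' E
  proof (intro dual_motive_module.intro dual_motive.intro dual_motive_axioms.intro dual_motive_module_axioms.intro C_infty)
    show "tsigma_module Fq \<theta> M" using motive by (simp add: effective_dual_t_motive_def)
    show "\<exists>L. \<forall>x. poly_act M ([:- \<theta>, 1:] ^ L) x \<in> range (sigma M)"
      using motive unfolding effective_dual_t_motive_def by blast
  qed (fact t_basis sigma_basis Phi'_Kbar Phi'_sigma E)+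
  have "matrix_inv \<Psi> ** \<Psi> = mat 1" "\<Psi> ** matrix_inv \<Psi> = mat 1"
    using Psi_GL someI_ex[of "\<lambda>A'. \<Psi> ** A' = mat 1 \<and> A' ** \<Psi> = mat 1"]
    unfolding invertible_def matrix_inv_def by auto
  then have inv: "map_matrix fps_to_fls \<Upsilon> ** \<Psi> = mat 1" "\<Psi> ** map_matrix fps_to_fls \<Upsilon> = mat 1"
    by (simp_all add: Upsilon_inv)
  note Y = rt_inverse_block[OF Psi_eq inv]
  \<comment> \<open>The last row of \<Upsilon>^(-1) \<Phi> = \<Upsilon>; the corner entry 1
    contributes f.\<close>
  have ups: "\<upsilon> = (\<chi> i. fps_rt (\<upsilon> $ i)) v* \<Phi>f + (\<chi> i. fps_of_poly (f $ i))"
  proof -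
    have "(map_matrix fps_rt \<Upsilon> ** map_matrix fps_of_poly \<Phi>) $ None $ Some j = \<upsilon> $ j" for j
      unfolding Y by (simp add: Upsilon)
    then have "fps_rt 1 * fps_of_poly (f $ j) + (\<Sum>i\<in>UNIV. fps_rt (\<upsilon> $ i) * fps_of_poly (\<Phi>' $ i $ j)) = \<upsilon> $ j" for j
      by (simp add: matrix_matrix_mult_def sum_option Upsilon Phi)
    moreover have "fps_rt 1 = 1" by (rule fps_ext) (simp add: fps_one_nth)
    ultimately show ?thesis by (simp add: vec_eq_iff vector_matrix_mult_def mult.commute add.commute)
  qed
  \<comment> \<open>The upper left block of the same identity.\<close>
  have Ups': "\<Upsilon>' = map_matrix fps_rt \<Upsilon>' ** \<Phi>f"
  proof -
    have "(map_matrix fps_rt \<Upsilon> ** map_matrix fps_of_poly \<Phi>) $ Some i $ Some j = \<Upsilon>' $ i $ j" for i j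
      unfolding Y by (simp add: Upsilon)
    then have "(\<Sum>k\<in>UNIV. fps_rt (\<Upsilon>' $ i $ k) * fps_of_poly (\<Phi>' $ k $ j)) = \<Upsilon>' $ i $ j" for i j
      by (simp add: matrix_matrix_mult_def sum_option Upsilon Phi)
    then show ?thesis by (simp add: vec_eq_iff matrix_matrix_mult_def)
  qed
  have "\<exists>h. \<forall>j. fls_of_poly F * \<psi> $ j = fps_to_fls (h $ j) \<and> h $ j \<in> tate"
  proof -
    have "\<forall>j. \<exists>g\<in>tate. fls_of_poly F * \<psi> $ j = fps_to_fls g"
      using F_Psi[of None "Some _"] by (auto simp: Psi)
    then obtain h where "\<forall>j. h j \<in> tate \<and> fls_of_poly F * \<psi> $ j = fps_to_fls (h j)" by metis
    then show ?thesis by (intro exI[of _ "\<chi> j. h j"]) simp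
  qed
  then obtain h where h: "\<And>j. fls_of_poly F * \<psi> $ j = fps_to_fls (h $ j)" "\<And>j. h $ j \<in> tate" by blast
  \<comment> \<open>The last row of \<Psi> \<Upsilon> = 1, multiplied by \<open>F\<close> to stay
    within power series.\<close>
  have hY: "fps_of_poly F *s \<upsilon> = - (h v* \<Upsilon>')"
  proof -
    have "fps_to_fls (fps_of_poly F * \<upsilon> $ j + (\<Sum>i\<in>UNIV. h $ i * \<Upsilon>' $ i $ j)) = 0" for j
    proof -
      have "(\<Psi> ** map_matrix fps_to_fls \<Upsilon>) $ None $ Some j = 0" by (simp add: inv mat_def)
      then have "fps_to_fls (\<upsilon> $ j) + (\<Sum>i\<in>UNIV. \<psi> $ i * fps_to_fls (\<Upsilon>' $ i $ j)) = 0"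
        by (simp add: matrix_matrix_mult_def sum_option Upsilon Psi)
      then have "fls_of_poly F * (fps_to_fls (\<upsilon> $ j) + (\<Sum>i\<in>UNIV. \<psi> $ i * fps_to_fls (\<Upsilon>' $ i $ j))) = 0" by simp
      then show ?thesis
        by (simp add: distrib_left sum_distrib_left mult.assoc[symmetric] h fps_to_fls_sum fls_times_fps_to_fls)
          (simp add: fls_of_poly_def)
    qed
    then have "fps_of_poly F * \<upsilon> $ j + (\<Sum>i\<in>UNIV. h $ i * \<Upsilon>' $ i $ j) = 0" for j
      by (simp only: fps_to_fls_eq_0_iff)
    then show ?thesis by (simp add: vec_eq_iff vector_matrix_mult_def eq_neg_iff_add_eq_0 mult.commute)
  qed
  define G where "G k = gauss_norm_vec (\<chi> j. fls_of_poly F * frob_fls q (int k) (\<psi> $ j))" for k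
  have G: "bd 1 (G k) (fps_map (\<lambda>x. x ^ (q ^ k)) (h $ j))" for k j
  proof -
    obtain b where b: "bd 1 b (h $ j)" using bd_tate[OF h(2)] by blast
    \<comment> \<open>A crude bound, only to make the supremum in the Gauss norm finite.\<close>
    have "bd 1 (b ^ (q ^ k)) (fps_map (\<lambda>x. x ^ (q ^ k)) (h $ j))"
      using b by (auto simp: bd_def absval_power intro!: power_mono)
    then have bd: "bd 1 (gauss_norm (fps_to_fls (fps_map (\<lambda>x. x ^ (q ^ k)) (h $ j)))) (fps_map (\<lambda>x. x ^ (q ^ k)) (h $ j))"
      by (rule gauss_norm_bd)
    \<comment> \<open>The twist fixes \<open>F\<close>, whose coefficients lie in the finite field,
      so F \<psi>^(k) is the k-th twist of F \<psi>.\<close>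
    have "fls_of_poly F * frob_fls q (int k) (\<psi> $ j) = fls_map (\<lambda>x. x ^ (q ^ k)) (fls_of_poly F * \<psi> $ j)"
      by (simp add: frob_fls_int power_q_power.fls_map_mult fls_of_poly_def power_q_power.fls_map_fps fps_map_Fq[OF F(1)])
    then have "fps_to_fls (fps_map (\<lambda>x. x ^ (q ^ k)) (h $ j)) = fls_of_poly F * frob_fls q (int k) (\<psi> $ j)"
      by (simp add: h power_q_power.fls_map_fps)
    moreover have "gauss_norm (fls_of_poly F * frob_fls q (int k) (\<psi> $ j)) \<le> G k"
      unfolding G_def gauss_norm_vec_def by (rule Max_ge) auto
    ultimately show ?thesis using bd by (auto intro: bd_mono)
  qed
  have "\<exists>U. \<forall>i j. bd 1 U (\<Upsilon>' $ i $ j)"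
  proof -
    have "\<forall>i j. \<exists>B. bd 1 B (\<Upsilon>' $ i $ j)" using Upsilon_tate[of "Some _" "Some _"] bd_tate by (simp add: Upsilon)
    then obtain b where b: "\<And>i j. bd 1 (b i j) (\<Upsilon>' $ i $ j)" by metis
    have "b i j \<le> Max (range (\<lambda>(i, j). b i j))" for i j by (rule Max_ge) auto
    then show ?thesis using bd_mono[OF b] by blast
  qed
  then obtain U where U: "\<And>i j. bd 1 U (\<Upsilon>' $ i $ j)" by blast
  interpret ext: dual_motive_extension Fq \<theta> M m w \<Phi>' E f \<upsilon> "\<lambda>k. G k * U"
  proof unfold_locales
    show "bd 1 (G k * U) ((S ^^ k) \<upsilon> $ i)" for k i
      by (rule S_upsilon_bound[OF F hY Ups' U G])
    show "(\<lambda>k. G k * U) \<longlonglongrightarrow> 0"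
      using F_psi_lim unfolding G_def by (rule tendsto_mult_left_zero)
  qed (fact f_Kbar ups)+
  have z: "ext.\<zeta> = delta0_ext Fq \<theta> M m w (\<chi> i. fps_of_poly (f $ i) - \<upsilon> $ i)"
    unfolding ext.\<zeta>_def by (rule arg_cong[of _ _ \<Lambda>]) (simp add: vec_eq_iff fps_vec_def)
  have v': "v = \<delta>\<^sub>1 (comb f)" by (simp add: v comb_def)
  show ?thesis unfolding z[symmetric] v'
  proof (intro conjI impI)
    show "stark_unit Fq \<theta> E ext.\<zeta>" by (rule ext.stark_unit)
    show "stark_log_identity Fq \<theta> E (\<delta>\<^sub>1 (comb f)) ext.\<zeta>" by (rule ext.stark_log_identity)
  next
    assume "\<exists>us :: (nat \<times> nat \<times> ('c ^ 'd)) list.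
          (\<forall>(l, n, u) \<in> set us. u \<in> log_domain Fq E) \<and>
          f = (\<Sum>(l, n, u)\<leftarrow>us.
                 monom 1 n *s (sigma_coord (card Fq) \<Phi>' ^^ l)
                   (\<Sum>j\<in>UNIV. [:u $ j:] *s t_coords Fq \<theta> M m (w j)))"
    then obtain us :: "(nat \<times> nat \<times> ('c ^ 'd)) list" where us: "\<forall>(l, n, u) \<in> set us. u \<in> log_domain Fq E"
      "f = (\<Sum>(l, n, u)\<leftarrow>us. monom 1 n *s (sigma_coord q \<Phi>' ^^ l) (wv u))"
      unfolding wv_def by blast
    show "split_log_identity Fq E (\<delta>\<^sub>1 (comb f)) ext.\<zeta>"
      by (rule ext.split_log_identity[OF _ us(2)]) (use us(1) in auto)
  next
    assume "\<delta>\<^sub>0 (\<Sum>i\<in>UNIV. poly_act M (f $ i) (m i)) = 0"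
    then have "ext.\<zeta> = \<Lambda> (- \<upsilon>)" by (intro ext.zeta_if_delta0_eq_0) (simp add: comb_def)
    also have "- \<upsilon> = (\<chi> i. - \<upsilon> $ i)" by (simp add: vec_eq_iff)
    finally show "ext.\<zeta> = \<Lambda> (\<chi> i. - \<upsilon> $ i)" .
  qed
qed

end
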